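(* Let $\Omega\subset\mathbb{R}^n$ be a connected open set with piecewise $C^1$ boundary, and let $\mu$ be a probability measure on $\Omega$, with Lebesgue density positive in $\Omega$, having Gaussian copula $\mathcal{C}_\Sigma$, where $\Sigma$ is a symmetric positive definite $n\times n$ matrix with $\Sigma_{i,i}=1$ for all $i$ and $\Sigma_{i,j}\in(-1,1)$ for $i\neq j$. Assume that each marginal distribution $\mu_i$, $i\in\{1,\dots,n\}$, is uniformly log-concave, that is, it has density $\rho_i=e^{-V_i}$ satisfying $V_i''\ge\kappa_i>0$ for some constant $\kappa_i$. Then $\mu$ satisfies a classical Poincaré inequality with optimal constant such that $$C_P(\mu)\le\lambda_{\max}(\Sigma)\,\max_{i}\frac{1}{\kappa_i},$$ where $\lambda_{\max}(\Sigma)$ is the largest eigenvalue of $\Sigma$.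
   Context: A probability measure $\mu$ on $\Omega$ satisfies a classical Poincaré inequality with finite constant $C>0$ if $$\mathrm{Var}_\mu(f):=\int_\Omega f^2\,d\mu-\Big(\int_\Omega f\,d\mu\Big)^2\le C\int_\Omega\|\nabla f\|^2\,d\mu$$ for all $f\in L^2(\mu)$ for which the right-hand side is finite, where $\nabla f$ is the gradient of weak partial derivatives (so $f$ is understood to be weakly differentiable) and $\|\cdot\|$ is the Euclidean norm. $C_P(\mu)$ denotes the smallest such constant. The copula of $\mu$ is the unique function $\mathcal{C}:[0,1]^n\to[0,1]$ such that $F(x_1,\dots,x_n)=\mathcal{C}(F_1(x_1),\dots,F_n(x_n))$ for all $x\in\mathbb{R}^n$, where $F$ is the cumulative distribution function of $\mu$ and $F_i$ that of its $i$-th marginal $\mu_i$. The Gaussian copula $\mathcal{C}_\Sigma$ is the copula of the centered multivariate normal distribution $\mathcal{N}(0,\Sigma)$. The condition $V_i''\ge\kappa_i$ holds on the open interval where $\mu_i$ has positive density. Standing convention: the Nataf transformation $T(\tilde x)=(F_1^{-1}\circ\Phi(\tilde x_1),\dots,F_n^{-1}\circ\Phi(\tilde x_n))$, where $\Phi$ is the cumulative distribution function of $\mathcal{N}(0,1)$, is a diffeomorphism from $\mathbb{R}^n$ onto $\Omega$ (in particular $\Omega$ is a product of open intervals). *)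

theory Defs
  imports "HOL-Probability.Probability"
begin

section \<open>Regularity of functions and domains\<close>

definition C1_on :: "('a::real_normed_vector \<Rightarrow> 'b::real_normed_vector) \<Rightarrow> 'a set \<Rightarrow> bool" where
  "C1_on f S \<longleftrightarrow>
    (\<exists>f'. (\<forall>x\<in>S. (f has_derivative blinfun_apply (f' x)) (at x)) \<and> continuous_on S f')"

text \<open>Only used between open sets.\<close>
definition diffeomorphism ::
    "'a::real_normed_vector set \<Rightarrow> 'b::real_normed_vector set \<Rightarrow> ('a \<Rightarrow> 'b) \<Rightarrow> bool" where
  "diffeomorphism S T f \<longleftrightarrow> (\<exists>g. homeomorphism S T f g \<and> C1_on f S \<and> C1_on g T)"

text \<open>A continuous function that coincides at every point with one of finitely many
  \<open>C\<^sup>1\<close> functions, such as a maximum of finitely many affine functions.\<close>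
definition piecewise_C1_on :: "('a::real_normed_vector \<Rightarrow> real) \<Rightarrow> 'a set \<Rightarrow> bool" where
  "piecewise_C1_on \<gamma> U \<longleftrightarrow> continuous_on U \<gamma> \<and>
    (\<exists>G. finite G \<and> (\<forall>g\<in>G. C1_on g U) \<and> (\<forall>y\<in>U. \<exists>g\<in>G. \<gamma> y = g y))"

text \<open>Near each boundary point the domain is the strict epigraph, in some unit direction \<open>e\<close>,
  of a piecewise \<open>C\<^sup>1\<close> function of the component orthogonal to \<open>e\<close>: this is what the invariance
  of \<open>\<gamma>\<close> under translations along \<open>e\<close> expresses. Products of open intervals qualify.\<close>
definition piecewise_C1_boundary :: "'a::euclidean_space set \<Rightarrow> bool" where
  "piecewise_C1_boundary \<Omega> \<longleftrightarrow>
    (\<forall>p\<in>frontier \<Omega>. \<exists>U e \<gamma>. open U \<and> p \<in> U \<and> norm e = 1 \<and>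
       (\<forall>y t. \<gamma> (y + t *\<^sub>R e) = \<gamma> y) \<and> piecewise_C1_on \<gamma> U \<and>
       \<Omega> \<inter> U = {y\<in>U. \<gamma> y < y \<bullet> e})"


section \<open>Weak gradients\<close>

primrec Ck :: "nat \<Rightarrow> (real^'n \<Rightarrow> real) \<Rightarrow> bool" where
  "Ck 0 f \<longleftrightarrow> continuous_on UNIV f"
| "Ck (Suc k) f \<longleftrightarrow> (\<exists>D. (\<forall>x. GDERIV f x :> D x) \<and> (\<forall>i. Ck k (\<lambda>x. D x $ i)))"

definition test_function :: "(real^'n) set \<Rightarrow> (real^'n \<Rightarrow> real) \<Rightarrow> bool" where
  "test_function \<Omega> \<phi> \<longleftrightarrow> (\<forall>k. Ck k \<phi>) \<and>
    (\<exists>K. compact K \<and> K \<subseteq> \<Omega> \<and> (\<forall>x. x \<notin> K \<longrightarrow> \<phi> x = 0))"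

definition locally_integrable_on ::
    "('a::euclidean_space \<Rightarrow> 'b::euclidean_space) \<Rightarrow> 'a set \<Rightarrow> bool" where
  "locally_integrable_on f \<Omega> \<longleftrightarrow> (\<forall>K. compact K \<and> K \<subseteq> \<Omega> \<longrightarrow> set_integrable lborel K f)"

definition weak_gradient ::
    "(real^'n) set \<Rightarrow> (real^'n \<Rightarrow> real) \<Rightarrow> (real^'n \<Rightarrow> real^'n) \<Rightarrow> bool" where
  "weak_gradient \<Omega> f G \<longleftrightarrow> locally_integrable_on f \<Omega> \<and> locally_integrable_on G \<Omega> \<and>
    (\<forall>\<phi> D i. test_function \<Omega> \<phi> \<longrightarrow> (\<forall>x. GDERIV \<phi> x :> D x) \<longrightarrow>
       (LINT x:\<Omega>|lborel. f x * D x $ i) = - (LINT x:\<Omega>|lborel. G x $ i * \<phi> x))"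


section \<open>Poincar\'e inequalities\<close>

text \<open>Weak gradients are unique almost everywhere on \<open>\<Omega>\<close>, so quantifying over all of them amounts
  to using \emph{the} weak gradient. Membership in \<open>L\<^sup>2\<close> and finiteness of the right-hand side are
  explicit premises, since the Bochner integral of a non-integrable function is 0.\<close>
definition poincare_inequality :: "(real^'n) set \<Rightarrow> (real^'n) measure \<Rightarrow> real \<Rightarrow> bool" where
  "poincare_inequality \<Omega> \<mu> C \<longleftrightarrow>
    (\<forall>f G. f \<in> borel_measurable \<mu> \<longrightarrow> integrable \<mu> (\<lambda>x. (f x)\<^sup>2) \<longrightarrow>
       weak_gradient \<Omega> f G \<longrightarrow> integrable \<mu> (\<lambda>x. (norm (G x))\<^sup>2) \<longrightarrow>
       (LINT x|\<mu>. (f x)\<^sup>2) - (LINT x|\<mu>. f x)\<^sup>2 \<le> C * (LINT x|\<mu>. (norm (G x))\<^sup>2))"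

text \<open>Meaningful as the smallest constant only if some constant is admissible and the infimum is
  itself admissible.\<close>
definition poincare_constant :: "(real^'n) set \<Rightarrow> (real^'n) measure \<Rightarrow> real" where
  "poincare_constant \<Omega> \<mu> = Inf {C. 0 < C \<and> poincare_inequality \<Omega> \<mu> C}"


section \<open>Marginals, copulas and the Nataf transformation\<close>

definition marginal :: "(real^'n) measure \<Rightarrow> 'n \<Rightarrow> real measure" where
  "marginal \<mu> i = distr \<mu> borel (\<lambda>x. x $ i)"

definition joint_cdf :: "(real^'n) measure \<Rightarrow> real^'n \<Rightarrow> real" where
  "joint_cdf \<mu> x = measure \<mu> {y. \<forall>i. y $ i \<le> x $ i}"

text \<open>The defining identity determines \<open>C\<close> exactly on the product of the ranges of the marginal
  distribution functions. For continuous marginals these ranges contain \<open>(0,1)\<close>, so two such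
  functions can differ at most on the boundary of the cube, at values not attained.\<close>
definition copula_of :: "(real^'n) measure \<Rightarrow> (real^'n \<Rightarrow> real) \<Rightarrow> bool" where
  "copula_of \<mu> C \<longleftrightarrow>
    (\<forall>u. (\<forall>i. u $ i \<in> {0..1}) \<longrightarrow> C u \<in> {0..1}) \<and>
    (\<forall>x. joint_cdf \<mu> x = C (\<chi> i. cdf (marginal \<mu> i) (x $ i)))"

definition centered_normal :: "real^'n^'n \<Rightarrow> (real^'n) measure" where
  "centered_normal \<Sigma> = density lborel
    (\<lambda>x. ennreal (exp (- (x \<bullet> (matrix_inv \<Sigma> *v x)) / 2) / sqrt ((2 * pi) ^ CARD('n) * det \<Sigma>)))"

abbreviation gaussian_copula :: "real^'n^'n \<Rightarrow> (real^'n \<Rightarrow> real) \<Rightarrow> bool" where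
  "gaussian_copula \<Sigma> C \<equiv> copula_of (centered_normal \<Sigma>) C"

definition std_normal_cdf :: "real \<Rightarrow> real" where
  "std_normal_cdf = cdf (density lborel std_normal_density)"

text \<open>The inverse of the distribution function wherever the latter is continuous and strictly
  increasing.\<close>
definition quantile :: "real measure \<Rightarrow> real \<Rightarrow> real" where
  "quantile M u = Inf {x. u \<le> cdf M x}"

definition nataf :: "(real^'n) measure \<Rightarrow> real^'n \<Rightarrow> real^'n" where
  "nataf \<mu> x = (\<chi> i. quantile (marginal \<mu> i) (std_normal_cdf (x $ i)))"

text \<open>\<open>J\<close> is the open interval on which the density \<open>exp (- V)\<close> is positive; \<open>V\<close> is irrelevant
  outside \<open>J\<close>.\<close>
definition uniformly_log_concave :: "real measure \<Rightarrow> real \<Rightarrow> bool" where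
  "uniformly_log_concave M \<kappa> \<longleftrightarrow> 0 < \<kappa> \<and>
    (\<exists>J V V' V''. open J \<and> is_interval J \<and>
       M = density lborel (\<lambda>x. ennreal (indicator J x * exp (- V x))) \<and>
       (\<forall>x\<in>J. (V has_real_derivative V' x) (at x) \<and>
              (V' has_real_derivative V'' x) (at x) \<and> \<kappa> \<le> V'' x))"


section \<open>Matrices\<close>

definition symmetric_positive_definite :: "real^'n^'n \<Rightarrow> bool" where
  "symmetric_positive_definite A \<longleftrightarrow> transpose A = A \<and> (\<forall>x. x \<noteq> 0 \<longrightarrow> 0 < x \<bullet> (A *v x))"

text \<open>The largest real eigenvalue; only used for symmetric matrices.\<close>
definition lambda_max :: "real^'n^'n \<Rightarrow> real" where
  "lambda_max A = Max {l. \<exists>v. v \<noteq> 0 \<and> A *v v = l *\<^sub>R v}"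

end

theory Submission
  imports Defs "HOL-Computational_Algebra.Polynomial"
begin

text \<open>
  The Nataf transformation \<open>T\<close> acts coordinatewise, by the increasing functions that carry the
  standard normal distribution to the marginals of \<open>\<mu>\<close>. Since \<open>\<mu>\<close> and \<open>N(0, \<Sigma>)\<close> have the same
  copula, \<open>T\<close> carries \<open>N(0, \<Sigma>)\<close> to \<open>\<mu>\<close> (\<open>mu_eq_distr\<close>). Hence the variance of \<open>f\<close> under \<open>\<mu>\<close> is that of
  \<open>f \<circ> T\<close> under \<open>N(0, \<Sigma>)\<close>, and two estimates give the constant.

  The first is one-dimensional. If a marginal has density \<open>exp (- V)\<close> with \<open>V'' \<ge> \<kappa>\<close>, the increasing
  transport from the standard normal distribution has derivative at most \<open>1 / \<surd>\<kappa>\<close>; this is Caffarelli's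
  theorem on the line, proved by a maximum principle (\<open>nataf1_derivative_bound\<close>). The derivative of \<open>T\<close>
  is diagonal with these entries, so composition with \<open>T\<close> increases the squared norm of a gradient at
  most by the factor \<open>max (1 / \<kappa> i)\<close>.

  The second is the Gaussian inequality \<open>Var h \<le> E (\<nabla>h \<bullet> \<Sigma> \<nabla>h)\<close> (\<open>gaussian_poincare\<close>), whose right-hand
  side is at most \<open>lambda_max \<Sigma>\<close> times the Dirichlet energy (\<open>quadratic_form_le_lambda_max\<close>). It follows
  by rotating a pair of independent copies, which preserves their joint law, and integrating by parts.

  The function \<open>f\<close> is only weakly differentiable in \<open>\<Omega>\<close>, and the Gaussian inequality is first obtained
  for \<open>C\<^sup>1\<close> functions of compact support. Therefore \<open>f \<circ> T\<close> is multiplied by a cutoff of radius \<open>R\<close>, whose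
  support \<open>T\<close> carries to a compact subset of \<open>\<Omega>\<close>. There \<open>\<mu>\<close> is comparable with Lebesgue measure
  (\<open>compare_lborel_mu\<close>), so that mollifications of \<open>f\<close> and their gradients converge in \<open>L\<^sup>2(\<mu>)\<close> to \<open>f\<close> and its
  weak gradient (\<open>poincare_cutoff\<close>). The gradient of the cutoff is \<open>O(1/R)\<close> and disappears as \<open>R\<close> tends to
  infinity (\<open>poincare_inequality_nataf\<close>).

  Admissible constants are closed under infima, so the least one exists. It is positive because a
  bump function is a competitor with positive variance (\<open>not_poincare_inequality_0\<close>).
\<close>

section \<open>Spectral theory of symmetric matrices\<close>

text \<open>The quadratic form attains its maximum on the unit sphere of \<open>V\<close>. Unless the residual
  \<open>A v - l v\<close> of a maximizer \<open>v\<close> vanishes, moving \<open>v\<close> in its direction increases the form to first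
  order. Invariant subspaces are needed to look for the next eigenvector in the orthogonal
  complement of those already found.\<close>
lemma rayleigh_maximizer_is_eigenvector:
  fixes A :: "real^'n^'n" and V :: "(real^'n) set"
  assumes sym: "transpose A = A" and V: "subspace V" and inv: "\<And>x. x \<in> V \<Longrightarrow> A *v x \<in> V"
    and nz: "V \<noteq> {0}"
  obtains v l where "v \<in> V" "norm v = 1" "A *v v = l *\<^sub>R v"
    "\<And>y. y \<in> V \<Longrightarrow> y \<bullet> (A *v y) \<le> l * (y \<bullet> y)"
proof -
  have symm: "x \<bullet> (A *v y) = (A *v x) \<bullet> y" for x y
    by (metis dot_lmul_matrix sym transpose_matrix_vector)
  let ?S = "V \<inter> sphere 0 1"
  have "compact ?S"
    using closed_subspace[OF V] by (simp add: closed_Int_compact)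
  moreover have "?S \<noteq> {}"
  proof -
    obtain x where "x \<in> V" "x \<noteq> 0" using nz V subspace_0 by blast
    then have "x /\<^sub>R norm x \<in> ?S" using V by (simp add: subspace_scale)
    then show ?thesis by blast
  qed
  moreover have "continuous_on ?S (\<lambda>x. x \<bullet> (A *v x))"
    by (intro continuous_intros matrix_vector_mult_linear_continuous_on)
  ultimately obtain v where v: "v \<in> ?S" and max: "\<And>y. y \<in> ?S \<Longrightarrow> y \<bullet> (A *v y) \<le> v \<bullet> (A *v v)"
    using continuous_attains_sup by meson
  define l where "l = v \<bullet> (A *v v)"
  have hom: "y \<bullet> (A *v y) \<le> l * (y \<bullet> y)" if "y \<in> V" for y
  proof (cases "y = 0")
    case False
    then have "y /\<^sub>R norm y \<in> ?S" using that V by (simp add: subspace_scale)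
    from max[OF this] have "(y \<bullet> (A *v y)) / (norm y)^2 \<le> l"
      by (simp add: l_def matrix_vector_mult_scaleR power2_eq_square divide_inverse mult.commute mult.left_commute)
    with False show ?thesis
      by (simp add: divide_le_eq power2_norm_eq_inner[symmetric])
  qed simp
  define w where "w = A *v v - l *\<^sub>R v"
  have wV: "w \<in> V" unfolding w_def using v V inv by (simp add: subspace_diff subspace_scale)
  have vv: "v \<bullet> v = 1" using v by (simp add: norm_eq_1)
  \<comment> \<open>first-order optimality of \<open>v\<close> in the direction of the residual \<open>w\<close>\<close>
  have ineq: "2 * t * (w \<bullet> w) + t^2 * (w \<bullet> (A *v w) - l * (w \<bullet> w)) \<le> 0" for t
  proof -
    have "v + t *\<^sub>R w \<in> V" using v wV V by (simp add: subspace_add subspace_scale)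
    from hom[OF this]
    have "l + 2 * t * (w \<bullet> (A *v v)) + t^2 * (w \<bullet> (A *v w)) \<le> l * (1 + 2 * t * (w \<bullet> v) + t^2 * (w \<bullet> w))"
      using symm[of v w]
      by (simp add: matrix_vector_right_distrib matrix_vector_mult_scaleR inner_add_left inner_add_right
          l_def[symmetric] vv power2_eq_square inner_commute algebra_simps)
    moreover have "w \<bullet> (A *v v) = w \<bullet> w + l * (w \<bullet> v)"
      by (simp add: w_def inner_diff_right algebra_simps)
    ultimately show ?thesis by (simp add: algebra_simps)
  qed
  have "w \<bullet> w = 0"
  proof (rule ccontr)
    assume "w \<bullet> w \<noteq> 0"
    then have p: "w \<bullet> w > 0" by (simp add: order_less_le)
    define c where "c = \<bar>w \<bullet> (A *v w) - l * (w \<bullet> w)\<bar> + 1"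
    have c: "c > 0" unfolding c_def by simp
    define t where "t = (w \<bullet> w) / c"
    have t: "t > 0" using p c by (simp add: t_def)
    from ineq[of t] have "t * (2 * (w \<bullet> w) + t * (w \<bullet> (A *v w) - l * (w \<bullet> w))) \<le> 0"
      by (simp add: power2_eq_square algebra_simps)
    then have "2 * (w \<bullet> w) \<le> - (t * (w \<bullet> (A *v w) - l * (w \<bullet> w)))" using t
      by (simp add: mult_le_0_iff)
    also have "\<dots> \<le> t * c"
    proof -
      have "- (w \<bullet> (A *v w) - l * (w \<bullet> w)) \<le> c" unfolding c_def by linarith
      from mult_left_mono[OF this, of t] t show ?thesis by (simp add: right_diff_distrib)
    qed
    also have "\<dots> = w \<bullet> w" using c by (simp add: t_def)
    finally show False using p by simp
  qed
  then have "A *v v = l *\<^sub>R v" by (simp add: w_def)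
  with v hom that[of v l] show ?thesis by simp
qed

text \<open>A maximal orthonormal set of eigenvectors spans the space: otherwise its orthogonal complement
  is a nonzero invariant subspace and contains one more eigenvector.\<close>
lemma spectral_theorem:
  fixes A :: "real^'n^'n"
  assumes sym: "transpose A = A"
  obtains B l where "pairwise orthogonal B" "\<And>b. b \<in> B \<Longrightarrow> norm b = 1" "span B = UNIV"
    "finite B" "card B = CARD('n)"
    "\<And>b. b \<in> B \<Longrightarrow> A *v b = l b *\<^sub>R b"
proof -
  have symm: "x \<bullet> (A *v y) = (A *v x) \<bullet> y" for x y
    by (metis dot_lmul_matrix sym transpose_matrix_vector)
  define P where "P B \<longleftrightarrow> pairwise orthogonal B \<and> (\<forall>b\<in>B. norm b = 1 \<and> (\<exists>l. A *v b = l *\<^sub>R b))"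
    for B :: "(real^'n) set"
  have indep: "independent B" if "P B" for B
    using that unfolding P_def
    by (intro pairwise_orthogonal_independent) (auto simp: P_def)
  have fin: "finite B \<and> card B \<le> CARD('n)" if "P B" for B
    using indep[OF that] independent_bound by fastforce
  have "P {}" by (simp add: P_def)
  then obtain B where B: "P B" and Bmax: "\<And>B'. P B' \<Longrightarrow> card B' \<le> card B"
    using ex_has_greatest_nat[of P "{}" card "Suc CARD('n)"] fin by (metis less_Suc_eq_le)
  have sp: "span B = UNIV"
  proof (rule ccontr)
    assume ns: "span B \<noteq> UNIV"
    define V where "V = {x. \<forall>b\<in>B. orthogonal b x}"
    have sV: "subspace V" unfolding V_def
      by (rule subspace_orthogonal_to_vectors)
    have iV: "A *v x \<in> V" if "x \<in> V" for x
    proof -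
      have "b \<bullet> (A *v x) = 0" if b: "b \<in> B" for b
      proof -
        obtain m where "A *v b = m *\<^sub>R b" using B b unfolding P_def by blast
        moreover have "b \<bullet> x = 0" using \<open>x \<in> V\<close> b by (auto simp: V_def orthogonal_def)
        ultimately show ?thesis by (simp add: symm[of b])
      qed
      then show ?thesis by (auto simp: V_def orthogonal_def)
    qed
    obtain x where x: "x \<noteq> 0" "x \<in> span UNIV" "\<And>y. y \<in> span B \<Longrightarrow> orthogonal x y"
    proof (rule orthogonal_to_subspace_exists_gen[of B UNIV])
      show "span B \<subset> span UNIV" using ns by auto
    qed blast
    then have "x \<in> V" unfolding V_def using orthogonal_commute span_base by blast
    with x have V0: "V \<noteq> {0}" by blast
    obtain v m where v: "v \<in> V" "norm v = 1" "A *v v = m *\<^sub>R v"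
      by (rule rayleigh_maximizer_is_eigenvector[OF sym sV iV V0])
    have "P (insert v B)"
      using B v unfolding P_def V_def
      by (auto simp: pairwise_insert orthogonal_commute)
    moreover have "v \<notin> B"
      using v by (auto simp: V_def orthogonal_def)
    ultimately show False using Bmax[of "insert v B"] fin[OF B] by simp
  qed
  obtain l where l: "\<forall>b\<in>B. A *v b = l b *\<^sub>R b"
    using B unfolding P_def by metis
  have "card B = dim (span B)"
    using indep[OF B] by (simp add: dim_eq_card_independent)
  then have "card B = CARD('n)" by (simp add: sp)
  then show ?thesis
    using B l sp fin[OF B] by (intro that[of B l]) (auto simp: P_def)
qed

text \<open>The maximum of the Rayleigh quotient is an eigenvalue. All eigenvalues occur in an eigenbasis,
  so the \<open>Max\<close> in \<open>lambda_max\<close> is over a finite set and dominates this one.\<close>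
lemma quadratic_form_le_lambda_max:
  fixes A :: "real^'n^'n"
  assumes sym: "transpose A = A"
  shows "x \<bullet> (A *v x) \<le> lambda_max A * (x \<bullet> x)"
proof -
  have symm: "x \<bullet> (A *v y) = (A *v x) \<bullet> y" for x y
    by (metis dot_lmul_matrix sym transpose_matrix_vector)
  obtain B l where B: "pairwise orthogonal B" "\<And>b. b \<in> B \<Longrightarrow> norm b = 1" "span B = UNIV" "finite B"
    and ev: "\<And>b. b \<in> B \<Longrightarrow> A *v b = l b *\<^sub>R b"
    using spectral_theorem[OF sym] by metis
  have "{l. \<exists>v. v \<noteq> 0 \<and> A *v v = l *\<^sub>R v} \<subseteq> l ` B"
  proof clarify
    fix m v assume v: "v \<noteq> (0::real^'n)" "A *v v = m *\<^sub>R v"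
    have "\<exists>b\<in>B. v \<bullet> b \<noteq> 0"
    proof (rule ccontr)
      assume "\<not> ?thesis"
      then have "orthogonal v y" if "y \<in> span B" for y
        using orthogonal_to_span[OF that, of v] \<open>\<not> (\<exists>b\<in>B. v \<bullet> b \<noteq> 0)\<close> by (auto simp: orthogonal_def)
      then have "orthogonal v v" using B by blast
      with v show False by (simp add: orthogonal_self)
    qed
    then obtain b where b: "b \<in> B" "v \<bullet> b \<noteq> 0" by blast
    have "l b * (v \<bullet> b) = m * (v \<bullet> b)"
      using symm[of v b] ev[OF b(1)] v by simp
    with b show "m \<in> l ` B" by auto
  qed
  then have fin: "finite {l. \<exists>v. v \<noteq> 0 \<and> A *v v = l *\<^sub>R v}"
    using B finite_subset by blast
  have U0: "(UNIV :: (real^'n) set) \<noteq> {0}"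
    by (metis UNIV_I singletonD zero_neq_one)
  obtain v m where v: "norm v = 1" "A *v v = m *\<^sub>R v"
     and vmax: "\<And>y. y \<bullet> (A *v y) \<le> m * (y \<bullet> y)"
    by (rule rayleigh_maximizer_is_eigenvector[OF sym subspace_UNIV UNIV_I U0]) blast
  have "m \<le> lambda_max A"
    unfolding lambda_max_def using v by (intro Max_ge fin) (auto intro!: exI[of _ v])
  then show ?thesis
    using vmax[of x] by (meson inner_ge_zero mult_right_mono order_trans)
qed

lemma positive_definite_imp_positive_eigenvalue:
  assumes "symmetric_positive_definite A" "A *v v = l *\<^sub>R v" "v \<noteq> 0"
  shows "0 < l"
proof -
  have "0 < v \<bullet> (A *v v)" using assms unfolding symmetric_positive_definite_def by blast
  with assms(2) have "0 < l * (v \<bullet> v)" by simp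
  then show ?thesis using inner_ge_zero[of v] by (simp add: zero_less_mult_iff)
qed

text \<open>The columns of the factor are the eigenvectors, scaled by the roots of the eigenvalues.\<close>
lemma positive_definite_factorization:
  fixes S :: "real^'n^'n"
  assumes S: "symmetric_positive_definite S"
  obtains A :: "real^'n^'n" where "S = A ** transpose A" "invertible A"
proof -
  have sym: "transpose S = S" using S unfolding symmetric_positive_definite_def by blast
  obtain B l where B: "pairwise orthogonal B" "\<And>b. b \<in> B \<Longrightarrow> norm b = 1" "span B = UNIV" "finite B"
     "card B = CARD('n)" and ev: "\<And>b. b \<in> B \<Longrightarrow> S *v b = l b *\<^sub>R b"
    using spectral_theorem[OF sym] by metis
  obtain f where f: "bij_betw f (UNIV :: 'n set) B"
    using B finite_same_card_bij[of "UNIV :: 'n set" B] by auto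
  have fB: "f j \<in> B" for j using f by (auto simp: bij_betw_def)
  have pos: "0 < l (f j)" for j
    using positive_definite_imp_positive_eigenvalue[OF S ev[OF fB], of j] B(2)[OF fB, of j]
    by (metis norm_zero zero_neq_one)
  have ortho: "f i \<bullet> f j = (if i = j then 1 else 0)" for i j
  proof (cases "i = j")
    case True
    then show ?thesis using B(2)[OF fB, of j] by (simp add: norm_eq_1)
  next
    case False
    then have "f i \<noteq> f j" using f by (auto simp: bij_betw_def inj_def)
    then show ?thesis using B(1) fB False by (auto simp: pairwise_def orthogonal_def)
  qed
  define Q :: "real^'n^'n" where "Q = (\<chi> i j. f j $ i)"
  define A :: "real^'n^'n" where "A = (\<chi> i j. sqrt (l (f j)) * f j $ i)"
  have QQ: "transpose Q ** Q = mat 1"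
    using ortho by (simp add: matrix_matrix_mult_def transpose_def Q_def mat_def vec_eq_iff inner_vec_def)
  then have QQ': "Q ** transpose Q = mat 1" by (simp add: matrix_left_right_inverse)
  have SQ: "(S ** Q) $ i $ j = l (f j) * f j $ i" for i j
  proof -
    have "(S ** Q) $ i $ j = (S *v f j) $ i"
      by (simp add: matrix_matrix_mult_def matrix_vector_mult_def Q_def)
    then show ?thesis using ev[OF fB[of j]] by simp
  qed
  have "A ** transpose A = (S ** Q) ** transpose Q"
  proof -
    have "(A ** transpose A) $ i $ j = ((S ** Q) ** transpose Q) $ i $ j" for i j
    proof -
      have "(A ** transpose A) $ i $ j = (\<Sum>k\<in>UNIV. A $ i $ k * A $ j $ k)"
        by (simp add: matrix_matrix_mult_def transpose_def)
      also have "\<dots> = (\<Sum>k\<in>UNIV. l (f k) * f k $ i * f k $ j)"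
      proof (rule sum.cong)
        fix k show "A $ i $ k * A $ j $ k = l (f k) * f k $ i * f k $ j"
        proof -
          have "A $ i $ k * A $ j $ k = (sqrt (l (f k)) * sqrt (l (f k))) * (f k $ i * f k $ j)"
            by (simp add: A_def mult_ac del: real_sqrt_mult_self)
          then show ?thesis using less_imp_le[OF pos[of k]] by simp
        qed
      qed simp
      also have "\<dots> = (\<Sum>k\<in>UNIV. (S ** Q) $ i $ k * Q $ j $ k)"
        by (simp only: SQ) (simp add: Q_def)
      also have "\<dots> = ((S ** Q) ** transpose Q) $ i $ j"
        by (simp add: matrix_matrix_mult_def[of "S ** Q"] transpose_def)
      finally show ?thesis .
    qed
    then show ?thesis by (simp add: vec_eq_iff)
  qed
  also have "\<dots> = S" by (metis QQ' matrix_mul_assoc matrix_mul_rid)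
  finally have AS: "S = A ** transpose A" ..
  have "S *v x \<noteq> 0" if "x \<noteq> 0" for x
    using S that unfolding symmetric_positive_definite_def by force
  then have "invertible S"
    by (metis invertible_left_inverse matrix_left_invertible_ker)
  then have "invertible A"
    using AS by (metis det_mul invertible_det_nz mult_zero_left)
  with AS that show ?thesis by blast
qed

section \<open>Gaussian measures as linear images\<close>

lemma invertible_matrix_inv:
  fixes A :: "real^'n^'n"
  assumes "invertible A"
  shows "A ** matrix_inv A = mat 1" and "matrix_inv A ** A = mat 1"
  using someI_ex[OF assms[unfolded invertible_def]] by (auto simp: matrix_inv_def)

lemma lborel_eq_PiM:
  "(lborel :: 'a::euclidean_space measure) = distr (\<Pi>\<^sub>M b\<in>Basis. lborel) borel (\<lambda>f. \<Sum>b\<in>Basis. f b *\<^sub>R b)"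
  by (subst lborel_def) (simp add: lborel_eq_real)

text \<open>For an elementary shear, Fubini isolates the sheared coordinate, along which the map is a
  translation.\<close>
lemma distr_lborel_shear:
  fixes m n :: "'n::finite"
  assumes mn: "m \<noteq> n"
  shows "distr lborel borel (\<lambda>x::real^'n. \<chi> i. if i = m then x $ m + x $ n else x $ i) = lborel"
    (is "distr _ _ ?h = _")
proof (rule measure_eqI)
  define bm bn :: "real^'n" where "bm = axis m 1" and "bn = axis n 1"
  define J where "J = (Basis :: (real^'n) set) - {bm}"
  have B: "Basis = insert bm J" and J: "finite J" "bm \<notin> J" and bn: "bn \<in> J"
    using mn by (auto simp: J_def bm_def bn_def axis_in_Basis_iff axis_eq_axis)
  define X where "X f = (\<Sum>b\<in>Basis. f b *\<^sub>R b)" for f :: "real^'n \<Rightarrow> real"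
  interpret product_sigma_finite "\<lambda>_. lborel :: real measure" ..
  have [measurable]: "X \<in> (\<Pi>\<^sub>M b\<in>Basis. lborel) \<rightarrow>\<^sub>M borel" unfolding X_def by measurable
  have [measurable]: "?h \<in> borel_measurable borel"
  proof -
    have "?h = (\<lambda>x. x + (x $ n) *\<^sub>R axis m 1)" by (auto simp: vec_eq_iff axis_def)
    moreover have "(\<lambda>x::real^'n. x + (x $ n) *\<^sub>R axis m 1) \<in> borel_measurable borel"
      by (intro borel_measurable_continuous_onI continuous_intros)
    ultimately show ?thesis by metis
  qed
  have inj: "inj (\<lambda>i. axis i (1::real) :: real^'n)" by (auto simp: inj_def axis_eq_axis)
  have BB: "(Basis :: (real^'n) set) = range (\<lambda>i. axis i 1)" by (auto simp: Basis_vec_def)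
  have Xc: "X f $ i = f (axis i 1)" for f i
  proof -
    have "X f $ i = (\<Sum>k\<in>UNIV. f (axis k 1) * (axis k 1 :: real^'n) $ i)"
      by (simp add: X_def BB sum.reindex[OF inj] sum_component)
    also have "\<dots> = (\<Sum>k\<in>UNIV. if k = i then f (axis i 1) else 0)"
      by (intro sum.cong) (auto simp: axis_def)
    finally show ?thesis by simp
  qed
  have hX: "?h (X (f(bm := y))) = X (f(bm := f bn + y))" for f y
  proof (rule vec_eq_iff[THEN iffD2], rule allI)
    fix i show "?h (X (f(bm := y))) $ i = X (f(bm := f bn + y)) $ i"
      using mn by (simp add: Xc bm_def bn_def axis_eq_axis)
  qed
  fix S assume "S \<in> sets (distr lborel borel ?h)"
  then have [measurable]: "S \<in> sets borel" by simp
  \<comment> \<open>the coordinate \<open>m\<close> is integrated innermost, with the others held fixed\<close>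
  have P: "(\<integral>\<^sup>+x. F x \<partial>lborel) = (\<integral>\<^sup>+f. (\<integral>\<^sup>+y. F (X (f(bm := y))) \<partial>lborel) \<partial>(\<Pi>\<^sub>M b\<in>J. lborel))"
    if [measurable]: "F \<in> borel_measurable borel" for F :: "real^'n \<Rightarrow> ennreal"
  proof -
    have "(\<integral>\<^sup>+x. F x \<partial>lborel) = (\<integral>\<^sup>+f. F (X f) \<partial>(\<Pi>\<^sub>M b\<in>Basis. lborel))"
      by (subst lborel_eq_PiM) (simp add: nn_integral_distr X_def)
    also have "\<dots> = (\<integral>\<^sup>+f. F (X f) \<partial>(\<Pi>\<^sub>M b\<in>insert bm J. lborel))"
      by (simp add: B)
    also have "\<dots> = (\<integral>\<^sup>+f. (\<integral>\<^sup>+y. F (X (f(bm := y))) \<partial>lborel) \<partial>(\<Pi>\<^sub>M b\<in>J. lborel))"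
      by (intro product_nn_integral_insert J) (simp add: B[symmetric])
    finally show ?thesis .
  qed
  have mJ: "(\<lambda>y. indicator S (X (f(bm := y))) :: ennreal) \<in> borel_measurable borel"
    if "f \<in> space (\<Pi>\<^sub>M b\<in>J. lborel)" for f
  proof -
    have "(\<lambda>y. f(bm := y)) \<in> lborel \<rightarrow>\<^sub>M (\<Pi>\<^sub>M b\<in>insert bm J. lborel)"
      using that by measurable
    then have [measurable]: "(\<lambda>y. f(bm := y)) \<in> borel \<rightarrow>\<^sub>M (\<Pi>\<^sub>M b\<in>Basis. lborel)"
      by (simp add: B[symmetric])
    show ?thesis by measurable
  qed
  have "emeasure (distr lborel borel ?h) S = (\<integral>\<^sup>+x. indicator S (?h x) \<partial>lborel)"
  proof -
    have "emeasure (distr lborel borel ?h) S = (\<integral>\<^sup>+x. indicator S x \<partial>distr lborel borel ?h)" by simp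
    then show ?thesis by (subst (asm) nn_integral_distr) auto
  qed
  also have "\<dots> = (\<integral>\<^sup>+f. (\<integral>\<^sup>+y. indicator S (X (f(bm := f bn + y))) \<partial>lborel) \<partial>(\<Pi>\<^sub>M b\<in>J. lborel))"
    unfolding hX[symmetric] by (rule P) measurable
  also have "\<dots> = (\<integral>\<^sup>+f. (\<integral>\<^sup>+y. indicator S (X (f(bm := y))) \<partial>lborel) \<partial>(\<Pi>\<^sub>M b\<in>J. lborel))"
  proof (rule nn_integral_cong)
    fix f :: "real^'n \<Rightarrow> real" assume "f \<in> space (\<Pi>\<^sub>M b\<in>J. lborel)"
    from nn_integral_real_affine[OF mJ[OF this], of 1 "f bn"]
    show "(\<integral>\<^sup>+y. indicator S (X (f(bm := f bn + y))) \<partial>lborel) = (\<integral>\<^sup>+y. indicator S (X (f(bm := y))) \<partial>lborel)"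
      by simp
  qed
  also have "\<dots> = (\<integral>\<^sup>+x. indicator S x \<partial>lborel)" by (rule P[symmetric]) measurable
  also have "\<dots> = emeasure lborel S" by simp
  finally show "emeasure (distr lborel borel ?h) S = emeasure lborel S" .
qed simp

lemma distr_lborel_permute:
  fixes p :: "'n::finite \<Rightarrow> 'n"
  assumes p: "p permutes UNIV"
  shows "distr lborel borel (\<lambda>x::real^'n. \<chi> i. x $ p i) = lborel" (is "distr _ _ ?h = _")
proof (rule lborel_eqI[symmetric])
  have m[measurable]: "?h \<in> borel_measurable borel"
    by (intro borel_measurable_continuous_onI continuous_intros)
  define q where "q = inv p"
  have q: "q permutes UNIV" unfolding q_def using permutes_inv[OF p] .
  have pq: "p (q i) = i" "q (p i) = i" for i
    using permutes_inverses[OF p] by (auto simp: q_def)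
  fix l u :: "real^'n" assume lu: "\<And>b. b \<in> Basis \<Longrightarrow> l \<bullet> b \<le> u \<bullet> b"
  have lu': "l $ i \<le> u $ i" for i using lu[of "axis i 1"] by (simp add: axis_in_Basis_iff inner_axis)
  let ?l = "\<chi> i. l $ q i" and ?u = "\<chi> i. u $ q i"
  have vi: "?h -` box l u = box ?l ?u"
    by (auto simp: mem_box_cart) (metis pq)+
  have prodB: "(\<Prod>b\<in>(Basis :: (real^'n) set). g b) = (\<Prod>i\<in>UNIV. g (axis i 1))" for g :: "real^'n \<Rightarrow> real"
  proof -
    have i: "inj (\<lambda>i. axis i (1::real) :: real^'n)" by (auto simp: inj_def axis_eq_axis)
    have B: "(Basis :: (real^'n) set) = range (\<lambda>i. axis i 1)" by (auto simp: Basis_vec_def)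
    show ?thesis unfolding B prod.reindex[OF i] comp_def ..
  qed
  have "emeasure (distr lborel borel ?h) (box l u) = emeasure lborel (box ?l ?u)"
    by (simp add: emeasure_distr vi)
  also have "\<dots> = (\<Prod>b\<in>Basis. (?u - ?l) \<bullet> b)"
    using lu' by (intro emeasure_lborel_box) (auto simp: Basis_vec_def inner_axis)
  also have "(\<Prod>b\<in>Basis. (?u - ?l) \<bullet> b) = (\<Prod>i\<in>UNIV. (u - l) $ q i)"
    unfolding prodB by (simp add: inner_axis)
  also have "\<dots> = (\<Prod>i\<in>UNIV. (u - l) $ i)"
    using prod.permute[OF q, of "\<lambda>i. (u - l) $ i"] by (simp add: comp_def)
  also have "\<dots> = (\<Prod>b\<in>Basis. (u - l) \<bullet> b)"
    unfolding prodB by (simp add: inner_axis)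
  finally show "emeasure (distr lborel borel ?h) (box l u) = (\<Prod>b\<in>Basis. (u - l) \<bullet> b)" .
qed simp

lemma distr_lborel_diagonal:
  fixes c :: "'n::finite \<Rightarrow> real"
  assumes c: "\<And>i. c i \<noteq> 0"
  shows "distr lborel borel (\<lambda>x::real^'n. \<chi> i. c i * x $ i) = density lborel (\<lambda>_. ennreal (1 / \<bar>\<Prod>i\<in>UNIV. c i\<bar>))"
    (is "?D = _")
proof -
  let ?d = "\<bar>\<Prod>i\<in>UNIV. c i\<bar>"
  have d: "?d > 0" using c by simp
  \<comment> \<open>the coordinate to which a basis vector belongs\<close>
  define ix where "ix b = (THE i. b = (axis i 1 :: real^'n))" for b
  have ix: "ix (axis i 1) = i" for i
    unfolding ix_def by (rule the_equality) (auto simp: axis_eq_axis)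
  have inj: "inj (\<lambda>i. axis i (1::real) :: real^'n)" by (auto simp: inj_def axis_eq_axis)
  have B: "(Basis :: (real^'n) set) = range (\<lambda>i. axis i 1)" by (auto simp: Basis_vec_def)
  have T: "0 + (\<Sum>j\<in>Basis. (c (ix j) * (x \<bullet> j)) *\<^sub>R j) = (\<chi> i. c i * x $ i)" for x :: "real^'n"
  proof -
    have "(0 + (\<Sum>j\<in>Basis. (c (ix j) * (x \<bullet> j)) *\<^sub>R j)) $ k = c k * x $ k" for k
    proof -
      have "(0 + (\<Sum>j\<in>Basis. (c (ix j) * (x \<bullet> j)) *\<^sub>R j)) $ k
          = (\<Sum>i\<in>UNIV. c i * x $ i * (axis i 1 :: real^'n) $ k)"
        by (simp add: B sum.reindex[OF inj] ix inner_axis sum_component)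
      also have "\<dots> = (\<Sum>i\<in>UNIV. if i = k then c k * x $ k else 0)"
        by (intro sum.cong) (auto simp: axis_def)
      finally show ?thesis by simp
    qed
    then show ?thesis by (simp add: vec_eq_iff)
  qed
  have p: "(\<Prod>j\<in>(Basis :: (real^'n) set). \<bar>c (ix j)\<bar>) = ?d"
    by (simp add: B prod.reindex[OF inj] ix abs_prod)
  have lb: "lborel = density ?D (\<lambda>_. ennreal ?d)"
    using lborel_affine_euclidean[of "\<lambda>j. c (ix j)" "0::real^'n"] c unfolding T p by simp
  have "density lborel (\<lambda>_. ennreal (1 / ?d)) = density (density ?D (\<lambda>_. ennreal ?d)) (\<lambda>_. ennreal (1 / ?d))"
    using lb by (rule arg_cong)
  also have "\<dots> = density ?D (\<lambda>_. 1)"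
    using d by (subst density_density_eq) (auto simp: ennreal_mult[symmetric])
  finally show ?thesis by (simp add: density_1)
qed

text \<open>Every matrix is a product of elementary ones, and the scaling factors multiply under
  composition just as determinants do.\<close>
lemma distr_lborel_linear:
  fixes A :: "real^'n^'n"
  assumes "invertible A"
  shows "distr lborel borel ((*v) A) = density lborel (\<lambda>_. ennreal (1 / \<bar>det A\<bar>))"
proof -
  have meas[measurable]: "(*v) A \<in> borel_measurable borel" for A :: "real^'n^'n"
    by (auto intro!: borel_measurable_continuous_onI matrix_vector_mult_linear_continuous_on)
  \<comment> \<open>the factors met in the induction may be singular; the claim is void for these\<close>
  define P where "P A \<longleftrightarrow> (det A \<noteq> 0 \<longrightarrow> distr lborel borel ((*v) A) = density lborel (\<lambda>_. ennreal (1 / \<bar>det A\<bar>)))"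
    for A :: "real^'n^'n"
  have "P A"
  proof (rule induct_matrix_elementary_alt[of P])
    fix A B assume A: "P A" and B: "P B"
    show "P (A ** B)"
      unfolding P_def
    proof
      assume "det (A ** B) \<noteq> 0"
      then have d: "det A \<noteq> 0" "det B \<noteq> 0" by (auto simp: det_mul)
      have "distr lborel borel ((*v) (A ** B)) = distr (distr lborel borel ((*v) B)) borel ((*v) A)"
        by (subst distr_distr) (auto simp: matrix_vector_mult_matrix_matrix_mult_compose)
      also have "\<dots> = distr (density lborel (\<lambda>_. ennreal (1 / \<bar>det B\<bar>))) borel ((*v) A)"
        using B d by (simp add: P_def)
      also have "\<dots> = density (distr lborel borel ((*v) A)) (\<lambda>_. ennreal (1 / \<bar>det B\<bar>))"
        by (subst density_distr) auto
      also have "\<dots> = density lborel (\<lambda>_. ennreal (1 / \<bar>det A\<bar>) * ennreal (1 / \<bar>det B\<bar>))"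
        using A d by (simp add: P_def density_density_eq)
      also have "\<dots> = density lborel (\<lambda>_. ennreal (1 / \<bar>det (A ** B)\<bar>))"
        by (simp add: ennreal_mult[symmetric] det_mul abs_mult)
      finally show "distr lborel borel ((*v) (A ** B)) = density lborel (\<lambda>_. ennreal (1 / \<bar>det (A ** B)\<bar>))" .
    qed
  next
    fix A :: "real^'n^'n" and i assume "row i A = 0"
    then show "P A" by (simp add: P_def det_zero_row(2))
  next
    fix A :: "real^'n^'n" assume z: "\<And>i j. i \<noteq> j \<Longrightarrow> A $ i $ j = 0"
    have m: "(*v) A = (\<lambda>x. \<chi> i. A $ i $ i * x $ i)"
    proof (intro ext, simp add: vec_eq_iff matrix_vector_mult_def, intro allI)
      fix x :: "real^'n" and i
      have "(\<Sum>j\<in>UNIV. A $ i $ j * x $ j) = (\<Sum>j\<in>UNIV. if j = i then A $ i $ i * x $ i else 0)"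
        by (intro sum.cong) (auto simp: z)
      then show "(\<Sum>j\<in>UNIV. A $ i $ j * x $ j) = A $ i $ i * x $ i" by simp
    qed
    have dA: "det A = (\<Prod>i\<in>UNIV. A $ i $ i)" using z by (rule det_diagonal)
    show "P A"
      unfolding P_def dA m by (auto intro!: distr_lborel_diagonal)
  next
    fix m n :: 'n assume "m \<noteq> n"
    let ?p = "Transposition.transpose m n"
    have p: "?p permutes UNIV" by (simp add: permutes_swap_id)
    let ?A = "\<chi> i j. mat 1 $ i $ ?p j :: real^'n^'n"
    have d: "\<bar>det ?A\<bar> = 1"
      by (subst det_permute_columns[OF p]) (simp add: sign_def)
    have "?A *v x = (\<chi> i. x $ ?p i)" for x
    proof -
      have "(\<Sum>j\<in>UNIV. ?A $ i $ j * x $ j) = (\<Sum>j\<in>UNIV. if j = ?p i then x $ j else 0)" for i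
        by (intro sum.cong) (auto simp: mat_def)
      then show ?thesis by (simp add: vec_eq_iff matrix_vector_mult_def)
    qed
    then have "(*v) ?A = (\<lambda>x. \<chi> i. x $ ?p i)" by (rule ext)
    then show "P ?A" unfolding P_def d using distr_lborel_permute[OF p] by (simp add: density_1)
  next
    fix m n :: 'n assume mn: "m \<noteq> n"
    let ?A = "\<chi> i j. of_bool (i = m \<and> j = n \<or> i = j) :: real^'n^'n"
    have "?A = (\<chi> k. if k = m then row m (mat 1) + 1 *s row n (mat 1) else row k (mat 1))"
      using mn by (auto simp: vec_eq_iff row_def mat_def)
    then have d: "det ?A = 1" using det_row_operation[OF mn, of "mat 1 :: real^'n^'n" 1] by simp
    have "?A *v x = (\<chi> i. if i = m then x $ m + x $ n else x $ i)" for x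
    proof -
      have "(\<Sum>j\<in>UNIV. of_bool (i = m \<and> j = n \<or> i = j) * x $ j)
        = (\<Sum>j\<in>UNIV. (if j = n then of_bool (i = m) * x $ n else 0) + (if j = i then x $ i else 0))" for i
        using mn by (intro sum.cong) auto
      then show ?thesis by (simp add: vec_eq_iff matrix_vector_mult_def sum.distrib)
    qed
    then have "(*v) ?A = (\<lambda>x. \<chi> i. if i = m then x $ m + x $ n else x $ i)" by (rule ext)
    then show "P ?A" unfolding P_def d using distr_lborel_shear[OF mn] by (simp add: density_1)
  qed
  with assms show ?thesis by (simp add: P_def invertible_det_nz)
qed

lemma distr_density_linear:
  fixes A :: "real^'n^'n"
  assumes A: "invertible A" and g[measurable]: "g \<in> borel_measurable borel"
  shows "distr (density lborel (\<lambda>y. g (A *v y))) borel ((*v) A)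
    = density lborel (\<lambda>x. ennreal (1 / \<bar>det A\<bar>) * g x)"
proof -
  have [measurable]: "(*v) A \<in> borel_measurable borel"
    by (auto intro!: borel_measurable_continuous_onI matrix_vector_mult_linear_continuous_on)
  have "distr (density lborel (\<lambda>y. g (A *v y))) borel ((*v) A) = density (distr lborel borel ((*v) A)) g"
    by (subst density_distr) auto
  also have "\<dots> = density lborel (\<lambda>x. ennreal (1 / \<bar>det A\<bar>) * g x)"
    unfolding distr_lborel_linear[OF A] by (subst density_density_eq) auto
  finally show ?thesis .
qed

lemma nn_integral_lborel_prod_vec:
  fixes f :: "'n::finite \<Rightarrow> real \<Rightarrow> ennreal"
  assumes [measurable]: "\<And>i. f i \<in> borel_measurable borel"
  shows "(\<integral>\<^sup>+x. (\<Prod>i\<in>UNIV. f i (x $ i)) \<partial>lborel) = (\<Prod>i\<in>UNIV. (\<integral>\<^sup>+x. f i x \<partial>lborel))"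
proof -
  \<comment> \<open>the coordinate to which a basis vector belongs\<close>
  define ix where "ix b = (THE i. b = (axis i 1 :: real^'n))" for b
  have ix: "ix (axis i 1) = i" for i
    unfolding ix_def by (rule the_equality) (auto simp: axis_eq_axis)
  have inj: "inj (\<lambda>i. axis i (1::real) :: real^'n)" by (auto simp: inj_def axis_eq_axis)
  have B: "(Basis :: (real^'n) set) = range (\<lambda>i. axis i 1)" by (auto simp: Basis_vec_def)
  have "(\<integral>\<^sup>+x. (\<Prod>b\<in>Basis. f (ix b) (x \<bullet> b)) \<partial>lborel) = (\<Prod>b\<in>Basis. (\<integral>\<^sup>+x. f (ix b) x \<partial>lborel))"
    by (rule nn_integral_lborel_prod) auto
  then show ?thesis
    by (simp add: B prod.reindex[OF inj] ix inner_axis)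
qed

text \<open>This is \<open>centered_normal (mat 1)\<close>, in a form that shows that the density is a product.\<close>
definition std_gaussian :: "(real^'n) measure" where
  "std_gaussian = density lborel (\<lambda>x. ennreal (exp (- (x \<bullet> x) / 2) / sqrt ((2 * pi) ^ CARD('n))))"

lemma std_gaussian_density_prod:
  fixes x :: "real^'n"
  shows "ennreal (exp (- (x \<bullet> x) / 2) / sqrt ((2 * pi) ^ CARD('n)))
    = (\<Prod>i\<in>UNIV. ennreal (std_normal_density (x $ i)))"
proof -
  have "(\<Prod>i\<in>UNIV. std_normal_density (x $ i)) = exp (- (x \<bullet> x) / 2) / sqrt ((2 * pi) ^ CARD('n))"
    by (simp add: std_normal_density_def prod.distrib prod_dividef real_sqrt_power[symmetric]
        exp_sum[symmetric] sum_negf sum_divide_distrib[symmetric] inner_vec_def power2_eq_square)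
  then show ?thesis by (simp add: prod_ennreal)
qed

lemma sets_std_gaussian[simp, measurable_cong]: "sets std_gaussian = sets borel"
  by (simp add: std_gaussian_def)

lemma space_std_gaussian[simp]: "space std_gaussian = UNIV"
  by (simp add: std_gaussian_def)

lemma nn_integral_std_normal_density: "(\<integral>\<^sup>+x. ennreal (std_normal_density x) \<partial>lborel) = 1"
  using prob_space.emeasure_space_1[OF prob_space_normal_density[of 1 0]]
  by (simp add: emeasure_density)

lemma emeasure_std_gaussian_coordinate:
  assumes [measurable]: "B \<in> sets borel"
  shows "emeasure (std_gaussian :: (real^'n) measure) {x. x $ k \<in> B} = emeasure (density lborel std_normal_density) B"
proof -
  have [measurable]: "{x :: real^'n. x $ k \<in> B} \<in> sets borel"
    using measurable_sets[of "\<lambda>x::real^'n. x $ k" borel borel B]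
    by (simp add: vimage_def)
  let ?f = "\<lambda>i y. ennreal (std_normal_density y) * (if i = k then indicator B y else 1)"
  have eq: "(\<Prod>i\<in>UNIV. ?f i (x $ i)) = (\<Prod>i\<in>UNIV. ennreal (std_normal_density (x $ i))) * indicator {x. x $ k \<in> B} x"
    for x :: "real^'n"
    by (simp add: prod.distrib prod.delta indicator_def)
  have "emeasure (std_gaussian :: (real^'n) measure) {x. x $ k \<in> B}
     = (\<integral>\<^sup>+x. (\<Prod>i\<in>UNIV. ?f i (x $ i)) \<partial>(lborel :: (real^'n) measure))"
    unfolding std_gaussian_def std_gaussian_density_prod eq
    by (subst emeasure_density) auto
  also have "\<dots> = (\<Prod>i\<in>UNIV. (\<integral>\<^sup>+x. ?f i x \<partial>lborel))"
    by (rule nn_integral_lborel_prod_vec) auto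
  also have "\<dots> = (\<Prod>i\<in>UNIV. if i = k then emeasure (density lborel std_normal_density) B else 1)"
    by (intro prod.cong) (auto simp: emeasure_density nn_integral_std_normal_density)
  also have "\<dots> = emeasure (density lborel std_normal_density) B" by (simp add: prod.delta)
  finally show ?thesis .
qed

lemma prob_space_std_gaussian: "prob_space (std_gaussian :: (real^'n) measure)"
proof
  show "emeasure std_gaussian (space (std_gaussian :: (real^'n) measure)) = 1"
    using emeasure_std_gaussian_coordinate[of UNIV "undefined :: 'n"]
    by (simp add: emeasure_density nn_integral_std_normal_density)
qed

lemma distr_std_gaussian_coordinate:
  "distr (std_gaussian :: (real^'n) measure) borel (\<lambda>x. x $ k) = density lborel std_normal_density"
proof (rule measure_eqI)
  fix B assume "B \<in> sets (distr (std_gaussian :: (real^'n) measure) borel (\<lambda>x. x $ k))"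
  then have "B \<in> sets borel" by simp
  then show "emeasure (distr (std_gaussian :: (real^'n) measure) borel (\<lambda>x. x $ k)) B
     = emeasure (density lborel std_normal_density) B"
    using emeasure_std_gaussian_coordinate[of B k]
    by (simp add: emeasure_distr vimage_def)
qed simp

text \<open>The density is a function of \<open>x \<bullet> x\<close>, and orthogonal maps have determinant \<open>\<plusminus>1\<close>.\<close>
lemma distr_std_gaussian_orthogonal:
  fixes f :: "real^'n \<Rightarrow> real^'n"
  assumes f: "orthogonal_transformation f"
  shows "distr std_gaussian borel f = std_gaussian"
proof -
  have fm: "f = (*v) (matrix f)"
    using orthogonal_transformation_linear[OF f] by (auto simp: matrix_vector_mul)
  have o: "orthogonal_matrix (matrix f)" using f orthogonal_transformation_matrix by blast
  then have d: "\<bar>det (matrix f)\<bar> = 1" using det_orthogonal_matrix by fastforce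
  then have i: "invertible (matrix f)" by (auto simp: invertible_det_nz)
  have ff: "f x \<bullet> f x = x \<bullet> x" for x using f by (simp add: orthogonal_transformation_def)
  have "distr (density lborel (\<lambda>x. ennreal (exp (- ((matrix f *v x) \<bullet> (matrix f *v x)) / 2) / sqrt ((2 * pi) ^ CARD('n)))))
     borel ((*v) (matrix f)) = (std_gaussian :: (real^'n) measure)"
    unfolding std_gaussian_def
    by (subst distr_density_linear[OF i, of "\<lambda>x. ennreal (exp (- (x \<bullet> x) / 2) / sqrt ((2 * pi) ^ CARD('n)))"]) (auto simp: d)
  then show ?thesis
    unfolding fm[symmetric] ff std_gaussian_def .
qed

text \<open>Substituting \<open>x = A y\<close> turns the exponent of the density into that of the standard Gaussian.\<close>
lemma centered_normal_eq_distr: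
  fixes A :: "real^'n^'n"
  assumes S: "S = A ** transpose A" and A: "invertible A"
  shows "centered_normal S = distr std_gaussian borel ((*v) A)"
proof -
  have dS: "det S = (det A)\<^sup>2" by (simp add: S det_mul det_transpose power2_eq_square)
  then have iS: "invertible S" using A by (simp add: invertible_det_nz)
  have "A ** (transpose A ** (matrix_inv S ** A)) = A"
    by (metis S iS invertible_matrix_inv(1) matrix_mul_assoc matrix_mul_lid)
  then have *: "transpose A ** (matrix_inv S ** A) = mat 1"
    by (metis A invertible_matrix_inv(2) matrix_mul_assoc matrix_mul_lid)
  have q: "(A *v y) \<bullet> (matrix_inv S *v (A *v y)) = y \<bullet> y" for y
  proof -
    have "(A *v y) \<bullet> (matrix_inv S *v (A *v y)) = y \<bullet> (transpose A *v (matrix_inv S *v (A *v y)))"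
      by (metis dot_lmul_matrix transpose_matrix_vector transpose_transpose)
    also have "\<dots> = y \<bullet> ((transpose A ** (matrix_inv S ** A)) *v y)"
      by (simp add: matrix_vector_mul_assoc matrix_mul_assoc)
    finally show ?thesis by (simp add: *)
  qed
  let ?g = "\<lambda>x. ennreal (exp (- (x \<bullet> (matrix_inv S *v x)) / 2) / sqrt ((2 * pi) ^ CARD('n)))"
  have g: "?g \<in> borel_measurable borel"
    by (intro measurable_compose[OF _ measurable_ennreal] borel_measurable_continuous_onI continuous_intros
        matrix_vector_mult_linear_continuous_on) auto
  have "distr std_gaussian borel ((*v) A) = density lborel (\<lambda>x. ennreal (1 / \<bar>det A\<bar>) * ?g x)"
    using distr_density_linear[OF A g] by (simp add: q std_gaussian_def)
  also have "\<dots> = centered_normal S"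
    unfolding centered_normal_def
    by (simp add: dS real_sqrt_mult ennreal_mult[symmetric] mult.commute)
  finally show ?thesis ..
qed

text \<open>Write the distribution as the image of the standard Gaussian under \<open>A\<close>. If \<open>S $ k $ k = 1\<close>, row
  \<open>k\<close> of \<open>A\<close> is a unit vector; a rotation moves it to a basis vector, which reduces the marginal to a
  coordinate of the standard Gaussian.\<close>
lemma
  fixes S :: "real^'n^'n"
  assumes S: "symmetric_positive_definite S"
  shows prob_space_centered_normal: "prob_space (centered_normal S)"
    and marginal_centered_normal: "S $ k $ k = 1 \<Longrightarrow> marginal (centered_normal S) k = density lborel std_normal_density"
proof -
  obtain A :: "real^'n^'n" where A: "S = A ** transpose A" "invertible A"
    by (rule positive_definite_factorization[OF S]) blast
  have [measurable]: "(*v) A \<in> borel_measurable borel"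
    by (auto intro!: borel_measurable_continuous_onI matrix_vector_mult_linear_continuous_on)
  note eq = centered_normal_eq_distr[OF A]
  show "prob_space (centered_normal S)"
    unfolding eq by (intro prob_space.prob_space_distr prob_space_std_gaussian) simp
  assume kk: "S $ k $ k = 1"
  have "A $ k \<bullet> A $ k = 1"
    using kk by (simp add: A(1) matrix_matrix_mult_def transpose_def inner_vec_def)
  then have "norm (A $ k) = norm (axis k 1 :: real^'n)" by (simp add: norm_eq_1)
  then obtain f :: "real^'n \<Rightarrow> real^'n" where f: "orthogonal_transformation f" "f (A $ k) = axis k 1"
    by (rule orthogonal_transformation_exists) blast
  have fm[measurable]: "f \<in> borel_measurable borel"
    using orthogonal_transformation_linear[OF f(1)]
    by (auto intro!: borel_measurable_continuous_onI linear_continuous_on simp: linear_conv_bounded_linear)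
  have fk: "(A *v y) $ k = f y $ k" for y
  proof -
    have "(A *v y) $ k = A $ k \<bullet> y" by (simp add: matrix_vector_mult_def inner_vec_def)
    also have "\<dots> = f (A $ k) \<bullet> f y" using f(1) by (simp add: orthogonal_transformation_def)
    finally show ?thesis by (simp add: f(2) inner_axis' )
  qed
  have "marginal (centered_normal S) k = distr std_gaussian borel (\<lambda>y. f y $ k)"
    unfolding eq marginal_def by (subst distr_distr) (auto simp: comp_def fk)
  also have "\<dots> = distr (distr std_gaussian borel f) borel (\<lambda>y. y $ k)"
    by (subst distr_distr) (auto simp: comp_def)
  also have "\<dots> = density lborel std_normal_density"
    unfolding distr_std_gaussian_orthogonal[OF f(1)] by (rule distr_std_gaussian_coordinate)
  finally show "marginal (centered_normal S) k = density lborel std_normal_density" .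
qed

lemma sets_centered_normal[simp, measurable_cong]: "sets (centered_normal S) = sets borel"
  by (simp add: centered_normal_def)

lemma space_centered_normal[simp]: "space (centered_normal S) = UNIV"
  by (simp add: centered_normal_def)

lemma integrable_norm_std_gaussian: "integrable (std_gaussian :: (real^'n) measure) norm"
proof -
  have "integrable (std_gaussian :: (real^'n) measure) (\<lambda>x. \<bar>x $ i\<bar>)" for i
  proof -
    have "integrable (distr (std_gaussian :: (real^'n) measure) borel (\<lambda>x. x $ i)) (\<lambda>x. \<bar>x\<bar>)"
      unfolding distr_std_gaussian_coordinate
      using integrable_std_normal_moment_abs[of 1] by (simp add: integrable_density)
    then show ?thesis by (subst (asm) integrable_distr_eq) auto
  qed
  then have "integrable (std_gaussian :: (real^'n) measure) (\<lambda>x. \<Sum>i\<in>UNIV. \<bar>x $ i\<bar>)" by auto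
  then show ?thesis
    by (rule Bochner_Integration.integrable_bound)
       (auto intro!: AE_I2 order_trans[OF norm_le_l1_cart] simp: borel_measurable_continuous_onI)
qed

lemma integrable_norm_centered_normal:
  fixes S :: "real^'n^'n"
  assumes S: "symmetric_positive_definite S"
  shows "integrable (centered_normal S) norm"
proof -
  obtain A :: "real^'n^'n" where A: "S = A ** transpose A" "invertible A"
    by (rule positive_definite_factorization[OF S]) blast
  have [measurable]: "(*v) A \<in> borel_measurable borel"
    by (auto intro!: borel_measurable_continuous_onI matrix_vector_mult_linear_continuous_on)
  have "integrable std_gaussian (\<lambda>y. norm (A *v y))"
  proof (rule Bochner_Integration.integrable_bound)
    show "integrable (std_gaussian :: (real^'n) measure) (\<lambda>y. onorm ((*v) A) * norm y)"
      by (intro integrable_mult_right integrable_norm_std_gaussian)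
  qed (auto intro!: AE_I2 onorm order_trans[OF _ abs_ge_self])
  then show ?thesis
    unfolding centered_normal_eq_distr[OF A] by (subst integrable_distr_eq) auto
qed

section \<open>Differentiation under the integral and integration by parts\<close>

text \<open>By the mean value inequality the remainders, divided by the increment, are dominated by
  \<open>2 * g\<close>.\<close>
lemma has_derivative_integral_dominated:
  fixes f :: "'a::real_normed_vector \<Rightarrow> 'b \<Rightarrow> real"
  assumes U: "open U" "convex U" "x0 \<in> U"
    and f: "\<And>x. x \<in> U \<Longrightarrow> integrable M (f x)"
    and d: "\<And>x y. x \<in> U \<Longrightarrow> y \<in> space M \<Longrightarrow> ((\<lambda>x. f x y) has_derivative f' x y) (at x)"
    and b: "\<And>x y v. x \<in> U \<Longrightarrow> y \<in> space M \<Longrightarrow> \<bar>f' x y v\<bar> \<le> g y * norm v"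
    and g: "integrable M g"
    and m: "\<And>v. (\<lambda>y. f' x0 y v) \<in> borel_measurable M"
  shows "((\<lambda>x. \<integral>y. f x y \<partial>M) has_derivative (\<lambda>v. \<integral>y. f' x0 y v \<partial>M)) (at x0)"
proof -
  have lin: "bounded_linear (f' x0 y)" if "y \<in> space M" for y
    using d[OF U(3) that] by (rule has_derivative_bounded_linear)
  have int: "integrable M (\<lambda>y. f' x0 y v)" for v
  proof (rule Bochner_Integration.integrable_bound)
    show "integrable M (\<lambda>y. g y * norm v)" using g by simp
    show "AE y in M. norm (f' x0 y v) \<le> norm (g y * norm v)"
      using b[OF U(3)] by (intro AE_I2) (simp, meson abs_ge_self order_trans abs_mult)
  qed (rule m)
  have bl: "bounded_linear (\<lambda>v. \<integral>y. f' x0 y v \<partial>M)"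
  proof (rule bounded_linear_intro)
    fix v w show "(\<integral>y. f' x0 y (v + w) \<partial>M) = (\<integral>y. f' x0 y v \<partial>M) + (\<integral>y. f' x0 y w \<partial>M)"
      unfolding Bochner_Integration.integral_add[OF int int, symmetric]
      by (intro Bochner_Integration.integral_cong refl) (simp add: linear_add[OF bounded_linear.linear[OF lin]])
    fix r show "(\<integral>y. f' x0 y (r *\<^sub>R v) \<partial>M) = r *\<^sub>R (\<integral>y. f' x0 y v \<partial>M)"
      unfolding integral_scaleR_right[symmetric]
      by (intro Bochner_Integration.integral_cong refl) (simp add: linear_scale[OF bounded_linear.linear[OF lin]])
    have "norm (\<integral>y. f' x0 y v \<partial>M) \<le> (\<integral>y. norm (f' x0 y v) \<partial>M)" by (rule integral_norm_bound)
    also have "\<dots> \<le> (\<integral>y. g y * norm v \<partial>M)"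
      using b[OF U(3)] int g by (intro integral_mono) auto
    finally show "norm (\<integral>y. f' x0 y v \<partial>M) \<le> norm v * (\<integral>y. g y \<partial>M)"
      by (simp add: mult.commute)
  qed
  have mv: "\<bar>f x y - f x0 y\<bar> \<le> g y * norm (x - x0)" if "x \<in> U" "y \<in> space M" for x y
  proof (cases "x = x0")
    case False
    have g0: "0 \<le> g y"
    proof -
      have "0 \<le> g y * norm (x - x0)" using b[OF U(3) that(2), of "x - x0"] by linarith
      with False show ?thesis by (simp add: zero_le_mult_iff)
    qed
    have "norm (f x y - f x0 y) \<le> g y * norm (x - x0)"
    proof (rule differentiable_bound[of U "\<lambda>x. f x y" "\<lambda>x. f' x y"])
      fix z assume z: "z \<in> U"
      show "((\<lambda>x. f x y) has_derivative f' z y) (at z within U)"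
        using d[OF z that(2)] by (rule has_derivative_at_withinI)
      show "onorm (f' z y) \<le> g y"
        by (rule onorm_bound[OF g0]) (use b[OF z that(2)] in simp)
    qed (use U that in auto)
    then show ?thesis by simp
  qed simp
  show ?thesis
    unfolding has_derivative_iff_norm
  proof (intro conjI bl)
    let ?Q = "\<lambda>x y. (f x y - f x0 y - f' x0 y (x - x0)) / norm (x - x0)"
    show "((\<lambda>x. norm ((\<integral>y. f x y \<partial>M) - (\<integral>y. f x0 y \<partial>M) - (\<integral>y. f' x0 y (x - x0) \<partial>M)) / norm (x - x0)) \<longlongrightarrow> 0) (at x0)"
      unfolding tendsto_at_iff_sequentially comp_def
    proof (intro allI impI)
      fix X assume X: "\<forall>i. X i \<in> UNIV - {x0}" "X \<longlonglongrightarrow> x0"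
      let ?q = "\<lambda>i y. if X i \<in> U then ?Q (X i) y else 0"
      have "(\<lambda>i. \<integral>y. ?q i y \<partial>M) \<longlonglongrightarrow> (\<integral>y. 0 \<partial>M)"
      proof (rule integral_dominated_convergence[where w = "\<lambda>y. 2 * g y"])
        show "?q i \<in> borel_measurable M" for i
          using f[of "X i"] f[OF U(3)] m by (cases "X i \<in> U") (simp_all add: borel_measurable_integrable)
        show "integrable M (\<lambda>y. 2 * g y)" using g by simp
        show "AE y in M. (\<lambda>i. ?q i y) \<longlonglongrightarrow> 0"
        proof (rule AE_I2)
          fix y assume y: "y \<in> space M"
          have "((\<lambda>x. norm (f x y - f x0 y - f' x0 y (x - x0)) / norm (x - x0)) \<longlongrightarrow> 0) (at x0)"
            using d[OF U(3) y] unfolding has_derivative_iff_norm by blast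
          then have "(\<lambda>i. norm (f (X i) y - f x0 y - f' x0 y (X i - x0)) / norm (X i - x0)) \<longlonglongrightarrow> 0"
            using X unfolding tendsto_at_iff_sequentially comp_def by blast
          then have "(\<lambda>i. norm (?Q (X i) y)) \<longlonglongrightarrow> 0" by simp
          then show "(\<lambda>i. ?q i y) \<longlonglongrightarrow> 0"
            by (rule Lim_null_comparison[rotated]) (auto intro!: always_eventually)
        qed
        show "AE y in M. norm (?q i y) \<le> 2 * g y" for i
        proof (rule AE_I2)
          fix y assume y: "y \<in> space M"
          have g0: "0 \<le> g y"
          proof -
            have "X i \<noteq> x0" using X by auto
            moreover have "0 \<le> g y * norm (X i - x0)" using b[OF U(3) y, of "X i - x0"] by linarith
            ultimately show ?thesis by (simp add: zero_le_mult_iff)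
          qed
          show "norm (?q i y) \<le> 2 * g y"
          proof (cases "X i \<in> U")
            case True
            have n: "norm (X i - x0) > 0" using X by auto
            have "\<bar>f (X i) y - f x0 y - f' x0 y (X i - x0)\<bar> \<le> 2 * g y * norm (X i - x0)"
              using mv[OF True y] b[OF U(3) y, of "X i - x0"] by linarith
            then show ?thesis using True n by (simp add: divide_le_eq)
          qed (use g0 in simp)
        qed
      qed simp
      then have "(\<lambda>i. norm (\<integral>y. ?q i y \<partial>M)) \<longlonglongrightarrow> norm (\<integral>y. (0::real) \<partial>M)" by (rule tendsto_norm)
      then have lim: "(\<lambda>i. norm (\<integral>y. ?q i y \<partial>M)) \<longlonglongrightarrow> 0" by (simp only: Bochner_Integration.integral_zero norm_zero)
      have "eventually (\<lambda>i. X i \<in> U) sequentially"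
        by (rule topological_tendstoD[OF X(2) U(1) U(3)])
      then have "eventually (\<lambda>i. norm (\<integral>y. ?q i y \<partial>M)
         = norm ((\<integral>y. f (X i) y \<partial>M) - (\<integral>y. f x0 y \<partial>M) - (\<integral>y. f' x0 y (X i - x0) \<partial>M)) / norm (X i - x0)) sequentially"
      proof (rule eventually_mono)
        fix i assume i: "X i \<in> U"
        then show "norm (\<integral>y. ?q i y \<partial>M)
         = norm ((\<integral>y. f (X i) y \<partial>M) - (\<integral>y. f x0 y \<partial>M) - (\<integral>y. f' x0 y (X i - x0) \<partial>M)) / norm (X i - x0)"
          using f[OF i] f[OF U(3)] int by simp
      qed
      with lim show "(\<lambda>i. norm ((\<integral>y. f (X i) y \<partial>M) - (\<integral>y. f x0 y \<partial>M) - (\<integral>y. f' x0 y (X i - x0) \<partial>M)) / norm (X i - x0)) \<longlonglongrightarrow> 0"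
        by (rule Lim_transform_eventually)
    qed
  qed
qed

lemma integrable_continuous_compact_support:
  fixes F :: "'a::euclidean_space \<Rightarrow> real"
  assumes "continuous_on UNIV F" "compact K" "\<And>x. x \<notin> K \<Longrightarrow> F x = 0"
  shows "integrable lborel F"
proof -
  have "integrable lborel (\<lambda>x. indicator K x *\<^sub>R F x)"
    using assms by (intro borel_integrable_compact) (auto intro: continuous_on_subset)
  also have "(\<lambda>x. indicator K x *\<^sub>R F x) = F" using assms(3) by (fastforce simp: indicator_def)
  finally show ?thesis .
qed

lemma integral_lborel_translate:
  fixes F :: "'a::euclidean_space \<Rightarrow> real"
  assumes [measurable]: "F \<in> borel_measurable borel"
  shows "(\<integral>x. F (x + a) \<partial>lborel) = (\<integral>x. F x \<partial>lborel)"
proof -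
  have "(\<integral>x. F x \<partial>lborel) = (\<integral>x. F x \<partial>distr lborel borel ((+) a))" by (simp add: lborel_distr_plus)
  also have "\<dots> = (\<integral>x. F (a + x) \<partial>lborel)" by (subst integral_distr) auto
  finally show ?thesis by (simp add: add.commute)
qed

lemma has_derivative_eq_0_outside_support:
  assumes "closed K" "\<And>x. x \<notin> K \<Longrightarrow> F x = 0" "(F has_derivative F') (at x)" "x \<notin> K"
  shows "F' = (\<lambda>_. 0)"
proof -
  have "(F has_derivative (\<lambda>_. 0)) (at x)"
    by (rule has_derivative_transform_within_open[of "\<lambda>_. 0" _ x UNIV "- K"]) (use assms in auto)
  then show ?thesis using assms(3) has_derivative_unique by blast
qed

text \<open>The integral of a translate does not depend on the translation; differentiate under it.\<close>
lemma integral_directional_derivative_eq_0: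
  fixes F :: "'a::euclidean_space \<Rightarrow> real"
  assumes K: "compact K" "\<And>x. x \<notin> K \<Longrightarrow> F x = 0"
    and d: "\<And>x. (F has_derivative F' x) (at x)"
    and b: "\<And>x. \<bar>F' x e\<bar> \<le> B"
    and m: "(\<lambda>x. F' x e) \<in> borel_measurable borel"
  shows "(\<integral>x. F' x e \<partial>lborel) = 0"
proof -
  have cont: "continuous_on UNIV F"
    using d by (meson continuous_at_imp_continuous_on has_derivative_continuous)
  then have Fm[measurable]: "F \<in> borel_measurable borel" by (rule borel_measurable_continuous_onI)
  \<comment> \<open>outside \<open>K'\<close> all translates by at most \<open>e\<close> vanish\<close>
  define K' where "K' = (\<lambda>(k, t). k - t *\<^sub>R e) ` (K \<times> {-1..1::real})"
  have "compact K'" unfolding K'_def using K(1)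
    by (intro compact_continuous_image compact_Times) (auto intro!: continuous_intros simp: case_prod_unfold)
  have out: "x + t *\<^sub>R e \<notin> K" if "x \<notin> K'" "\<bar>t\<bar> \<le> 1" for x t
  proof
    assume "x + t *\<^sub>R e \<in> K"
    then have "x \<in> K'" unfolding K'_def using that(2)
      by (intro image_eqI[of _ _ "(x + t *\<^sub>R e, t)"]) auto
    with that show False by blast
  qed
  have "((\<lambda>t. \<integral>x. F (x + t *\<^sub>R e) \<partial>lborel) has_derivative (\<lambda>v. \<integral>x. F' (x + 0 *\<^sub>R e) (v *\<^sub>R e) \<partial>lborel)) (at (0::real))"
  proof (rule has_derivative_integral_dominated[where U = "ball 0 1" and g = "\<lambda>x. B * indicator K' x"
        and f' = "\<lambda>t x v. F' (x + t *\<^sub>R e) (v *\<^sub>R e)"])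
    fix t :: real assume "t \<in> ball 0 1"
    then have t: "\<bar>t\<bar> \<le> 1" by simp
    show "integrable lborel (\<lambda>x. F (x + t *\<^sub>R e))"
      by (rule integrable_continuous_compact_support[where K = K'])
         (use \<open>compact K'\<close> out[OF _ t] K(2) in \<open>auto intro!: continuous_on_compose2[OF cont] continuous_intros\<close>)
    fix x
    show "((\<lambda>t. F (x + t *\<^sub>R e)) has_derivative (\<lambda>v. F' (x + t *\<^sub>R e) (v *\<^sub>R e))) (at t)"
      by (rule has_derivative_compose[OF _ d]) (auto intro!: derivative_eq_intros)
    fix v
    have "F' (x + t *\<^sub>R e) (v *\<^sub>R e) = v * F' (x + t *\<^sub>R e) e"
      using linear_scale[OF has_derivative_linear[OF d]] by simp
    moreover have "\<bar>F' (x + t *\<^sub>R e) e\<bar> \<le> B * indicator K' x"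
    proof (cases "x \<in> K'")
      case False
      then show ?thesis
        using has_derivative_eq_0_outside_support[OF compact_imp_closed[OF K(1)] K(2) d out[OF False t]] by simp
    qed (use b in simp)
    ultimately show "\<bar>F' (x + t *\<^sub>R e) (v *\<^sub>R e)\<bar> \<le> B * indicator K' x * norm v"
      by (simp add: abs_mult) (metis abs_ge_zero mult.commute mult_left_mono)
  next
    show "integrable lborel (\<lambda>x. B * indicator K' x)"
      using \<open>compact K'\<close> emeasure_compact_finite[OF \<open>compact K'\<close>]
      by (intro integrable_mult_right integrable_real_indicator) (auto simp: borel_compact)
    fix v :: real
    have "(\<lambda>x. F' (x + 0 *\<^sub>R e) (v *\<^sub>R e)) = (\<lambda>x. v * F' x e)"
      using linear_scale[OF has_derivative_linear[OF d]] by auto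
    then show "(\<lambda>x. F' (x + 0 *\<^sub>R e) (v *\<^sub>R e)) \<in> borel_measurable lborel" using m by simp
  qed auto
  moreover have "(\<lambda>t. \<integral>x. F (x + t *\<^sub>R e) \<partial>lborel) = (\<lambda>t. \<integral>x. F x \<partial>lborel)"
    by (simp add: integral_lborel_translate)
  ultimately have "((\<lambda>t::real. \<integral>x. F x \<partial>lborel) has_derivative (\<lambda>v. \<integral>x. F' x (v *\<^sub>R e) \<partial>lborel)) (at 0)"
    by simp
  from has_derivative_unique[OF this has_derivative_const]
  have "(\<integral>x. F' x (1 *\<^sub>R e) \<partial>lborel) = 0" by meson
  then show ?thesis by simp
qed

section \<open>The Gaussian Poincar\'e inequality\<close>

text \<open>Shears preserve Lebesgue measure by Fubini: for a fixed second component they are translations.\<close>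
lemma distr_lborel_shear_fst:
  "distr lborel borel (\<lambda>p. (fst p + a *\<^sub>R snd p, snd p)) = (lborel :: ('a::euclidean_space \<times> 'a) measure)"
    (is "distr _ _ ?h = _")
proof (rule measure_eqI)
  fix S assume "S \<in> sets (distr lborel borel ?h)"
  then have [measurable]: "S \<in> sets borel" by simp
  have [measurable]: "?h \<in> borel_measurable borel"
    by (intro borel_measurable_continuous_onI continuous_intros)
  have snd: "(\<integral>\<^sup>+p. F p \<partial>lborel) = (\<integral>\<^sup>+y. \<integral>\<^sup>+x. F (x, y) \<partial>lborel \<partial>lborel)"
    if "F \<in> borel_measurable borel" for F :: "'a \<times> 'a \<Rightarrow> ennreal"
  proof -
    have "F \<in> borel_measurable (lborel \<Otimes>\<^sub>M lborel)" using that by (simp add: lborel_prod)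
    from lborel_pair.nn_integral_snd[OF this] show ?thesis by (simp add: lborel_prod)
  qed
  have "emeasure (distr lborel borel ?h) S = (\<integral>\<^sup>+p. indicator S p \<partial>distr lborel borel ?h)" by simp
  also have "\<dots> = (\<integral>\<^sup>+p. indicator S (?h p) \<partial>lborel)" by (subst nn_integral_distr) auto
  also have "\<dots> = (\<integral>\<^sup>+y. \<integral>\<^sup>+x. indicator S (x + a *\<^sub>R y, y) \<partial>lborel \<partial>lborel)"
    by (subst snd) auto
  also have "\<dots> = (\<integral>\<^sup>+y. \<integral>\<^sup>+x. indicator S (x, y) \<partial>lborel \<partial>lborel)"
  proof (rule nn_integral_cong)
    fix y :: 'a
    have [measurable]: "(\<lambda>x. indicator S (x, y) :: ennreal) \<in> borel_measurable borel"
      by (rule measurable_compose[of "\<lambda>x. (x, y)" _ borel])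
         (auto intro!: borel_measurable_continuous_onI continuous_intros)
    have "(\<integral>\<^sup>+x. indicator S (x, y) \<partial>lborel) = (\<integral>\<^sup>+x. indicator S (x, y) \<partial>distr lborel borel ((+) (a *\<^sub>R y)))"
      by (simp add: lborel_distr_plus)
    also have "\<dots> = (\<integral>\<^sup>+x. indicator S (a *\<^sub>R y + x, y) \<partial>lborel)" by (subst nn_integral_distr) auto
    finally show "(\<integral>\<^sup>+x. indicator S (x + a *\<^sub>R y, y) \<partial>lborel) = (\<integral>\<^sup>+x. indicator S (x, y) \<partial>lborel)"
      by (simp add: add.commute)
  qed
  also have "\<dots> = (\<integral>\<^sup>+p. indicator S p \<partial>lborel)" by (subst snd) auto
  finally show "emeasure (distr lborel borel ?h) S = emeasure lborel S" by simp
qed simp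

lemma distr_lborel_prod_swap:
  "distr lborel borel (\<lambda>p. (snd p, fst p)) = (lborel :: ('a::euclidean_space \<times> 'a) measure)"
proof -
  have "(lborel :: ('a \<times> 'a) measure) = distr lborel lborel (\<lambda>(x, y). (y, x))"
    using lborel_pair.distr_pair_swap[where ?'a = 'a and ?'b = 'a] unfolding lborel_prod .
  also have "\<dots> = distr lborel borel (\<lambda>p. (snd p, fst p))"
    by (rule distr_cong) (auto simp: case_prod_unfold)
  finally show ?thesis ..
qed

lemma distr_lborel_shear_snd:
  "distr lborel borel (\<lambda>p. (fst p, snd p + a *\<^sub>R fst p)) = (lborel :: ('a::euclidean_space \<times> 'a) measure)"
proof -
  let ?sw = "\<lambda>p::'a \<times> 'a. (snd p, fst p)" and ?h = "\<lambda>p::'a \<times> 'a. (fst p + a *\<^sub>R snd p, snd p)"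
  have [measurable]: "?sw \<in> borel_measurable borel" "?h \<in> borel_measurable borel"
    by (intro borel_measurable_continuous_onI continuous_intros)+
  have "distr lborel borel (\<lambda>p::'a \<times> 'a. (fst p, snd p + a *\<^sub>R fst p)) = distr (distr (distr lborel borel ?sw) borel ?h) borel ?sw"
    by (subst distr_distr, simp, simp)+ (simp add: comp_def)
  then show ?thesis by (simp only: distr_lborel_prod_swap distr_lborel_shear_fst)
qed

text \<open>A rotation of the plane by an angle that is not a multiple of \<open>\<pi>\<close> is a product of three shears.\<close>
lemma distr_lborel_rotation:
  fixes c s :: real
  assumes cs: "c\<^sup>2 + s\<^sup>2 = 1" "s \<noteq> 0"
  shows "distr lborel borel (\<lambda>p. (c *\<^sub>R fst p + s *\<^sub>R snd p, c *\<^sub>R snd p - s *\<^sub>R fst p))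
    = (lborel :: ('a::euclidean_space \<times> 'a) measure)"
proof -
  \<comment> \<open>the tangent of half the angle of rotation\<close>
  define a where "a = (1 - c) / s"
  let ?h = "\<lambda>p::'a \<times> 'a. (fst p + a *\<^sub>R snd p, snd p)" and ?k = "\<lambda>p::'a \<times> 'a. (fst p, snd p + (- s) *\<^sub>R fst p)"
  have [measurable]: "?h \<in> borel_measurable borel" "?k \<in> borel_measurable borel"
    by (intro borel_measurable_continuous_onI continuous_intros)+
  have as: "a * s = 1 - c" using cs by (simp add: a_def)
  have "a * (1 + c) = s"
  proof -
    have "a * (1 + c) * s = (1 - c) * (1 + c)" by (simp only: as[symmetric] mult_ac)
    also have "\<dots> = s * s" using cs(1) by (simp add: algebra_simps power2_eq_square)
    finally show ?thesis using cs(2) by simp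
  qed
  then have a2: "a + c * a = s" by (simp add: algebra_simps)
  have e: "?h (?k (?h p)) = (c *\<^sub>R fst p + s *\<^sub>R snd p, c *\<^sub>R snd p - s *\<^sub>R fst p)" for p
  proof -
    define x y where "x = fst p" and "y = snd p"
    have c: "c = 1 - a * s" using as by simp
    have "x + a *\<^sub>R y + a *\<^sub>R (y + (- s) *\<^sub>R (x + a *\<^sub>R y)) = c *\<^sub>R x + (a *\<^sub>R y + (c * a) *\<^sub>R y)"
      unfolding c by (simp add: algebra_simps)
    then have "x + a *\<^sub>R y + a *\<^sub>R (y + (- s) *\<^sub>R (x + a *\<^sub>R y)) = c *\<^sub>R x + s *\<^sub>R y"
      by (simp only: scaleR_left_distrib[symmetric] a2)
    moreover have "y + (- s) *\<^sub>R (x + a *\<^sub>R y) = c *\<^sub>R y - s *\<^sub>R x" unfolding c by (simp add: algebra_simps)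
    ultimately show ?thesis by (simp only: x_def[symmetric] y_def[symmetric] fst_conv snd_conv)
  qed
  have "distr lborel borel (\<lambda>p::'a \<times> 'a. (c *\<^sub>R fst p + s *\<^sub>R snd p, c *\<^sub>R snd p - s *\<^sub>R fst p))
      = distr (distr (distr lborel borel ?h) borel ?k) borel ?h"
  proof -
    have hm: "?h \<in> borel_measurable borel" "?h \<in> borel_measurable lborel" and km: "?k \<in> borel_measurable borel"
      by (simp_all only: measurable_lborel2 measurable_lborel1) measurable
    show ?thesis
      by (subst distr_distr[OF km hm(2)], subst distr_distr[OF hm(1) measurable_comp[OF hm(2) km]])
         (simp only: comp_def e)
  qed
  then show ?thesis by (simp only: distr_lborel_shear_fst distr_lborel_shear_snd)
qed

definition normal_dens :: "real^'n^'n \<Rightarrow> real^'n \<Rightarrow> real" where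
  "normal_dens S x = exp (- (x \<bullet> (matrix_inv S *v x)) / 2) / sqrt ((2 * pi) ^ CARD('n) * det S)"

lemma centered_normal_eq: "centered_normal S = density lborel (\<lambda>x. ennreal (normal_dens S x))"
  by (simp add: centered_normal_def normal_dens_def)

lemma continuous_normal_dens: "continuous_on UNIV (normal_dens S)"
  unfolding normal_dens_def divide_inverse
  by (intro continuous_intros matrix_vector_mult_linear_continuous_on)

lemma borel_measurable_normal_dens[measurable]: "normal_dens S \<in> borel_measurable borel"
  by (intro borel_measurable_continuous_onI continuous_normal_dens)

context
  fixes S :: "real^'n^'n"
  assumes S: "symmetric_positive_definite S"
begin

lemma spd_invertible: "invertible S" and spd_det: "det S > 0"
proof -
  obtain A :: "real^'n^'n" where A: "S = A ** transpose A" "invertible A"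
    by (rule positive_definite_factorization[OF S]) blast
  have "det S = (det A)\<^sup>2" by (simp add: A(1) det_mul power2_eq_square)
  moreover have "det A \<noteq> 0" using A(2) by (simp add: invertible_det_nz)
  ultimately show "det S > 0" by simp
  then show "invertible S" by (simp add: invertible_det_nz)
qed

lemma spd_symm: "x \<bullet> (S *v y) = (S *v x) \<bullet> y"
  using S unfolding symmetric_positive_definite_def by (metis dot_lmul_matrix transpose_matrix_vector)

lemma matrix_inv_symm: "x \<bullet> (matrix_inv S *v y) = (matrix_inv S *v x) \<bullet> y"
proof -
  have i: "S *v (matrix_inv S *v z) = z" for z
    using invertible_matrix_inv[OF spd_invertible] by (simp add: matrix_vector_mul_assoc)
  have "x \<bullet> (matrix_inv S *v y) = (S *v (matrix_inv S *v x)) \<bullet> (matrix_inv S *v y)" by (simp add: i)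
  also have "\<dots> = (matrix_inv S *v x) \<bullet> y" unfolding spd_symm[symmetric] unfolding i ..
  finally show ?thesis .
qed

lemma normal_dens_pos: "normal_dens S x > 0"
  using spd_det by (simp add: normal_dens_def)

text \<open>The joint density of two independent copies depends on the pair only through the sum of the two
  quadratic forms, which a rotation of the pair preserves.\<close>
lemma normal_dens_rotation:
  assumes "c\<^sup>2 + s\<^sup>2 = 1"
  shows "normal_dens S (c *\<^sub>R x + s *\<^sub>R y) * normal_dens S (c *\<^sub>R y - s *\<^sub>R x) = normal_dens S x * normal_dens S y"
proof -
  let ?q = "\<lambda>x y. x \<bullet> (matrix_inv S *v y)"
  have "?q (c *\<^sub>R x + s *\<^sub>R y) (c *\<^sub>R x + s *\<^sub>R y) + ?q (c *\<^sub>R y - s *\<^sub>R x) (c *\<^sub>R y - s *\<^sub>R x)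
      = (c\<^sup>2 + s\<^sup>2) * (?q x x + ?q y y)"
    by (simp add: matrix_vector_right_distrib matrix_vector_mult_diff_distrib matrix_vector_mult_scaleR
        inner_add_left inner_add_right inner_diff_left inner_diff_right power2_eq_square algebra_simps)
  then have e: "?q (c *\<^sub>R x + s *\<^sub>R y) (c *\<^sub>R x + s *\<^sub>R y) + ?q (c *\<^sub>R y - s *\<^sub>R x) (c *\<^sub>R y - s *\<^sub>R x)
      = ?q x x + ?q y y" using assms by simp
  have p: "exp (- a / 2) * exp (- b / 2) = exp (- (a + b) / 2)" for a b :: real
    by (simp add: exp_add[symmetric] add_divide_distrib)
  show ?thesis
    unfolding normal_dens_def times_divide_times_eq p e ..
qed

lemma normal_dens_has_derivative:
  "(normal_dens S has_derivative (\<lambda>v. - (v \<bullet> (matrix_inv S *v x)) * normal_dens S x)) (at x)"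
proof -
  let ?Z = "sqrt ((2 * pi) ^ CARD('n) * det S)"
  have bl: "bounded_linear ((*v) (matrix_inv S))" by simp
  have "((\<lambda>x. x \<bullet> (matrix_inv S *v x)) has_derivative (\<lambda>v. x \<bullet> (matrix_inv S *v v) + v \<bullet> (matrix_inv S *v x))) (at x)"
    by (intro has_derivative_inner has_derivative_ident bounded_linear_imp_has_derivative bl)
  then have q: "((\<lambda>x. x \<bullet> (matrix_inv S *v x)) has_derivative (\<lambda>v. 2 * (v \<bullet> (matrix_inv S *v x)))) (at x)"
    by (simp add: matrix_inv_symm[of x] inner_commute)
  have "((\<lambda>t. exp (- t / 2)) has_real_derivative (- exp (- t / 2) / 2)) (at t)" for t :: real
    by (auto intro!: derivative_eq_intros)
  from DERIV_compose_FDERIV[OF DERIV_cdivide[OF this, where c = ?Z] q] show ?thesis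
    unfolding normal_dens_def by (simp add: algebra_simps)
qed

lemma normal_dens_bounded: "normal_dens S x \<le> normal_dens S 0"
proof -
  have "0 \<le> x \<bullet> (matrix_inv S *v x)"
  proof -
    have "S *v (matrix_inv S *v x) = x"
      using invertible_matrix_inv[OF spd_invertible] by (simp add: matrix_vector_mul_assoc)
    then have "x \<bullet> (matrix_inv S *v x) = (matrix_inv S *v x) \<bullet> (S *v (matrix_inv S *v x))"
      by (simp add: inner_commute)
    also have "\<dots> \<ge> 0" using S unfolding symmetric_positive_definite_def by (metis inner_zero_left less_eq_real_def)
    finally show ?thesis .
  qed
  then show ?thesis using spd_det by (simp add: normal_dens_def divide_right_mono)
qed

text \<open>Integration by parts against the density: in the direction \<open>S g\<close> the logarithmic
  derivative of the density at \<open>w\<close> is \<open>- g \<bullet> w\<close>.\<close>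
lemma stein_identity:
  fixes k :: "real^'n \<Rightarrow> real" and Dk :: "real^'n \<Rightarrow> real^'n"
  assumes K: "compact K" "\<And>x. x \<notin> K \<Longrightarrow> k x = 0"
    and d: "\<And>x. GDERIV k x :> Dk x" and B: "\<And>x. norm (Dk x) \<le> B"
    and m[measurable]: "Dk \<in> borel_measurable borel"
  shows "(\<integral>w. k w * (g \<bullet> w) \<partial>centered_normal S) = (\<integral>w. Dk w \<bullet> (S *v g) \<partial>centered_normal S)"
proof -
  define e where "e = S *v g"
  have eQ: "e \<bullet> (matrix_inv S *v w) = g \<bullet> w" for w
    using matrix_inv_symm[of e w] invertible_matrix_inv[OF spd_invertible]
    by (simp add: e_def matrix_vector_mul_assoc)
  have dk: "(k has_derivative (\<lambda>v. Dk x \<bullet> v)) (at x)" for x using d[of x] by (simp add: gderiv_def inner_commute)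
  have ck: "continuous_on UNIV k" using dk by (meson continuous_at_imp_continuous_on has_derivative_continuous)
  then have km[measurable]: "k \<in> borel_measurable borel" by (rule borel_measurable_continuous_onI)
  let ?F = "\<lambda>x. k x * normal_dens S x"
  let ?F' = "\<lambda>x v. k x * (- (v \<bullet> (matrix_inv S *v x)) * normal_dens S x) + (Dk x \<bullet> v) * normal_dens S x"
  have F'e: "?F' x e = (Dk x \<bullet> e) * normal_dens S x - k x * (g \<bullet> x) * normal_dens S x" for x
    by (simp add: eQ)
  have dF: "(?F has_derivative ?F' x) (at x)" for x
    by (rule has_derivative_mult[OF dk normal_dens_has_derivative])
  have Bk: "\<exists>H. \<forall>x. \<bar>k x * (g \<bullet> x)\<bar> \<le> H"
  proof -
    have "compact ((\<lambda>x. k x * (g \<bullet> x)) ` K)"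
      by (intro compact_continuous_image K continuous_intros continuous_on_subset[OF ck]) auto
    then obtain H where "\<forall>y \<in> (\<lambda>x. k x * (g \<bullet> x)) ` K. norm y \<le> H"
      by (auto simp: bounded_iff dest!: compact_imp_bounded)
    then have "\<bar>k x * (g \<bullet> x)\<bar> \<le> max H 0" for x using K(2)[of x] by (cases "x \<in> K") force+
    then show ?thesis by blast
  qed
  then obtain H where H: "\<And>x. \<bar>k x * (g \<bullet> x)\<bar> \<le> H" by blast
  interpret prob_space "centered_normal S" by (rule prob_space_centered_normal[OF S])
  have i1: "integrable (centered_normal S) (\<lambda>w. Dk w \<bullet> e)"
    by (rule integrable_const_bound[of _ "B * norm e"])
       (auto intro!: AE_I2 order_trans[OF Cauchy_Schwarz_ineq2] mult_right_mono B)
  have i2: "integrable (centered_normal S) (\<lambda>w. k w * (g \<bullet> w))"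
    by (rule integrable_const_bound[of _ H]) (use H in auto)
  have "(\<integral>x. ?F' x e \<partial>lborel) = 0"
  proof (rule integral_directional_derivative_eq_0[where F = ?F and K = K])
    fix x
    have "\<bar>?F' x e\<bar> \<le> (\<bar>Dk x \<bullet> e\<bar> + \<bar>k x * (g \<bullet> x)\<bar>) * normal_dens S x"
    proof -
      have "?F' x e = (Dk x \<bullet> e - k x * (g \<bullet> x)) * normal_dens S x" unfolding F'e by (simp add: algebra_simps)
      then have "\<bar>?F' x e\<bar> = \<bar>Dk x \<bullet> e - k x * (g \<bullet> x)\<bar> * normal_dens S x"
        using less_imp_le[OF normal_dens_pos[of x]] by (simp add: abs_mult)
      also have "\<dots> \<le> (\<bar>Dk x \<bullet> e\<bar> + \<bar>k x * (g \<bullet> x)\<bar>) * normal_dens S x"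
        using less_imp_le[OF normal_dens_pos[of x]] by (intro mult_right_mono) linarith+
      finally show ?thesis .
    qed
    also have "\<dots> \<le> (B * norm e + H) * normal_dens S 0"
    proof (intro mult_mono add_mono H normal_dens_bounded)
      show "\<bar>Dk x \<bullet> e\<bar> \<le> B * norm e"
        by (rule order_trans[OF Cauchy_Schwarz_ineq2]) (intro mult_right_mono B norm_ge_zero)
      show "0 \<le> B * norm e + H"
        using order_trans[OF norm_ge_zero B[of x]] order_trans[OF abs_ge_zero H[of x]] by simp
      show "0 \<le> normal_dens S x" using normal_dens_pos[of x] by simp
    qed
    finally show "\<bar>?F' x e\<bar> \<le> (B * norm e + H) * normal_dens S 0" .
  next
    show "(\<lambda>x. ?F' x e) \<in> borel_measurable borel" unfolding F'e by measurable
  qed (use K dF in auto)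
  then have "(\<integral>w. Dk w \<bullet> e - k w * (g \<bullet> w) \<partial>centered_normal S) = 0"
    unfolding centered_normal_eq F'e
    by (subst integral_density) (auto intro!: AE_I2 less_imp_le[OF normal_dens_pos] simp: algebra_simps)
  then show ?thesis using i1 i2 by (simp add: e_def)
qed

lemma pair_centered_normal:
  "centered_normal S \<Otimes>\<^sub>M centered_normal S
    = density lborel (\<lambda>p. ennreal (normal_dens S (fst p) * normal_dens S (snd p)))"
proof -
  interpret prob_space "centered_normal S" by (rule prob_space_centered_normal[OF S])
  have "centered_normal S \<Otimes>\<^sub>M centered_normal S
     = density (lborel \<Otimes>\<^sub>M lborel) (\<lambda>(x, y). ennreal (normal_dens S x) * ennreal (normal_dens S y))"
    unfolding centered_normal_eq
    by (rule pair_measure_density) (auto simp: lborel.sigma_finite_measure_axioms centered_normal_eq[symmetric]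
        sigma_finite_measure_axioms)
  then show ?thesis
    by (simp add: lborel_prod case_prod_unfold ennreal_mult[symmetric] less_imp_le[OF normal_dens_pos])
qed

lemma distr_pair_centered_normal_rotation:
  assumes cs: "c\<^sup>2 + s\<^sup>2 = 1" "s \<noteq> 0"
  shows "distr (centered_normal S \<Otimes>\<^sub>M centered_normal S) borel (\<lambda>p. (c *\<^sub>R fst p + s *\<^sub>R snd p, c *\<^sub>R snd p - s *\<^sub>R fst p))
    = centered_normal S \<Otimes>\<^sub>M centered_normal S" (is "distr _ _ ?R = _")
proof -
  let ?W = "\<lambda>p. ennreal (normal_dens S (fst p) * normal_dens S (snd p))"
  have [measurable]: "?R \<in> borel_measurable borel"
    by (intro borel_measurable_continuous_onI continuous_intros)
  have [measurable]: "?W \<in> borel_measurable borel"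
    by (intro measurable_compose[OF _ measurable_ennreal] borel_measurable_continuous_onI continuous_intros
        continuous_on_compose2[OF continuous_normal_dens]) auto
  have "?W p = ?W (?R p)" for p using normal_dens_rotation[OF cs(1), of "fst p" "snd p"] by simp
  then have "distr (density lborel ?W) borel ?R = distr (density lborel (\<lambda>p. ?W (?R p))) borel ?R" by simp
  also have "\<dots> = density (distr lborel borel ?R) ?W" by (subst density_distr) auto
  also have "\<dots> = density lborel ?W" by (simp only: distr_lborel_rotation[OF cs])
  finally show ?thesis unfolding pair_centered_normal .
qed

text \<open>For independent \<open>X\<close>, \<open>Y\<close> with this law, the function \<open>\<theta> \<mapsto> E (h X * h (cos \<theta> X + sin \<theta> Y))\<close>
  interpolates between \<open>E (h\<^sup>2)\<close> and \<open>(E h)\<^sup>2\<close>. Rotating the pair and integrating by parts, its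
  derivative is \<open>- sin \<theta>\<close> times the correlation of the gradients at \<open>X\<close> and at the rotated
  variable, so it is at least \<open>- sin \<theta>\<close> times the Dirichlet energy.\<close>
theorem gaussian_poincare:
  fixes h :: "real^'n \<Rightarrow> real" and D :: "real^'n \<Rightarrow> real^'n"
  assumes K: "compact K" "\<And>x. x \<notin> K \<Longrightarrow> h x = 0"
    and d: "\<And>x. GDERIV h x :> D x" and B: "\<And>x. norm (D x) \<le> B"
    and m[measurable]: "D \<in> borel_measurable borel"
  shows "(\<integral>x. (h x)\<^sup>2 \<partial>centered_normal S) - (\<integral>x. h x \<partial>centered_normal S)\<^sup>2
    \<le> (\<integral>x. D x \<bullet> (S *v D x) \<partial>centered_normal S)"
proof -
  let ?N = "centered_normal S"
  let ?P = "?N \<Otimes>\<^sub>M ?N"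
  interpret N: prob_space ?N by (rule prob_space_centered_normal[OF S])
  interpret P: pair_prob_space ?N ?N ..
  have setsP[measurable_cong, simp]: "sets ?P = sets borel"
    unfolding pair_centered_normal by simp
  have spaceP[simp]: "space ?P = UNIV" by (simp add: space_pair_measure)
  have B0: "0 \<le> B" using order_trans[OF norm_ge_zero B] .
  have dh: "(h has_derivative (\<lambda>v. D x \<bullet> v)) (at x)" for x using d[of x] by (simp add: gderiv_def inner_commute)
  have ch: "continuous_on UNIV h" using dh by (meson continuous_at_imp_continuous_on has_derivative_continuous)
  then have hm[measurable]: "h \<in> borel_measurable borel" by (rule borel_measurable_continuous_onI)
  obtain H where H: "\<And>x. \<bar>h x\<bar> \<le> H" and H0: "0 \<le> H"
  proof -
    have "compact (h ` K)" by (intro compact_continuous_image K continuous_on_subset[OF ch]) auto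
    then obtain H where "\<forall>y \<in> h ` K. norm y \<le> H"
      by (auto simp: bounded_iff dest!: compact_imp_bounded)
    then have "\<bar>h x\<bar> \<le> max H 0" for x using K(2)[of x] by (cases "x \<in> K") force+
    then show ?thesis using that[of "max H 0"] by simp
  qed
  have meas_lin[measurable]: "(\<lambda>p. a *\<^sub>R fst p + b *\<^sub>R snd p) \<in> borel_measurable (borel :: ((real^'n) \<times> (real^'n)) measure)"
     "(\<lambda>p. a *\<^sub>R fst p - b *\<^sub>R snd p) \<in> borel_measurable (borel :: ((real^'n) \<times> (real^'n)) measure)"
     "(\<lambda>p. a *\<^sub>R snd p - b *\<^sub>R fst p) \<in> borel_measurable (borel :: ((real^'n) \<times> (real^'n)) measure)" for a b :: real
    by (intro borel_measurable_continuous_onI continuous_intros)+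
  have [measurable]: "fst \<in> borel_measurable (borel :: ((real^'n) \<times> (real^'n)) measure)"
     "snd \<in> borel_measurable (borel :: ((real^'n) \<times> (real^'n)) measure)"
    by (intro borel_measurable_continuous_onI continuous_intros)+
  have [measurable]: "(\<lambda>x. S *v D x) \<in> borel_measurable borel"
    by (rule measurable_compose[OF m]) (auto intro!: borel_measurable_continuous_onI matrix_vector_mult_linear_continuous_on)
  have fst_P: "distr ?P ?N fst = ?N" by (rule N.distr_pair_fst)
  have int_fst: "(\<integral>p. F (fst p) \<partial>?P) = (\<integral>x. F x \<partial>?N)" if [measurable]: "F \<in> borel_measurable borel" for F :: "real^'n \<Rightarrow> real"
  proof -
    have "(\<integral>x. F x \<partial>?N) = (\<integral>x. F x \<partial>distr ?P ?N fst)" by (simp add: fst_P)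
    also have "\<dots> = (\<integral>p. F (fst p) \<partial>?P)" by (rule integral_distr) auto
    finally show ?thesis ..
  qed
  have in1: "integrable ?P (\<lambda>p. norm (fst p))"
  proof -
    have "integrable (distr ?P ?N fst) norm" unfolding fst_P by (rule integrable_norm_centered_normal[OF S])
    then show ?thesis by (subst (asm) integrable_distr_eq) auto
  qed
  have in2: "integrable ?P (\<lambda>p. norm (snd p))"
  proof -
    have "integrable ?P (\<lambda>(x, y). norm (fst (y, x)))"
      by (rule P.integrable_product_swap) (use in1 in simp)
    then show ?thesis by (simp add: case_prod_unfold)
  qed
  define q where "q v = v \<bullet> (S *v v)" for v
  have q0: "0 \<le> q v" for v
    using S unfolding symmetric_positive_definite_def q_def by (cases "v = 0") (auto intro: less_imp_le)
  \<comment> \<open>positive semidefiniteness at \<open>a - b\<close>\<close>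
  have pol: "2 * (a \<bullet> (S *v b)) \<le> q a + q b" for a b
  proof -
    have "q (a - b) = q a + q b - 2 * (a \<bullet> (S *v b))"
      using spd_symm[of a b]
      by (simp add: q_def matrix_vector_mult_diff_distrib inner_diff_left inner_diff_right inner_commute)
    then show ?thesis using q0[of "a - b"] by linarith
  qed
  obtain b where b: "\<And>v. norm (S *v v) \<le> norm v * b"
    using bounded_linear.bounded[OF matrix_vector_mul_bounded_linear[of S]] by blast
  have bD: "norm (S *v D x) \<le> B * \<bar>b\<bar>" for x
  proof -
    have "norm (S *v D x) \<le> norm (D x) * \<bar>b\<bar>" using b[of "D x"] by (meson abs_ge_self mult_left_mono norm_ge_zero order_trans)
    also have "\<dots> \<le> B * \<bar>b\<bar>" using B by (intro mult_right_mono) auto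
    finally show ?thesis .
  qed
  have DSD: "\<bar>D x \<bullet> (S *v D y)\<bar> \<le> B * (B * \<bar>b\<bar>)" for x y
    by (rule order_trans[OF Cauchy_Schwarz_ineq2]) (intro mult_mono B bD norm_ge_zero B0)
  define M where "M = (\<integral>x. q (D x) \<partial>?N)"
  let ?X = "\<lambda>t (p :: (real^'n) \<times> (real^'n)). cos t *\<^sub>R fst p + sin t *\<^sub>R snd p" and ?Y = "\<lambda>t (p :: (real^'n) \<times> (real^'n)). cos t *\<^sub>R snd p - sin t *\<^sub>R fst p"
  define \<phi> where "\<phi> t = (\<integral>p. h (fst p) * h (?X t p) \<partial>?P)" for t
  define \<phi>' where "\<phi>' t = (\<integral>p. h (fst p) * (D (?X t p) \<bullet> ?Y t p) \<partial>?P)" for t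
  have der: "(\<phi> has_real_derivative \<phi>' t) (at t)" for t
  proof -
    have "(\<phi> has_derivative (\<lambda>v. \<integral>p. h (fst p) * (D (?X t p) \<bullet> (v *\<^sub>R ?Y t p)) \<partial>?P)) (at t)"
      unfolding \<phi>_def
    proof (rule has_derivative_integral_dominated[where U = UNIV and g = "\<lambda>p. H * (B * (norm (fst p) + norm (snd p)))"
        and f' = "\<lambda>t p v. h (fst p) * (D (?X t p) \<bullet> (v *\<^sub>R ?Y t p))"])
      fix t
      show "integrable ?P (\<lambda>p. h (fst p) * h (?X t p))"
        by (rule P.integrable_const_bound[of _ "H * H"]) (auto intro!: AE_I2 mult_mono H H0 simp: abs_mult)
      fix p :: "(real^'n) \<times> (real^'n)"
      have "((\<lambda>t. ?X t p) has_derivative (\<lambda>v. v *\<^sub>R ?Y t p)) (at t)"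
        by (auto intro!: derivative_eq_intros simp: algebra_simps)
      then show "((\<lambda>t. h (fst p) * h (?X t p)) has_derivative (\<lambda>v. h (fst p) * (D (?X t p) \<bullet> (v *\<^sub>R ?Y t p)))) (at t)"
        by (intro has_derivative_mult_right has_derivative_compose[OF _ dh])
      fix v :: real
      have "norm (?Y t p) \<le> norm (fst p) + norm (snd p)"
      proof -
        have "norm (?Y t p) \<le> \<bar>cos t\<bar> * norm (snd p) + \<bar>sin t\<bar> * norm (fst p)"
          using norm_triangle_ineq4[of "cos t *\<^sub>R snd p" "sin t *\<^sub>R fst p"] by simp
        also have "\<dots> \<le> 1 * norm (snd p) + 1 * norm (fst p)"
          by (intro add_mono mult_right_mono) auto
        finally show ?thesis by simp
      qed
      then have Dv: "\<bar>D (?X t p) \<bullet> (v *\<^sub>R ?Y t p)\<bar> \<le> B * (\<bar>v\<bar> * (norm (fst p) + norm (snd p)))"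
        by (intro order_trans[OF Cauchy_Schwarz_ineq2] mult_mono B B0) (auto intro!: mult_left_mono)
      have "\<bar>h (fst p)\<bar> * \<bar>D (?X t p) \<bullet> (v *\<^sub>R ?Y t p)\<bar> \<le> H * (B * (\<bar>v\<bar> * (norm (fst p) + norm (snd p))))"
        by (intro mult_mono H H0 Dv) auto
      then show "\<bar>h (fst p) * (D (?X t p) \<bullet> (v *\<^sub>R ?Y t p))\<bar> \<le> H * (B * (norm (fst p) + norm (snd p))) * norm v"
        by (simp add: abs_mult mult_ac)
    qed (use in1 in2 in auto)
    moreover have "(\<lambda>v. \<integral>p. h (fst p) * (D (?X t p) \<bullet> (v *\<^sub>R ?Y t p)) \<partial>?P) = (\<lambda>v. \<phi>' t * v)"
      by (simp add: \<phi>'_def mult_ac flip: integral_mult_right_zero)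
    ultimately show ?thesis by (simp add: has_field_derivative_def)
  qed
  have lower: "- sin t * M \<le> \<phi>' t" if t: "0 < t" "t < pi / 2" for t
  proof -
    define c s where "c = cos t" and "s = sin t"
    have s: "s > 0" unfolding s_def using t by (intro sin_gt_zero) auto
    have cs: "c\<^sup>2 + s\<^sup>2 = 1" by (simp add: c_def s_def)
    let ?R = "\<lambda>p. (c *\<^sub>R fst p + s *\<^sub>R snd p, c *\<^sub>R snd p - s *\<^sub>R fst p) :: (real^'n) \<times> (real^'n)"
    have rot: "(\<integral>p. F (?R p) \<partial>?P) = (\<integral>p. F p \<partial>?P)" if [measurable]: "F \<in> borel_measurable borel" for F :: "(real^'n) \<times> (real^'n) \<Rightarrow> real"
    proof -
      have "(\<integral>p. F p \<partial>?P) = (\<integral>p. F p \<partial>distr ?P borel ?R)"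
        using distr_pair_centered_normal_rotation[OF cs] s by simp
      also have "\<dots> = (\<integral>p. F (?R p) \<partial>?P)"
        by (rule integral_distr) (auto intro!: borel_measurable_continuous_onI continuous_intros)
      finally show ?thesis ..
    qed
    have unrotate: "c *\<^sub>R (c *\<^sub>R x + s *\<^sub>R y) - s *\<^sub>R (c *\<^sub>R y - s *\<^sub>R x) = x" for x y :: "real^'n"
    proof -
      have "c *\<^sub>R (c *\<^sub>R x + s *\<^sub>R y) - s *\<^sub>R (c *\<^sub>R y - s *\<^sub>R x) = (c\<^sup>2 + s\<^sup>2) *\<^sub>R x"
        by (simp add: algebra_simps power2_eq_square)
      then show ?thesis by (simp add: cs)
    qed
    let ?F = "\<lambda>p. h (c *\<^sub>R fst p - s *\<^sub>R snd p) * (D (fst p) \<bullet> snd p)"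
    have Fm: "?F \<in> borel_measurable borel" by measurable
    have intF: "integrable ?P ?F"
    proof (rule Bochner_Integration.integrable_bound)
      show "integrable ?P (\<lambda>p. H * (B * norm (snd p)))" using in2 by simp
      show "AE p in ?P. norm (?F p) \<le> norm (H * (B * norm (snd p)))"
      proof (rule AE_I2)
        fix p :: "(real^'n) \<times> (real^'n)"
        have "\<bar>D (fst p) \<bullet> snd p\<bar> \<le> B * norm (snd p)"
          by (intro order_trans[OF Cauchy_Schwarz_ineq2] mult_right_mono B) auto
        then have "\<bar>h (c *\<^sub>R fst p - s *\<^sub>R snd p)\<bar> * \<bar>D (fst p) \<bullet> snd p\<bar> \<le> H * (B * norm (snd p))"
          by (intro mult_mono H H0) auto
        then show "norm (?F p) \<le> norm (H * (B * norm (snd p)))"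
          using H0 B0 by (simp add: abs_mult)
      qed
    qed (use Fm in simp)
    have iq: "integrable ?P (\<lambda>p. q (D (c *\<^sub>R fst p - s *\<^sub>R snd p)))" "integrable ?P (\<lambda>p. q (D (fst p)))"
      unfolding q_def by (intro P.integrable_const_bound[of _ "B * (B * \<bar>b\<bar>)"]; use DSD in auto)+
    \<comment> \<open>in rotated coordinates \<open>h\<close> at the first copy becomes a function of both variables\<close>
    have "\<phi>' t = (\<integral>p. ?F (?R p) \<partial>?P)"
      unfolding \<phi>'_def c_def[symmetric] s_def[symmetric] by (simp only: fst_conv snd_conv unrotate)
    also have "\<dots> = (\<integral>p. ?F p \<partial>?P)" by (rule rot[OF Fm])
    also have "\<dots> = (\<integral>u. \<integral>w. ?F (u, w) \<partial>?N \<partial>?N)" by (rule P.integral_fst'[OF intF, symmetric])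
    also have "\<dots> = (\<integral>u. \<integral>w. - s * (D (c *\<^sub>R u - s *\<^sub>R w) \<bullet> (S *v D u)) \<partial>?N \<partial>?N)"
    proof (rule Bochner_Integration.integral_cong[OF refl])
      fix u
      let ?k = "\<lambda>w. h (c *\<^sub>R u - s *\<^sub>R w)" and ?Dk = "\<lambda>w. - s *\<^sub>R D (c *\<^sub>R u - s *\<^sub>R w)"
      let ?K = "(\<lambda>z. (c / s) *\<^sub>R u - (1 / s) *\<^sub>R z) ` K"
      \<comment> \<open>integration by parts in the second variable, the first one being fixed\<close>
      have "(\<integral>w. ?k w * (D u \<bullet> w) \<partial>?N) = (\<integral>w. ?Dk w \<bullet> (S *v D u) \<partial>?N)"
      proof (rule stein_identity[of ?K])
        show "compact ?K" by (intro compact_continuous_image K continuous_intros)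
        show "?k w = 0" if "w \<notin> ?K" for w
        proof (rule K(2), rule notI)
          assume "c *\<^sub>R u - s *\<^sub>R w \<in> K"
          then have "w \<in> ?K" using s by (intro image_eqI[of _ _ "c *\<^sub>R u - s *\<^sub>R w"]) (auto simp: algebra_simps)
          with that show False by blast
        qed
        show "GDERIV ?k w :> ?Dk w" for w
        proof -
          have "((\<lambda>w. c *\<^sub>R u - s *\<^sub>R w) has_derivative (\<lambda>v. - s *\<^sub>R v)) (at w)"
            by (auto intro!: derivative_eq_intros)
          from has_derivative_compose[OF this dh] show ?thesis
            by (simp add: gderiv_def inner_commute)
        qed
        show "norm (?Dk w) \<le> s * B" for w using s B by simp
        have "(\<lambda>w. c *\<^sub>R u - s *\<^sub>R w) \<in> borel_measurable borel"
          by (intro borel_measurable_continuous_onI continuous_intros)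
        then show "?Dk \<in> borel_measurable borel" by measurable
      qed
      then show "(\<integral>w. ?F (u, w) \<partial>?N) = (\<integral>w. - s * (D (c *\<^sub>R u - s *\<^sub>R w) \<bullet> (S *v D u)) \<partial>?N)" by simp
    qed
    also have "\<dots> = (\<integral>p. - s * (D (c *\<^sub>R fst p - s *\<^sub>R snd p) \<bullet> (S *v D (fst p))) \<partial>?P)"
    proof -
      have "integrable ?P (\<lambda>p. - s * (D (c *\<^sub>R fst p - s *\<^sub>R snd p) \<bullet> (S *v D (fst p))))"
        by (intro integrable_mult_right P.integrable_const_bound[of _ "B * (B * \<bar>b\<bar>)"]) (use DSD in auto)
      from P.integral_fst'[OF this] show ?thesis by simp
    qed
    also have "\<dots> \<ge> (\<integral>p. - s * ((q (D (c *\<^sub>R fst p - s *\<^sub>R snd p)) + q (D (fst p))) / 2) \<partial>?P)"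
    proof (rule integral_mono)
      show "integrable ?P (\<lambda>p. - s * (D (c *\<^sub>R fst p - s *\<^sub>R snd p) \<bullet> (S *v D (fst p))))"
        by (intro integrable_mult_right P.integrable_const_bound[of _ "B * (B * \<bar>b\<bar>)"]) (use DSD in auto)
      show "integrable ?P (\<lambda>p. - s * ((q (D (c *\<^sub>R fst p - s *\<^sub>R snd p)) + q (D (fst p))) / 2))"
        by (intro integrable_mult_right integrable_divide Bochner_Integration.integrable_add iq)
      fix p :: "(real^'n) \<times> (real^'n)"
      show "- s * ((q (D (c *\<^sub>R fst p - s *\<^sub>R snd p)) + q (D (fst p))) / 2)
          \<le> - s * (D (c *\<^sub>R fst p - s *\<^sub>R snd p) \<bullet> (S *v D (fst p)))"
        using pol[of "D (c *\<^sub>R fst p - s *\<^sub>R snd p)" "D (fst p)"] s by (simp add: mult_left_mono)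
    qed
    also have "(\<integral>p. - s * ((q (D (c *\<^sub>R fst p - s *\<^sub>R snd p)) + q (D (fst p))) / 2) \<partial>?P)
      = - s * (((\<integral>p. q (D (c *\<^sub>R fst p - s *\<^sub>R snd p)) \<partial>?P) + (\<integral>p. q (D (fst p)) \<partial>?P)) / 2)"
    proof -
      show ?thesis using iq by simp
    qed
    also have "(\<integral>p. q (D (c *\<^sub>R fst p - s *\<^sub>R snd p)) \<partial>?P) = (\<integral>p. q (D (fst p)) \<partial>?P)"
    proof -
      have Gm: "(\<lambda>p. q (D (c *\<^sub>R fst p - s *\<^sub>R snd p))) \<in> borel_measurable borel"
        unfolding q_def by measurable
      show ?thesis unfolding rot[OF Gm, symmetric] by (simp only: fst_conv snd_conv unrotate)
    qed
    also have "(\<integral>p. q (D (fst p)) \<partial>?P) = M"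
      unfolding M_def by (rule int_fst) (unfold q_def, measurable)
    finally show ?thesis by (simp add: s_def)
  qed
  \<comment> \<open>by \<open>lower\<close> this function is nondecreasing on the quarter period\<close>
  have "((\<lambda>t. \<phi> t - M * cos t) has_real_derivative \<phi>' t + M * sin t) (at t)" for t
    by (auto intro!: derivative_eq_intros der)
  then obtain z where z: "0 < z" "z < pi / 2"
    "(\<phi> (pi / 2) - M * cos (pi / 2)) - (\<phi> 0 - M * cos 0) = (pi / 2 - 0) * (\<phi>' z + M * sin z)"
    using MVT2[of 0 "pi / 2" "\<lambda>t. \<phi> t - M * cos t" "\<lambda>t. \<phi>' t + M * sin t"] by auto
  have "0 \<le> (pi / 2 - 0) * (\<phi>' z + M * sin z)"
    using lower[OF z(1,2)] by (intro mult_nonneg_nonneg) (auto simp: algebra_simps)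
  then have "\<phi> 0 - \<phi> (pi / 2) \<le> M" using z(3) by simp
  moreover have "\<phi> 0 = (\<integral>x. (h x)\<^sup>2 \<partial>?N)"
    using int_fst[of "\<lambda>x. (h x)\<^sup>2"] by (simp add: \<phi>_def power2_eq_square)
  moreover have "\<phi> (pi / 2) = (\<integral>x. h x \<partial>?N)\<^sup>2"
  proof -
    have "integrable ?P (\<lambda>p. h (fst p) * h (snd p))"
      by (rule P.integrable_const_bound[of _ "H * H"]) (auto intro!: AE_I2 mult_mono H H0 simp: abs_mult)
    from P.integral_fst'[OF this] show ?thesis by (simp add: \<phi>_def power2_eq_square)
  qed
  ultimately show ?thesis by (simp add: M_def q_def)
qed

end

section \<open>Monotone transport on the line\<close>

lemma cdf_has_density_derivative:
  fixes r :: "real \<Rightarrow> real"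
  assumes M: "real_distribution M" "M = density lborel (\<lambda>x. ennreal (r x))"
    and r[measurable]: "r \<in> borel_measurable borel" and r0: "\<And>x. 0 \<le> r x"
    and J: "open J" "x \<in> J" "continuous_on J r"
  shows "(cdf M has_real_derivative r x) (at x)"
proof -
  interpret real_distribution M by fact
  obtain e where e: "e > 0" "cball x e \<subseteq> J" using J(1,2) open_contains_cball by blast
  define a b where "a = x - e" and "b = x + e"
  have ab: "a < x" "x < b" "{a..b} \<subseteq> J" using e by (auto simp: a_def b_def cball_eq_atLeastAtMost)
  have cont: "continuous_on {a..b} r" using J(3) ab(3) by (rule continuous_on_subset)
  have "cdf M y = cdf M a + integral {a..y} r" if y: "y \<in> {a..b}" for y
  proof -
    have i: "(r has_integral integral {a..y} r) {a..y}"
      using y by (intro integrable_integral integrable_continuous_interval continuous_on_subset[OF cont]) auto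
    have I0: "0 \<le> integral {a..y} r" using i r0 by (meson has_integral_nonneg)
    have "emeasure M {a<..y} = (\<integral>\<^sup>+x. ennreal (r x) * indicator {a<..y} x \<partial>lborel)"
      unfolding M(2) by (rule emeasure_density) auto
    also have "\<dots> = (\<integral>\<^sup>+x. ennreal (r x * indicator {a..y} x) \<partial>lborel)"
      by (rule nn_integral_cong_AE) (use AE_lborel_singleton[of a] in eventually_elim, auto simp: indicator_def)
    also have "\<dots> = ennreal (integral {a..y} r)"
    proof (rule nn_integral_has_integral_lborel)
      show "((\<lambda>x. r x * indicator {a..y} x) has_integral integral {a..y} r) UNIV"
        using i unfolding has_integral_restrict_UNIV[of "{a..y}", symmetric]
        by (rule has_integral_eq_rhs[OF has_integral_cong[THEN iffD1, rotated]]) (auto simp: indicator_def)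
    qed (auto simp: r0)
    finally have "measure M {a<..y} = integral {a..y} r"
      using I0 by (simp add: measure_def)
    moreover have "cdf M y - cdf M a = measure M {a<..y}"
      using y ab by (cases "a = y") (auto simp: cdf_diff_eq)
    ultimately show ?thesis by simp
  qed
  then have eq: "\<forall>y\<in>{a..b}. cdf M a + integral {a..y} r = cdf M y" by (intro ballI) (rule sym)
  have "((\<lambda>y. cdf M a + integral {a..y} r) has_real_derivative r x) (at x within {a..b})"
    using integral_has_real_derivative[OF cont, of x] ab by (auto intro!: derivative_eq_intros)
  then have "(cdf M has_real_derivative r x) (at x within {a..b})"
    by (rule has_field_derivative_transform_within[where d = 1]) (use eq ab in auto)
  then show ?thesis
    using ab at_within_interior[of x "{a..b}"] by simp
qed

lemma std_normal_real_distribution: "real_distribution (density lborel std_normal_density)"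
proof -
  interpret prob_space "density lborel std_normal_density" by (rule prob_space_normal_density) simp
  show ?thesis by unfold_locales auto
qed

lemma std_normal_cdf_has_derivative: "(std_normal_cdf has_real_derivative std_normal_density x) (at x)"
  unfolding std_normal_cdf_def
proof (rule cdf_has_density_derivative[where J = UNIV])
  show "continuous_on UNIV std_normal_density"
    unfolding std_normal_density_def by (intro continuous_intros) auto
qed (auto simp: std_normal_real_distribution simp del: std_normal_density_def)

lemma std_normal_density_gt_0: "std_normal_density x > 0"
  by (simp add: std_normal_density_def)

lemma std_normal_cdf_strict_mono: "strict_mono std_normal_cdf"
proof (rule strict_monoI)
  fix x y :: real assume "x < y"
  then show "std_normal_cdf x < std_normal_cdf y"
    by (rule DERIV_pos_imp_increasing) (use std_normal_cdf_has_derivative std_normal_density_gt_0 in blast)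
qed

lemma std_normal_cdf_gt_0: "0 < std_normal_cdf x" and std_normal_cdf_lt_1: "std_normal_cdf x < 1"
proof -
  interpret real_distribution "density lborel std_normal_density" by (rule std_normal_real_distribution)
  have "std_normal_cdf (x - 1) < std_normal_cdf x" "std_normal_cdf x < std_normal_cdf (x + 1)"
    using std_normal_cdf_strict_mono by (auto simp: strict_mono_def)
  moreover have "0 \<le> std_normal_cdf (x - 1)" "std_normal_cdf (x + 1) \<le> 1"
    unfolding std_normal_cdf_def by (auto simp: cdf_nonneg cdf_bounded_prob)
  ultimately show "0 < std_normal_cdf x" "std_normal_cdf x < 1" by linarith+
qed

lemma std_normal_cdf_surj:
  assumes "0 < p" "p < 1"
  obtains x where "std_normal_cdf x = p"
proof -
  interpret real_distribution "density lborel std_normal_density" by (rule std_normal_real_distribution)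
  have "eventually (\<lambda>x. std_normal_cdf x < p) at_bot" "eventually (\<lambda>x. p < std_normal_cdf x) at_top"
    using order_tendstoD(2)[OF cdf_lim_at_bot assms(1)] order_tendstoD(1)[OF cdf_lim_at_top_prob assms(2)]
    by (auto simp: std_normal_cdf_def)
  then obtain a b where ab: "std_normal_cdf a < p" "p < std_normal_cdf b"
    by (metis eventually_at_bot_linorder eventually_at_top_linorder order_refl)
  then have "a \<le> b" using std_normal_cdf_strict_mono by (meson less_trans linear not_less strict_mono_less_eq)
  moreover have "\<forall>x. a \<le> x \<and> x \<le> b \<longrightarrow> isCont std_normal_cdf x"
    using std_normal_cdf_has_derivative DERIV_isCont by blast
  ultimately obtain x where "std_normal_cdf x = p"
    using IVT[of std_normal_cdf a p b] ab by auto
  with that show thesis by blast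
qed

lemma cdf_quantile:
  assumes M: "real_distribution M" "\<And>x. measure M {x} = 0" and p: "0 < p" "p < 1"
  shows "cdf M (quantile M p) = p"
proof -
  interpret real_distribution M by fact
  have cont: "isCont (cdf M) x" for x using M(2) isCont_cdf by blast
  let ?A = "{x. p \<le> cdf M x}"
  obtain b where b: "\<And>x. x \<ge> b \<Longrightarrow> p < cdf M x"
    using order_tendstoD(1)[OF cdf_lim_at_top_prob p(2)] unfolding eventually_at_top_linorder by blast
  obtain a where a: "\<And>x. x \<le> a \<Longrightarrow> cdf M x < p"
    using order_tendstoD(2)[OF cdf_lim_at_bot p(1)] unfolding eventually_at_bot_linorder by blast
  have ne: "?A \<noteq> {}" using b[of b] by (auto intro: less_imp_le)
  have bd: "bdd_below ?A" using a by (intro bdd_belowI[of _ a]) (metis mem_Collect_eq not_less linear)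
  have cl: "closed ?A"
    by (intro closed_Collect_le continuous_intros continuous_at_imp_continuous_on) (use cont in auto)
  have q: "quantile M p = Inf ?A" by (simp add: quantile_def)
  have ge: "p \<le> cdf M (quantile M p)"
    using closed_contains_Inf[OF ne bd cl] by (simp add: q)
  moreover have "cdf M (quantile M p) \<le> p"
  proof (rule ccontr)
    assume "\<not> ?thesis"
    then have "p < cdf M (quantile M p)" by simp
    then have "eventually (\<lambda>x. p < cdf M x) (at (quantile M p))"
      using cont order_tendstoD(1) unfolding isCont_def by blast
    then obtain d where d: "d > 0" "\<And>x. x \<noteq> quantile M p \<Longrightarrow> dist x (quantile M p) < d \<Longrightarrow> p < cdf M x"
      unfolding eventually_at by blast
    have "p < cdf M (quantile M p - d / 2)" using d by (intro d(2)) (auto simp: dist_real_def)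
    then have "quantile M p \<le> quantile M p - d / 2"
      unfolding q by (intro cInf_lower bd) (simp add: q[symmetric])
    with d(1) show False by simp
  qed
  ultimately show ?thesis by simp
qed

context
  fixes M :: "real measure" and J :: "real set" and V V' V'' :: "real \<Rightarrow> real" and \<kappa> :: real
  assumes prob: "prob_space M" and J: "open J" "is_interval J"
    and M: "M = density lborel (\<lambda>x. ennreal (indicator J x * exp (- V x)))"
    and V': "\<And>x. x \<in> J \<Longrightarrow> (V has_real_derivative V' x) (at x)"
    and V'': "\<And>x. x \<in> J \<Longrightarrow> (V' has_real_derivative V'' x) (at x)"
    and \<kappa>: "0 < \<kappa>" "\<And>x. x \<in> J \<Longrightarrow> \<kappa> \<le> V'' x"
begin

lemma density_real_distribution: "real_distribution M"
proof -
  interpret prob_space M by (rule prob)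
  show ?thesis by unfold_locales (simp_all add: M)
qed

lemma continuous_on_density: "continuous_on J (\<lambda>x. indicator J x * exp (- V x))"
proof -
  have "continuous_on J V" using V' by (meson DERIV_isCont continuous_at_imp_continuous_on)
  then have "continuous_on J (\<lambda>x. exp (- V x))" by (intro continuous_intros)
  then show ?thesis by (rule continuous_on_eq) auto
qed

lemma borel_measurable_density: "(\<lambda>x. indicator J x * exp (- V x)) \<in> borel_measurable borel"
proof -
  have "continuous_on J (\<lambda>x. exp (- V x))"
    using continuous_on_density by (rule continuous_on_eq) auto
  then have "(\<lambda>x. indicator J x *\<^sub>R exp (- V x)) \<in> borel_measurable borel"
    using J by (intro borel_measurable_continuous_on_indicator) auto
  then show ?thesis by simp
qed

lemma density_no_atoms: "measure M {x} = 0"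
proof -
  have "emeasure M {x} = 0"
    unfolding M using borel_measurable_density
    by (subst emeasure_density) (auto intro!: nn_integral_0_iff_AE[THEN iffD2] AE_mp[OF AE_lborel_singleton[of x]] AE_I2)
  then show ?thesis by (simp add: measure_def)
qed

lemma cdf_density_derivative:
  assumes "x \<in> J"
  shows "(cdf M has_real_derivative exp (- V x)) (at x)"
proof -
  have "(cdf M has_real_derivative indicator J x * exp (- V x)) (at x)"
    by (rule cdf_has_density_derivative[OF density_real_distribution M borel_measurable_density _ J(1) assms continuous_on_density])
       simp
  then show ?thesis using assms by simp
qed

lemma cdf_strictly_inside_imp_support:
  assumes "0 < cdf M y" "cdf M y < 1"
  shows "y \<in> J"
proof (rule ccontr)
  interpret real_distribution M by (rule density_real_distribution)
  assume y: "y \<notin> J"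
  have z: "measure M A = 0" if "A \<in> sets borel" "A \<inter> J = {}" for A
  proof -
    have "emeasure M A = 0"
      unfolding M using that borel_measurable_density
      by (subst emeasure_density) (auto intro!: nn_integral_0_iff_AE[THEN iffD2] AE_I2 simp: indicator_def)
    then show ?thesis by (simp add: measure_def)
  qed
  show False
  proof (cases "\<exists>z\<in>J. z < y")
    case False
    then have "{..y} \<inter> J = {}" using y by force
    then have "cdf M y = 0" using z[of "{..y}"] by (simp add: cdf_def2)
    with assms show False by simp
  next
    case True
    then have "{y<..} \<inter> J = {}" using y J(2) by (auto simp: is_interval_1 intro: less_imp_le)
    then have "measure M {y<..} = 0" using z[of "{y<..}"] by simp
    moreover have "measure M (space M - {..y}) = 1 - measure M {..y}" by (rule prob_compl) simp
    moreover have "space M - {..y} = {y<..}" by auto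
    ultimately show False using assms by (simp add: cdf_def2)
  qed
qed

lemma cdf_density_strict_mono:
  assumes "x \<in> J" "y \<in> J" "x < y"
  shows "cdf M x < cdf M y"
proof (rule DERIV_pos_imp_increasing[OF assms(3)])
  fix z assume "x \<le> z" "z \<le> y"
  then have "z \<in> J" using assms J(2) unfolding is_interval_1 by blast
  then show "\<exists>d. (cdf M has_real_derivative d) (at z) \<and> 0 < d"
    using cdf_density_derivative by (intro exI[of _ "exp (- V z)"]) auto
qed

lemma cdf_support_strictly_inside:
  assumes "y \<in> J" shows "0 < cdf M y" "cdf M y < 1"
proof -
  interpret real_distribution M by (rule density_real_distribution)
  obtain e where e: "e > 0" "cball y e \<subseteq> J" using J(1) assms open_contains_cball by blast
  then have "y - e \<in> J" "y + e \<in> J" by (auto simp: cball_eq_atLeastAtMost)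
  then have "cdf M (y - e) < cdf M y" "cdf M y < cdf M (y + e)"
    using cdf_density_strict_mono assms e(1) by auto
  then show "0 < cdf M y" "cdf M y < 1"
    using cdf_nonneg[of "y - e"] cdf_bounded_prob[of "y + e"] by linarith+
qed

abbreviation (input) nataf1 :: "real \<Rightarrow> real" where
  "nataf1 x \<equiv> quantile M (std_normal_cdf x)"

lemma cdf_nataf1: "cdf M (nataf1 x) = std_normal_cdf x"
  by (rule cdf_quantile[OF density_real_distribution density_no_atoms std_normal_cdf_gt_0 std_normal_cdf_lt_1])

lemma nataf1_in_support: "nataf1 x \<in> J"
  by (rule cdf_strictly_inside_imp_support) (simp_all add: cdf_nataf1 std_normal_cdf_gt_0 std_normal_cdf_lt_1)

lemma nataf1_strict_mono: "strict_mono nataf1"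
proof (rule strict_monoI)
  interpret real_distribution M by (rule density_real_distribution)
  fix x y :: real assume "x < y"
  then have "cdf M (nataf1 x) < cdf M (nataf1 y)"
    unfolding cdf_nataf1 using std_normal_cdf_strict_mono by (simp add: strict_mono_less)
  then show "nataf1 x < nataf1 y" using cdf_nondecreasing[of "nataf1 y" "nataf1 x"] by (meson not_less)
qed

lemma nataf1_surj:
  assumes "y \<in> J" obtains x where "nataf1 x = y"
proof -
  obtain x where x: "std_normal_cdf x = cdf M y"
    using std_normal_cdf_surj[OF cdf_support_strictly_inside[OF assms]] by blast
  have "nataf1 x = y"
    using cdf_density_strict_mono[OF assms nataf1_in_support[of x]] cdf_density_strict_mono[OF nataf1_in_support[of x] assms]
      cdf_nataf1[of x] x by (metis less_irrefl linorder_less_linear)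
  with that show thesis by blast
qed

text \<open>Let \<open>u\<close> be the density of \<open>M\<close> at the image point minus \<open>\<surd>\<kappa>\<close> times the Gaussian density; it is
  the quantity whose sign decides whether the derivative exceeds \<open>1 / \<surd>\<kappa>\<close>. If \<open>u\<close> were negative
  somewhere it would have a negative global minimum, because the Gaussian density vanishes at
  infinity. Now \<open>u'\<close> is the Gaussian density times a function \<open>r\<close> which vanishes at that point and has
  there the derivative \<open>\<surd>\<kappa> - V'' * a\<close>. The latter is negative because \<open>u < 0\<close> means \<open>a > 1 / \<surd>\<kappa>\<close>, so
  \<open>u\<close> decreases to the right of its minimum, a contradiction.\<close>
lemma nataf1_derivative_bound:
  assumes der: "\<And>x. (nataf1 has_real_derivative a x) (at x)"
  shows "0 < a x" and "a x \<le> 1 / sqrt \<kappa>"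
proof -
  let ?\<phi> = "std_normal_density" and ?t = nataf1
  \<comment> \<open>differentiating \<open>cdf M (nataf1 x) = std_normal_cdf x\<close>\<close>
  have ch: "exp (- V (?t x)) * a x = ?\<phi> x" for x
  proof -
    have "((\<lambda>x. cdf M (?t x)) has_real_derivative exp (- V (?t x)) * a x) (at x)"
      by (rule DERIV_chain2[OF cdf_density_derivative[OF nataf1_in_support] der])
    then have "(std_normal_cdf has_real_derivative exp (- V (?t x)) * a x) (at x)"
      by (simp only: cdf_nataf1)
    then show ?thesis using std_normal_cdf_has_derivative DERIV_unique by blast
  qed
  show "0 < a x"
    using ch[of x] std_normal_density_gt_0[of x] by (metis exp_gt_zero zero_less_mult_pos)
  define u where "u x = exp (- V (?t x)) - sqrt \<kappa> * ?\<phi> x" for x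
  define r where "r x = sqrt \<kappa> * x - V' (?t x)" for x
  have d\<phi>: "(?\<phi> has_real_derivative - x * ?\<phi> x) (at x)" for x
    unfolding std_normal_density_def by (auto intro!: derivative_eq_intros simp: field_simps)
  have dVt: "((\<lambda>x. V (?t x)) has_real_derivative V' (?t x) * a x) (at x)" for x
    by (rule DERIV_chain2[OF V'[OF nataf1_in_support] der])
  have du: "(u has_real_derivative ?\<phi> x * r x) (at x)" for x
  proof -
    have "(u has_real_derivative exp (- V (?t x)) * (- (V' (?t x) * a x)) - sqrt \<kappa> * (- x * ?\<phi> x)) (at x)"
      unfolding u_def by (intro DERIV_diff DERIV_cmult d\<phi> DERIV_fun_exp DERIV_minus dVt)
    moreover have "exp (- V (?t x)) * (- (V' (?t x) * a x)) - sqrt \<kappa> * (- x * ?\<phi> x) = ?\<phi> x * r x"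
      unfolding ch[of x, symmetric] r_def by (simp add: algebra_simps)
    ultimately show ?thesis by simp
  qed
  have dr: "(r has_real_derivative sqrt \<kappa> - V'' (?t x) * a x) (at x)" for x
    unfolding r_def
    by (intro DERIV_diff DERIV_chain2[OF V''[OF nataf1_in_support] der] DERIV_cmult_Id)
  have "0 \<le> u x" for x
  proof (rule ccontr)
    assume "\<not> 0 \<le> u x"
    then have ux: "u x < 0" by simp
    have lim: "((\<lambda>y. sqrt \<kappa> * ?\<phi> y) \<longlongrightarrow> 0) at_infinity"
    proof -
      have b: "norm (sqrt \<kappa> * ?\<phi> y) \<le> sqrt \<kappa> * inverse \<bar>y\<bar>" if "y \<noteq> 0" for y
      proof -
        have "?\<phi> y \<le> exp (- y\<^sup>2 / 2)"
        proof -
          have "1 / sqrt (2 * pi) \<le> 1" using pi_gt3 by simp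
          then show ?thesis unfolding std_normal_density_def by (intro mult_left_le_one_le) auto
        qed
        also have "\<dots> \<le> inverse \<bar>y\<bar>"
        proof -
          have "\<bar>y\<bar> \<le> 1 + y\<^sup>2 / 2"
            using zero_le_power2[of "\<bar>y\<bar> - 1"] by (simp add: power2_diff)
          also have "\<dots> \<le> exp (y\<^sup>2 / 2)" by (rule exp_ge_add_one_self)
          finally have "inverse (exp (y\<^sup>2 / 2)) \<le> inverse \<bar>y\<bar>" using that by (intro le_imp_inverse_le) auto
          then show ?thesis by (simp add: exp_minus)
        qed
        finally show ?thesis using \<kappa>(1) std_normal_density_gt_0[of y] by (simp add: abs_mult)
      qed
      have "((\<lambda>y::real. sqrt \<kappa> * inverse \<bar>y\<bar>) \<longlongrightarrow> sqrt \<kappa> * 0) at_infinity"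
        using tendsto_inverse_0[where 'a = real] 
        by (intro tendsto_mult tendsto_const) (metis (no_types, lifting) abs_inverse ext tendsto_rabs_zero)
      then have l: "((\<lambda>y::real. sqrt \<kappa> * inverse \<bar>y\<bar>) \<longlongrightarrow> 0) at_infinity" by simp
      have e: "eventually (\<lambda>y. norm (sqrt \<kappa> * ?\<phi> y) \<le> sqrt \<kappa> * inverse \<bar>y\<bar>) at_infinity"
        unfolding eventually_at_infinity
      proof (intro exI[of _ 1] allI impI)
        fix y :: real assume "1 \<le> norm y"
        then show "norm (sqrt \<kappa> * ?\<phi> y) \<le> sqrt \<kappa> * inverse \<bar>y\<bar>" by (intro b) auto
      qed
      show ?thesis by (rule Lim_null_comparison[OF e l])
    qed
    then have "eventually (\<lambda>y. sqrt \<kappa> * ?\<phi> y < - u x) at_infinity"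
      using ux by (intro order_tendstoD) auto
    then obtain R where R: "\<And>y. R \<le> norm y \<Longrightarrow> sqrt \<kappa> * ?\<phi> y < - u x"
      unfolding eventually_at_infinity by blast
    have out: "u x < u y" if "R \<le> \<bar>y\<bar>" for y
    proof -
      have "sqrt \<kappa> * ?\<phi> y < - u x" using R[of y] that by simp
      moreover have "0 < exp (- V (?t y))" by simp
      ultimately show ?thesis unfolding u_def[of y] by linarith
    qed
    have xR: "\<bar>x\<bar> < R" using out[of x] by force
    have cu: "continuous_on {-R..R} u" using du by (meson DERIV_isCont continuous_at_imp_continuous_on)
    obtain x0 where x0: "x0 \<in> {-R..R}" "\<And>y. y \<in> {-R..R} \<Longrightarrow> u x0 \<le> u y"
      using continuous_attains_inf[OF compact_Icc _ cu] xR by force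
    have min: "u x0 \<le> u y" for y
    proof (cases "y \<in> {-R..R}")
      case False
      then have "u x < u y" by (intro out) auto
      moreover have "u x0 \<le> u x" using xR by (intro x0(2)) auto
      ultimately show ?thesis by simp
    qed (rule x0(2))
    have u0: "u x0 < 0" using min[of x] ux by simp
    have "?\<phi> x0 * r x0 = 0" by (rule DERIV_local_min[OF du zero_less_one]) (use min in auto)
    then have r0: "r x0 = 0" using std_normal_density_gt_0[of x0] by simp
    have "sqrt \<kappa> - V'' (?t x0) * a x0 < 0"
    proof -
      have a0: "a x0 > 0" using ch[of x0] std_normal_density_gt_0[of x0] by (metis exp_gt_zero zero_less_mult_pos)
      have "exp (- V (?t x0)) * a x0 < sqrt \<kappa> * ?\<phi> x0 * a x0"
        using u0 a0 unfolding u_def by simp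
      then have "?\<phi> x0 * 1 < ?\<phi> x0 * (sqrt \<kappa> * a x0)" unfolding ch by (simp add: mult_ac)
      then have "1 < sqrt \<kappa> * a x0" using std_normal_density_gt_0[of x0] by (simp add: mult_less_cancel_left_pos)
      then have "sqrt \<kappa> * 1 < sqrt \<kappa> * (sqrt \<kappa> * a x0)" using \<kappa>(1) by (intro mult_strict_left_mono) auto
      also have "\<dots> = \<kappa> * a x0" using \<kappa>(1) by (simp flip: mult.assoc)
      also have "\<dots> \<le> V'' (?t x0) * a x0" using \<kappa>(2)[OF nataf1_in_support] a0 by (intro mult_right_mono) auto
      finally show ?thesis by simp
    qed
    from DERIV_neg_dec_right[OF dr this]
    obtain d where d: "d > 0" "\<And>h. 0 < h \<Longrightarrow> h < d \<Longrightarrow> r (x0 + h) < 0" using r0 by auto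
    obtain z where z: "x0 < z" "z < x0 + d / 2" "u (x0 + d / 2) - u x0 = (x0 + d / 2 - x0) * (?\<phi> z * r z)"
      using MVT2[of x0 "x0 + d / 2" u "\<lambda>x. ?\<phi> x * r x"] du d(1) by auto
    have "r z < 0" using d(2)[of "z - x0"] z d(1) by simp
    then have "(x0 + d / 2 - x0) * (?\<phi> z * r z) < 0"
      using d(1) std_normal_density_gt_0[of z] by (simp add: mult_pos_neg)
    with z(3) min[of "x0 + d / 2"] show False by simp
  qed
  then have "sqrt \<kappa> * ?\<phi> x \<le> exp (- V (?t x))" by (simp add: u_def)
  then have "sqrt \<kappa> * ?\<phi> x * a x \<le> ?\<phi> x"
    using \<open>0 < a x\<close> ch[of x] by (metis less_imp_le mult_right_mono)
  then have "?\<phi> x * (sqrt \<kappa> * a x) \<le> ?\<phi> x * 1" by (simp add: mult_ac)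
  then have "sqrt \<kappa> * a x \<le> 1" using std_normal_density_gt_0[of x] by (simp add: mult_le_cancel_left_pos)
  then show "a x \<le> 1 / sqrt \<kappa>" using \<kappa>(1) by (simp add: field_simps)
qed

end

section \<open>The Nataf transformation transports the normal distribution\<close>

lemma borel_measurable_vec_nth[measurable (raw)]:
  fixes f :: "'a \<Rightarrow> real^'n"
  assumes "f \<in> borel_measurable M"
  shows "(\<lambda>x. f x $ i) \<in> borel_measurable M"
  by (rule measurable_compose[OF assms]) (intro borel_measurable_continuous_onI continuous_intros)

lemma atMost_vec_eq: "{..x :: real^'n} = {y. \<forall>i. y $ i \<le> x $ i}"
  by (auto simp: less_eq_vec_def)

text \<open>Lower orthants form a generator of the Borel sets that is stable under intersections.\<close>
lemma measure_eqI_joint_cdf: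
  fixes m g :: "(real^'n) measure"
  assumes "finite_measure m" "finite_measure g" and sets: "sets m = sets borel" "sets g = sets borel"
    and cdf: "\<And>s. joint_cdf m s = joint_cdf g s"
  shows "m = g"
proof -
  interpret m: finite_measure m by fact
  interpret g: finite_measure g by fact
  show ?thesis
  proof (rule measure_eqI_generator_eq[where E = "range atMost" and \<Omega> = UNIV and A = "\<lambda>k. {.. (\<chi> i. real k)}"])
    show "Int_stable (range (atMost :: real^'n \<Rightarrow> _))"
    proof (rule Int_stableI_image)
      fix a b :: "real^'n"
      have "{..a} \<inter> {..b} = {.. (\<chi> i. min (a $ i) (b $ i))}" by (auto simp: less_eq_vec_def)
      then show "\<exists>c\<in>UNIV. {..a} \<inter> {..b} = {..c}" by blast
    qed
    show "sets m = sigma_sets UNIV (range atMost)" "sets g = sigma_sets UNIV (range atMost)"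
      by (simp_all add: sets borel_eq_atMost)
    show "(\<Union>k. {.. (\<chi> i. real k)}) = (UNIV :: (real^'n) set)"
    proof safe
      fix x :: "real^'n"
      obtain k where k: "norm x \<le> real k" using real_arch_simple by blast
      have "x $ i \<le> real k" for i using component_le_norm_cart[of x i] k by linarith
      then have "x \<in> {.. (\<chi> i. real k)}" by (auto simp: less_eq_vec_def)
      then show "x \<in> (\<Union>k. {.. (\<chi> i. real k)})" by blast
    qed auto
    fix X assume "X \<in> range (atMost :: real^'n \<Rightarrow> _)"
    then obtain x :: "real^'n" where "X = {..x}" by blast
    then show "emeasure m X = emeasure g X"
      using cdf[of x] by (simp add: joint_cdf_def atMost_vec_eq m.emeasure_eq_measure g.emeasure_eq_measure)
  qed (auto simp: m.emeasure_eq_measure)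
qed

text \<open>An order embedding \<open>T\<close> pulls lower orthants with corner \<open>T s\<close> back to those with corner \<open>s\<close>.
  Hence the image of \<open>m\<close> under the inverse of \<open>T\<close> has the distribution function of \<open>g\<close>.\<close>
lemma measure_eq_distr_of_joint_cdf:
  fixes m g :: "(real^'n) measure"
  assumes m: "prob_space m" "sets m = sets borel" and g: "prob_space g" "sets g = sets borel"
    and T: "homeomorphism UNIV \<Omega> T S" and \<Omega>: "open \<Omega>" "emeasure m \<Omega> = 1"
    and mono: "\<And>x s. (\<forall>i. T x $ i \<le> T s $ i) \<longleftrightarrow> (\<forall>i. x $ i \<le> s $ i)"
    and cdf: "\<And>s. joint_cdf m (T s) = joint_cdf g s"
  shows "m = distr g borel T"
proof -
  interpret m: prob_space m by fact
  interpret g: prob_space g by fact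
  have [measurable_cong]: "sets m = sets borel" "sets g = sets borel" by fact+
  have AE: "AE y in m. y \<in> \<Omega>"
    by (rule m.AE_prob_1) (simp add: measure_def \<Omega>(2))
  have TS: "T (S y) = y" if "y \<in> \<Omega>" for y using T that by (simp add: homeomorphism_def)
  have Tm[measurable]: "T \<in> borel_measurable borel"
    using T by (intro borel_measurable_continuous_onI) (simp add: homeomorphism_def)
  \<comment> \<open>an extension of the inverse to a measurable function on the whole space\<close>
  define S0 where "S0 y = (if y \<in> \<Omega> then S y else 0)" for y
  have S0m[measurable]: "S0 \<in> borel_measurable borel"
    unfolding S0_def using T \<Omega>(1)
    by (intro borel_measurable_continuous_on_if) (auto simp: homeomorphism_def)
  have "distr m borel S0 = g"
  proof (rule measure_eqI_joint_cdf)
    show "finite_measure (distr m borel S0)" "finite_measure g"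
      by (auto intro!: m.finite_measure_distr g.finite_measure_axioms)
    fix s
    have ss: "{..s} \<in> sets borel" "{..T s} \<in> sets borel" by auto
    have "joint_cdf (distr m borel S0) s = measure m (S0 -` {..s} \<inter> space m)"
      unfolding joint_cdf_def atMost_vec_eq[symmetric] by (rule measure_distr) (auto intro: ss)
    also have "\<dots> = measure m {..T s}"
    proof (rule m.finite_measure_eq_AE)
      show "AE y in m. (y \<in> S0 -` {..s} \<inter> space m) = (y \<in> {..T s})"
        using AE
      proof eventually_elim
        fix y assume y: "y \<in> \<Omega>"
        have "S y \<le> s \<longleftrightarrow> T (S y) \<le> T s" using mono[of "S y" s] by (simp add: less_eq_vec_def)
        then show "(y \<in> S0 -` {..s} \<inter> space m) = (y \<in> {..T s})"
          using y by (simp add: S0_def TS sets_eq_imp_space_eq[OF m(2)])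
      qed
      show "S0 -` {..s} \<inter> space m \<in> sets m"
        using measurable_sets[OF S0m ss(1)] by (simp add: sets_eq_imp_space_eq[OF m(2)] m(2))
    qed (simp add: m(2))
    also have "\<dots> = joint_cdf g s" using cdf[of s] by (simp add: joint_cdf_def atMost_vec_eq)
    finally show "joint_cdf (distr m borel S0) s = joint_cdf g s" .
  qed (simp_all add: g)
  then have "distr g borel T = distr (distr m borel S0) borel T" by simp
  also have "\<dots> = distr m borel (T \<circ> S0)" by (rule distr_distr) auto
  also have "\<dots> = distr m borel (\<lambda>y. y)"
    by (rule distr_cong_AE) (use AE in \<open>auto simp: m S0_def TS elim!: eventually_mono\<close>)
  also have "\<dots> = m" by (rule distr_id2) (simp add: m(2))
  finally show ?thesis ..
qed

definition prod_density :: "('n::finite \<Rightarrow> real \<Rightarrow> real) \<Rightarrow> (real^'n) measure" where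
  "prod_density r = density lborel (\<lambda>y. \<Prod>i\<in>UNIV. ennreal (r i (y $ i)))"

lemma emeasure_prod_density_box:
  fixes r :: "'n::finite \<Rightarrow> real \<Rightarrow> real"
  assumes [measurable]: "\<And>i. r i \<in> borel_measurable borel" "\<And>i. B i \<in> sets borel"
  shows "emeasure (prod_density r) {y. \<forall>i. y $ i \<in> B i} = (\<Prod>i\<in>UNIV. emeasure (density lborel (\<lambda>x. ennreal (r i x))) (B i))"
proof -
  have s: "{y :: real^'n. \<forall>i. y $ i \<in> B i} \<in> sets borel"
  proof -
    have "(\<lambda>x::real^'n. x $ i) -` B i \<inter> space borel \<in> sets borel" for i
      by (rule measurable_sets) (auto intro!: borel_measurable_continuous_onI continuous_intros)
    then have "(\<Inter>i\<in>UNIV. (\<lambda>x::real^'n. x $ i) -` B i) \<in> sets borel" by (intro sets.finite_INT) auto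
    also have "(\<Inter>i\<in>UNIV. (\<lambda>x::real^'n. x $ i) -` B i) = {y. \<forall>i. y $ i \<in> B i}" by auto
    finally show ?thesis .
  qed
  have ind: "indicator {y :: real^'n. \<forall>i. y $ i \<in> B i} y = (\<Prod>i\<in>UNIV. indicator (B i) (y $ i) :: ennreal)" for y
    by (auto simp: indicator_def)
  have "emeasure (prod_density r) {y. \<forall>i. y $ i \<in> B i}
     = (\<integral>\<^sup>+y. (\<Prod>i\<in>UNIV. ennreal (r i (y $ i)) * indicator (B i) (y $ i)) \<partial>lborel)"
    unfolding prod_density_def prod.distrib ind[symmetric]
    by (rule emeasure_density) (use s in auto)
  also have "\<dots> = (\<Prod>i\<in>UNIV. (\<integral>\<^sup>+x. ennreal (r i x) * indicator (B i) x \<partial>lborel))"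
    by (rule nn_integral_lborel_prod_vec) auto
  also have "\<dots> = (\<Prod>i\<in>UNIV. emeasure (density lborel (\<lambda>x. ennreal (r i x))) (B i))"
    by (intro prod.cong refl emeasure_density[symmetric]) auto
  finally show ?thesis .
qed

lemma std_gaussian_eq_prod_density: "std_gaussian = prod_density (\<lambda>_. std_normal_density)"
  unfolding std_gaussian_def prod_density_def std_gaussian_density_prod ..

lemma
  fixes r :: "'n::finite \<Rightarrow> real \<Rightarrow> real"
  assumes r[measurable]: "\<And>i. r i \<in> borel_measurable borel"
    and p: "\<And>i. prob_space (density lborel (\<lambda>x. ennreal (r i x)))"
  shows prob_space_prod_density: "prob_space (prod_density r)"
    and joint_cdf_prod_density: "joint_cdf (prod_density r) s = (\<Prod>i\<in>UNIV. cdf (density lborel (\<lambda>x. ennreal (r i x))) (s $ i))"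
proof -
  have one: "emeasure (density lborel (\<lambda>x. ennreal (r i x))) UNIV = 1" for i
    using prob_space.emeasure_space_1[OF p[of i]] by simp
  have "emeasure (prod_density r) {y. \<forall>i. y $ i \<in> UNIV} = 1"
    by (subst emeasure_prod_density_box) (auto simp: one)
  then show pr: "prob_space (prod_density r)" by (intro prob_spaceI) (simp add: prod_density_def)
  have "emeasure (prod_density r) {y. \<forall>i. y $ i \<in> {..s $ i}}
    = (\<Prod>i\<in>UNIV. ennreal (cdf (density lborel (\<lambda>x. ennreal (r i x))) (s $ i)))"
    unfolding cdf_def2
    by (subst emeasure_prod_density_box)
       (auto intro!: prod.cong finite_measure.emeasure_eq_measure prob_space.finite_measure p)
  then show "joint_cdf (prod_density r) s = (\<Prod>i\<in>UNIV. cdf (density lborel (\<lambda>x. ennreal (r i x))) (s $ i))"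
    by (simp add: joint_cdf_def measure_def prod_ennreal cdf_def2 prod_nonneg)
qed

text \<open>On a compact set the quotient of two positive continuous densities is bounded.\<close>
lemma nn_integral_density_compare_compact:
  fixes w w' :: "'a::euclidean_space \<Rightarrow> real"
  assumes K: "compact K" and w: "continuous_on K w" "\<And>x. x \<in> K \<Longrightarrow> 0 < w x"
    and w': "continuous_on K w'" "\<And>x. x \<in> K \<Longrightarrow> 0 < w' x"
    and [measurable]: "w \<in> borel_measurable borel" "w' \<in> borel_measurable borel"
  obtains c :: real where "0 < c"
    "\<And>u. u \<in> borel_measurable borel \<Longrightarrow> (\<And>x. x \<notin> K \<Longrightarrow> u x = 0) \<Longrightarrow>
       (\<integral>\<^sup>+x. u x \<partial>density lborel (\<lambda>x. ennreal (w x))) \<le> ennreal c * (\<integral>\<^sup>+x. u x \<partial>density lborel (\<lambda>x. ennreal (w' x)))"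
proof -
  have "w' x \<noteq> 0" if "x \<in> K" for x using w'(2)[OF that] by simp
  then have "compact ((\<lambda>x. w x / w' x) ` K)"
    by (intro compact_continuous_image K continuous_on_divide w w') blast
  then obtain b where b0: "\<forall>y \<in> (\<lambda>x. w x / w' x) ` K. norm y \<le> b"
    by (auto simp: bounded_iff dest!: compact_imp_bounded)
  then have b: "w x \<le> max 1 b * w' x" if "x \<in> K" for x
  proof -
    have "norm (w x / w' x) \<le> b" using b0 that by blast
    then have "w x / w' x \<le> b" unfolding real_norm_def by (rule abs_le_D1)
    then have "w x / w' x \<le> max 1 b" by (rule max.coboundedI2)
    then show ?thesis using w'(2)[OF that] by (simp add: divide_le_eq)
  qed
  show thesis
  proof (rule that[of "max 1 b"])
    fix u :: "'a \<Rightarrow> ennreal" assume u[measurable]: "u \<in> borel_measurable borel" and z: "\<And>x. x \<notin> K \<Longrightarrow> u x = 0"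
    have "(\<integral>\<^sup>+x. u x \<partial>density lborel (\<lambda>x. ennreal (w x))) = (\<integral>\<^sup>+x. ennreal (w x) * u x \<partial>lborel)"
      by (rule nn_integral_density) auto
    also have "\<dots> \<le> (\<integral>\<^sup>+x. ennreal (max 1 b) * (ennreal (w' x) * u x) \<partial>lborel)"
    proof (rule nn_integral_mono)
      fix x
      show "ennreal (w x) * u x \<le> ennreal (max 1 b) * (ennreal (w' x) * u x)"
      proof (cases "x \<in> K")
        case True
        have "ennreal (w x) \<le> ennreal (max 1 b) * ennreal (w' x)"
          using b[OF True] w'(2)[OF True] by (simp add: ennreal_mult[symmetric])
        then show ?thesis by (simp add: mult_right_mono flip: mult.assoc)
      qed (simp add: z)
    qed
    also have "\<dots> = ennreal (max 1 b) * (\<integral>\<^sup>+x. u x \<partial>density lborel (\<lambda>x. ennreal (w' x)))"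
      by (subst nn_integral_cmult) (auto simp: nn_integral_density)
    finally show "(\<integral>\<^sup>+x. u x \<partial>density lborel (\<lambda>x. ennreal (w x))) \<le> ennreal (max 1 b) * (\<integral>\<^sup>+x. u x \<partial>density lborel (\<lambda>x. ennreal (w' x)))" .
  qed simp
qed

text \<open>Here \<open>\<nu>\<close> is the normal distribution that shares its copula with \<open>\<mu>\<close>, and \<open>T\<close> turns out to transport
  \<open>\<nu>\<close> to \<open>\<mu>\<close>.\<close>
locale nataf_model =
  fixes \<Omega> :: "(real^'n) set" and \<mu> :: "(real^'n) measure" and \<rho> :: "real^'n \<Rightarrow> real"
    and \<Sigma> :: "real^'n^'n" and C :: "real^'n \<Rightarrow> real" and \<kappa> :: "'n \<Rightarrow> real"
  assumes open_domain: "open \<Omega>"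
    and prob: "prob_space \<mu>"
    and density_measurable: "\<rho> \<in> borel_measurable borel"
    and density: "\<mu> = density lborel (\<lambda>x. ennreal (\<rho> x))"
    and density_pos: "\<And>x. x \<in> \<Omega> \<Longrightarrow> 0 < \<rho> x" and density_0: "\<And>x. x \<notin> \<Omega> \<Longrightarrow> \<rho> x = 0"
    and spd: "symmetric_positive_definite \<Sigma>" and diag: "\<And>i. \<Sigma> $ i $ i = 1"
    and copula_normal: "gaussian_copula \<Sigma> C" and copula: "copula_of \<mu> C"
    and diffeo: "diffeomorphism UNIV \<Omega> (nataf \<mu>)"
    and log_concave: "\<And>i. uniformly_log_concave (marginal \<mu> i) (\<kappa> i)"
begin

abbreviation "\<nu> \<equiv> centered_normal \<Sigma>"
abbreviation "T \<equiv> nataf \<mu>"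
abbreviation "t i s \<equiv> quantile (marginal \<mu> i) (std_normal_cdf s)"

lemma sets_mu[simp, measurable_cong]: "sets \<mu> = sets borel" by (simp add: density)
lemma space_mu[simp]: "space \<mu> = UNIV" by (simp add: density)

lemma T_component: "T x $ i = t i (x $ i)" by (simp add: nataf_def)

lemma prob_marginal: "prob_space (marginal \<mu> i)"
  unfolding marginal_def by (rule prob_space.prob_space_distr[OF prob]) simp

lemma kappa_pos: "0 < \<kappa> i" using log_concave[of i] by (simp add: uniformly_log_concave_def)

lemma marginal_data:
  obtains J :: "'n \<Rightarrow> real set" and r :: "'n \<Rightarrow> real \<Rightarrow> real" where
    "\<And>i. open (J i)" "\<And>i. continuous_on (J i) (r i)" "\<And>i x. x \<in> J i \<Longrightarrow> 0 < r i x" "\<And>i x. x \<notin> J i \<Longrightarrow> r i x = 0"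
    "\<And>i. r i \<in> borel_measurable borel" "\<And>i. marginal \<mu> i = density lborel (\<lambda>x. ennreal (r i x))"
    "\<And>i s. t i s \<in> J i" "\<And>i s. cdf (marginal \<mu> i) (t i s) = std_normal_cdf s" "\<And>i. strict_mono (t i)"
    "\<And>i y. y \<in> J i \<Longrightarrow> \<exists>s. t i s = y"
proof -
  have "\<forall>i. \<exists>J r. open J \<and> continuous_on J r \<and> (\<forall>x\<in>J. 0 < r x) \<and> (\<forall>x. x \<notin> J \<longrightarrow> r x = (0::real)) \<and>
    r \<in> borel_measurable borel \<and> marginal \<mu> i = density lborel (\<lambda>x. ennreal (r x)) \<and>
    (\<forall>s. t i s \<in> J \<and> cdf (marginal \<mu> i) (t i s) = std_normal_cdf s) \<and> strict_mono (t i) \<and> (\<forall>y\<in>J. \<exists>s. t i s = y)"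
  proof
    fix i
    obtain J V V' V'' where *: "open J" "is_interval J"
       "marginal \<mu> i = density lborel (\<lambda>x. ennreal (indicator J x * exp (- V x)))"
       "\<And>x. x \<in> J \<Longrightarrow> (V has_real_derivative V' x) (at x)"
       "\<And>x. x \<in> J \<Longrightarrow> (V' has_real_derivative V'' x) (at x)" "0 < \<kappa> i" "\<And>x. x \<in> J \<Longrightarrow> \<kappa> i \<le> V'' x"
      using log_concave[of i] unfolding uniformly_log_concave_def by blast
    note A = prob_marginal *
    have "\<exists>s. t i s = y" if "y \<in> J" for y
      by (rule nataf1_surj[OF A that]) (assumption | rule exI)+
    then show "\<exists>J r. open J \<and> continuous_on J r \<and> (\<forall>x\<in>J. 0 < r x) \<and> (\<forall>x. x \<notin> J \<longrightarrow> r x = (0::real)) \<and>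
      r \<in> borel_measurable borel \<and> marginal \<mu> i = density lborel (\<lambda>x. ennreal (r x)) \<and>
      (\<forall>s. t i s \<in> J \<and> cdf (marginal \<mu> i) (t i s) = std_normal_cdf s) \<and> strict_mono (t i) \<and> (\<forall>y\<in>J. \<exists>s. t i s = y)"
      using continuous_on_density[OF A] borel_measurable_density[OF A] nataf1_in_support[OF A] cdf_nataf1[OF A]
        nataf1_strict_mono[OF A] *(1,3)
      by (intro exI[of _ J] exI[of _ "\<lambda>x. indicator J x * exp (- V x)"]) auto
  qed
  then obtain J r where "\<And>i. open (J i) \<and> continuous_on (J i) (r i) \<and> (\<forall>x\<in>J i. 0 < r i x) \<and> (\<forall>x. x \<notin> J i \<longrightarrow> r i x = (0::real)) \<and>
    r i \<in> borel_measurable borel \<and> marginal \<mu> i = density lborel (\<lambda>x. ennreal (r i x)) \<and>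
    (\<forall>s. t i s \<in> J i \<and> cdf (marginal \<mu> i) (t i s) = std_normal_cdf s) \<and> strict_mono (t i) \<and> (\<forall>y\<in>J i. \<exists>s. t i s = y)"
    by metis
  then show thesis by (intro that[of J r]) blast+
qed

lemma cdf_t: "cdf (marginal \<mu> i) (t i s) = std_normal_cdf s"
  by (rule marginal_data) blast

lemma t_strict_mono: "strict_mono (t i)"
  by (rule marginal_data) blast

lemma T_le_iff: "(\<forall>i. T x $ i \<le> T s $ i) \<longleftrightarrow> (\<forall>i. x $ i \<le> s $ i)"
  by (simp add: T_component strict_mono_less_eq[OF t_strict_mono])

lemma T_homeomorphism: obtains S where "homeomorphism UNIV \<Omega> T S"
  using diffeo unfolding diffeomorphism_def by blast

lemma T_measurable[measurable]: "T \<in> borel_measurable borel"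
proof -
  obtain S where "homeomorphism UNIV \<Omega> T S" by (rule T_homeomorphism)
  then show ?thesis by (intro borel_measurable_continuous_onI) (simp add: homeomorphism_def)
qed

lemma T_in: "T x \<in> \<Omega>"
proof -
  obtain S where "homeomorphism UNIV \<Omega> T S" by (rule T_homeomorphism)
  then show ?thesis by (auto simp: homeomorphism_def)
qed

text \<open>Both measures have the same distribution functions after the change of variables by \<open>T\<close>,
  as the equality of copulas says.\<close>
lemma mu_eq_distr: "\<mu> = distr \<nu> borel T"
proof -
  obtain S where S: "homeomorphism UNIV \<Omega> T S" by (rule T_homeomorphism)
  show ?thesis
  proof (rule measure_eq_distr_of_joint_cdf[OF prob _ prob_space_centered_normal[OF spd] _ S open_domain _ T_le_iff])
    have "emeasure \<mu> (- \<Omega>) = 0"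
    proof -
      have "emeasure \<mu> (- \<Omega>) = (\<integral>\<^sup>+x. ennreal (\<rho> x) * indicator (- \<Omega>) x \<partial>lborel)"
        unfolding density by (rule emeasure_density) (use density_measurable open_domain in auto)
      also have "\<dots> = (\<integral>\<^sup>+x. 0 \<partial>(lborel :: (real^'n) measure))"
        by (rule nn_integral_cong) (auto simp: density_0 indicator_def)
      finally show ?thesis by simp
    qed
    then have "AE x in \<mu>. x \<in> \<Omega>"
      using open_domain by (intro AE_I[of _ _ "- \<Omega>"]) auto
    then show "emeasure \<mu> \<Omega> = 1"
      using open_domain by (intro prob_space.emeasure_eq_1_AE[OF prob]) auto
    fix s
    have "joint_cdf \<mu> (T s) = C (\<chi> i. cdf (marginal \<mu> i) (T s $ i))"
      using copula unfolding copula_of_def by blast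
    also have "\<dots> = C (\<chi> i. cdf (marginal \<nu> i) (s $ i))"
      by (simp add: T_component cdf_t marginal_centered_normal[OF spd diag] std_normal_cdf_def[symmetric])
    also have "\<dots> = joint_cdf \<nu> s" using copula_normal unfolding copula_of_def by simp
    finally show "joint_cdf \<mu> (T s) = joint_cdf \<nu> s" .
  qed simp_all
qed

text \<open>Restricting \<open>T\<close> to the coordinate axes shows that its coordinate functions are differentiable, as
  the one-dimensional comparison requires.\<close>
lemma T_coordinate_derivatives:
  obtains a :: "'n \<Rightarrow> real \<Rightarrow> real" where
    "\<And>i s. (t i has_real_derivative a i s) (at s)" "\<And>i s. 0 < a i s" "\<And>i s. a i s \<le> 1 / sqrt (\<kappa> i)"
    "\<And>i. a i \<in> borel_measurable borel"
proof -
  obtain T' where T': "\<And>x. (T has_derivative blinfun_apply (T' x)) (at x)" "continuous_on UNIV T'"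
    using diffeo unfolding diffeomorphism_def C1_on_def by auto
  define a where "a i s = blinfun_apply (T' (s *\<^sub>R axis i 1)) (axis i 1) $ i" for i s
  have d: "(t i has_real_derivative a i s) (at s)" for i s
  proof -
    have "((\<lambda>s. s *\<^sub>R axis i 1 :: real^'n) has_derivative (\<lambda>h. h *\<^sub>R axis i 1)) (at s)"
      by (auto intro!: derivative_eq_intros)
    from has_derivative_compose[OF this T'(1)]
    have "((\<lambda>s. T (s *\<^sub>R axis i 1) $ i) has_derivative (\<lambda>h. blinfun_apply (T' (s *\<^sub>R axis i 1)) (h *\<^sub>R axis i 1) $ i)) (at s)"
      by (rule bounded_linear.has_derivative[OF bounded_linear_vec_nth])
    then show ?thesis
      by (simp add: T_component has_field_derivative_def a_def blinfun.scaleR_right mult_commute_abs)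
  qed
  have m: "a i \<in> borel_measurable borel" for i
    unfolding a_def
    by (intro borel_measurable_continuous_onI continuous_intros continuous_on_compose2[OF T'(2)]) auto
  have "0 < a i s \<and> a i s \<le> 1 / sqrt (\<kappa> i)" for i s
  proof -
    obtain J V V' V'' where *: "open J" "is_interval J"
       "marginal \<mu> i = density lborel (\<lambda>x. ennreal (indicator J x * exp (- V x)))"
       "\<And>x. x \<in> J \<Longrightarrow> (V has_real_derivative V' x) (at x)"
       "\<And>x. x \<in> J \<Longrightarrow> (V' has_real_derivative V'' x) (at x)" "0 < \<kappa> i" "\<And>x. x \<in> J \<Longrightarrow> \<kappa> i \<le> V'' x"
      using log_concave[of i] unfolding uniformly_log_concave_def by blast
    show ?thesis
      using nataf1_derivative_bound[OF prob_marginal * d] by blast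
  qed
  with d m that show thesis by blast
qed

text \<open>The density \<open>\<rho>\<close> is merely measurable, so it has no evident bounds on compact sets. But \<open>T\<close> carries
  the standard Gaussian to the product of the marginals, whose density is continuous. On compact
  sets this product is therefore comparable with Lebesgue measure, and, through \<open>T\<close>, with \<open>\<mu>\<close>, since the
  two Gaussian densities are comparable.\<close>
lemma compare_lborel_mu:
  assumes K: "compact K" "K \<subseteq> \<Omega>"
  obtains c :: real where "0 < c"
    "\<And>u. u \<in> borel_measurable borel \<Longrightarrow> (\<And>x. x \<notin> K \<Longrightarrow> u x = 0) \<Longrightarrow> (\<integral>\<^sup>+x. u x \<partial>lborel) \<le> ennreal c * (\<integral>\<^sup>+x. u x \<partial>\<mu>)"
    "\<And>u. u \<in> borel_measurable borel \<Longrightarrow> (\<And>x. x \<notin> K \<Longrightarrow> u x = 0) \<Longrightarrow> (\<integral>\<^sup>+x. u x \<partial>\<mu>) \<le> ennreal c * (\<integral>\<^sup>+x. u x \<partial>lborel)"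
proof -
  obtain S where S: "homeomorphism UNIV \<Omega> T S" by (rule T_homeomorphism)
  obtain J r where J: "\<And>i. open (J i)" "\<And>i. continuous_on (J i) (r i)" "\<And>i x. x \<in> J i \<Longrightarrow> 0 < r i x"
     "\<And>i x. x \<notin> J i \<Longrightarrow> r i x = (0::real)"
     and r[measurable]: "\<And>i. r i \<in> borel_measurable borel" and marg: "\<And>i. marginal \<mu> i = density lborel (\<lambda>x. ennreal (r i x))"
     and tJ: "\<And>i s. t i s \<in> J i" and surj: "\<And>i y. y \<in> J i \<Longrightarrow> \<exists>s. t i s = y"
    by (rule marginal_data) blast
  have r0: "0 \<le> r i x" for i x using J(3,4)[of x i] by (cases "x \<in> J i") auto
  have rJ: "x \<in> J i" if "0 < r i x" for i x using J(4)[of x i] that by (cases "x \<in> J i") auto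
  have Om: "\<Omega> = {y. \<forall>i. y $ i \<in> J i}"
  proof (intro equalityI subsetI)
    fix y assume "y \<in> \<Omega>"
    then have "y = T (S y)" using S by (simp add: homeomorphism_def)
    then have "y $ i = t i (S y $ i)" for i by (metis T_component)
    then show "y \<in> {y. \<forall>i. y $ i \<in> J i}" using tJ by simp
  next
    fix y assume "y \<in> {y. \<forall>i. y $ i \<in> J i}"
    then have "\<forall>i. \<exists>s. t i s = y $ i" using surj by blast
    then obtain s where s: "\<And>i. t i (s i) = y $ i" by (rule choice[THEN exE]) blast
    have "T (\<chi> i. s i) = y" by (simp add: vec_eq_iff T_component s)
    then show "y \<in> \<Omega>" using T_in by metis
  qed
  let ?Q = "prod_density r"
  have pm: "prob_space (density lborel (\<lambda>x. ennreal (r i x)))" for i using prob_marginal[of i] by (simp add: marg)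
  have Q: "?Q = distr std_gaussian borel T"
  proof (rule measure_eq_distr_of_joint_cdf[OF prob_space_prod_density[OF r pm] _ prob_space_std_gaussian _ S open_domain _ T_le_iff])
    have "emeasure (density lborel (\<lambda>x. ennreal (r i x))) (J i) = 1" for i
    proof -
      have "AE x in density lborel (\<lambda>x. ennreal (r i x)). x \<in> J i"
        using rJ by (subst AE_density) (auto intro!: AE_I2)
      then show ?thesis using J(1)[of i] by (intro prob_space.emeasure_eq_1_AE[OF pm]) auto
    qed
    then show "emeasure ?Q \<Omega> = 1"
      unfolding Om using J(1) by (subst emeasure_prod_density_box) auto
    fix s
    have "joint_cdf ?Q (T s) = (\<Prod>i\<in>UNIV. std_normal_cdf (s $ i))"
      unfolding joint_cdf_prod_density[OF r pm] by (simp add: marg[symmetric] T_component cdf_t)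
    also have "\<dots> = joint_cdf std_gaussian s"
      unfolding std_gaussian_eq_prod_density
      by (subst joint_cdf_prod_density) (auto simp: std_normal_cdf_def intro: prob_space_normal_density)
    finally show "joint_cdf ?Q (T s) = joint_cdf std_gaussian s" .
  qed (simp_all add: prod_density_def)
  let ?R = "\<lambda>y. \<Prod>i\<in>UNIV. r i (y $ i)"
  have Q2: "?Q = density lborel (\<lambda>y. ennreal (?R y))" by (simp add: prod_density_def prod_ennreal r0)
  have Rc: "continuous_on K ?R"
  proof (intro continuous_intros)
    fix i show "continuous_on K (\<lambda>y. r i (y $ i))"
      by (rule continuous_on_compose2[OF J(2)]) (use K Om in \<open>auto intro!: continuous_intros\<close>)
  qed
  have Rpos: "0 < ?R y" if "y \<in> K" for y using that K Om by (auto intro!: prod_pos J(3))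
  have [measurable]: "?R \<in> borel_measurable borel" by measurable
  define L where "L = S ` K"
  have L: "compact L" unfolding L_def
    using S K by (intro compact_continuous_image) (auto simp: homeomorphism_def intro: continuous_on_subset)
  have KT: "T x \<in> K \<longleftrightarrow> x \<in> L" for x
    unfolding L_def using S K by (auto simp: homeomorphism_def image_iff) (metis subsetD)
  let ?g = "\<lambda>x::real^'n. exp (- (x \<bullet> x) / 2) / sqrt ((2 * pi) ^ CARD('n))"
  have gc: "continuous_on A ?g" for A by (intro continuous_intros) auto
  have gm: "?g \<in> borel_measurable borel" by (rule borel_measurable_continuous_onI[OF gc])
  have gp: "0 < ?g x" for x by simp
  have nc: "continuous_on A (normal_dens \<Sigma>)" for A by (rule continuous_on_subset[OF continuous_normal_dens]) auto
  obtain c1 where c1: "0 < c1" "\<And>u. u \<in> borel_measurable borel \<Longrightarrow> (\<And>x. x \<notin> L \<Longrightarrow> u x = 0) \<Longrightarrow>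
       (\<integral>\<^sup>+x. u x \<partial>\<nu>) \<le> ennreal c1 * (\<integral>\<^sup>+x. u x \<partial>std_gaussian)"
    unfolding centered_normal_eq std_gaussian_def
    by (rule nn_integral_density_compare_compact[OF L nc normal_dens_pos[OF spd] gc gp borel_measurable_normal_dens gm]) blast
  obtain c2 where c2: "0 < c2" "\<And>u. u \<in> borel_measurable borel \<Longrightarrow> (\<And>x. x \<notin> L \<Longrightarrow> u x = 0) \<Longrightarrow>
       (\<integral>\<^sup>+x. u x \<partial>std_gaussian) \<le> ennreal c2 * (\<integral>\<^sup>+x. u x \<partial>\<nu>)"
    unfolding centered_normal_eq std_gaussian_def
    by (rule nn_integral_density_compare_compact[OF L gc gp nc normal_dens_pos[OF spd] gm borel_measurable_normal_dens]) blast
  obtain c3 where c3: "0 < c3" "\<And>u. u \<in> borel_measurable borel \<Longrightarrow> (\<And>x. x \<notin> K \<Longrightarrow> u x = 0) \<Longrightarrow>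
       (\<integral>\<^sup>+x. u x \<partial>?Q) \<le> ennreal c3 * (\<integral>\<^sup>+x. u x \<partial>lborel)"
    unfolding Q2
    by (rule nn_integral_density_compare_compact[OF K(1) Rc Rpos, of "\<lambda>_. 1"]) (auto simp: density_1)
  obtain c4 where c4: "0 < c4" "\<And>u. u \<in> borel_measurable borel \<Longrightarrow> (\<And>x. x \<notin> K \<Longrightarrow> u x = 0) \<Longrightarrow>
       (\<integral>\<^sup>+x. u x \<partial>lborel) \<le> ennreal c4 * (\<integral>\<^sup>+x. u x \<partial>?Q)"
    unfolding Q2
    by (rule nn_integral_density_compare_compact[OF K(1) _ _ Rc Rpos, of "\<lambda>_. 1"]) (auto simp: density_1)
  have mu_int: "(\<integral>\<^sup>+x. u x \<partial>\<mu>) = (\<integral>\<^sup>+x. u (T x) \<partial>\<nu>)" if "u \<in> borel_measurable borel" for u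
    by (subst mu_eq_distr, rule nn_integral_distr) (use that in auto)
  have Q_int: "(\<integral>\<^sup>+x. u x \<partial>?Q) = (\<integral>\<^sup>+x. u (T x) \<partial>std_gaussian)" if "u \<in> borel_measurable borel" for u
    by (subst Q, rule nn_integral_distr) (use that in auto)
  show thesis
  proof (rule that[of "max (c4 * c2) (c1 * c3)"])
    fix u :: "real^'n \<Rightarrow> ennreal" assume u[measurable]: "u \<in> borel_measurable borel" and z: "\<And>x. x \<notin> K \<Longrightarrow> u x = 0"
    have zT: "u (T x) = 0" if "x \<notin> L" for x using z KT that by blast
    have um: "(\<lambda>x. u (T x)) \<in> borel_measurable borel" by measurable
    have "(\<integral>\<^sup>+x. u x \<partial>lborel) \<le> ennreal c4 * (ennreal c2 * (\<integral>\<^sup>+x. u x \<partial>\<mu>))"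
      unfolding mu_int[OF u]
      using c4(2)[OF u z] mult_left_mono[OF c2(2)[OF um zT], of "ennreal c4"] unfolding Q_int[OF u] by (auto intro: order_trans)
    also have "\<dots> = ennreal (c4 * c2) * (\<integral>\<^sup>+x. u x \<partial>\<mu>)"
      using c4(1) c2(1) by (simp add: ennreal_mult mult.assoc)
    also have "\<dots> \<le> ennreal (max (c4 * c2) (c1 * c3)) * (\<integral>\<^sup>+x. u x \<partial>\<mu>)"
      by (intro mult_right_mono ennreal_leI) auto
    finally show "(\<integral>\<^sup>+x. u x \<partial>lborel) \<le> ennreal (max (c4 * c2) (c1 * c3)) * (\<integral>\<^sup>+x. u x \<partial>\<mu>)" .
    have "(\<integral>\<^sup>+x. u x \<partial>\<mu>) \<le> ennreal c1 * (ennreal c3 * (\<integral>\<^sup>+x. u x \<partial>lborel))"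
      unfolding mu_int[OF u]
      using c1(2)[OF um zT] mult_left_mono[OF c3(2)[OF u z], of "ennreal c1"] unfolding Q_int[OF u] by (auto intro: order_trans)
    also have "\<dots> = ennreal (c1 * c3) * (\<integral>\<^sup>+x. u x \<partial>lborel)"
      using c1(1) c3(1) by (simp add: ennreal_mult mult.assoc)
    also have "\<dots> \<le> ennreal (max (c4 * c2) (c1 * c3)) * (\<integral>\<^sup>+x. u x \<partial>lborel)"
      by (intro mult_right_mono ennreal_leI) auto
    finally show "(\<integral>\<^sup>+x. u x \<partial>\<mu>) \<le> ennreal (max (c4 * c2) (c1 * c3)) * (\<integral>\<^sup>+x. u x \<partial>lborel)" .
  qed (use c1 c2 c3 c4 in \<open>auto simp: less_max_iff_disj\<close>)
qed

end

section \<open>Smooth bump functions\<close>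

text \<open>For \<open>p = 1\<close> this is the standard smooth function that is flat at 0. Its derivatives are of the same
  form with other polynomials \<open>p\<close>, so the family is closed under differentiation.\<close>
definition flat_exp :: "real poly \<Rightarrow> real \<Rightarrow> real" where
  "flat_exp p t = (if 0 < t then poly p (1 / t) * exp (- (1 / t)) else 0)"

definition flat_exp_pderiv :: "real poly \<Rightarrow> real poly" where
  "flat_exp_pderiv p = monom 1 2 * (p - pderiv p)"

lemma poly_div_exp_tendsto_0: "((\<lambda>x::real. poly p x * exp (- x)) \<longlongrightarrow> 0) at_top"
proof -
  have "((\<lambda>x::real. \<Sum>i\<le>degree p. coeff p i * (x ^ i / exp x)) \<longlongrightarrow> (\<Sum>i\<le>degree p. coeff p i * 0)) at_top"
    by (intro tendsto_sum tendsto_mult tendsto_const tendsto_power_div_exp_0)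
  then show ?thesis by (simp add: poly_altdef sum_distrib_right exp_minus divide_inverse mult.assoc)
qed

lemma flat_exp_has_derivative: "(flat_exp p has_real_derivative flat_exp (flat_exp_pderiv p) t) (at t)"
proof -
  consider "t < 0" | "t = 0" | "0 < t" by linarith
  then show ?thesis
  proof cases
    case 1
    have "((\<lambda>_. 0) has_real_derivative 0) (at t)" by simp
    then have "(flat_exp p has_real_derivative 0) (at t)"
      by (rule has_field_derivative_transform_within_open[of _ _ _ "{..<0}"]) (use 1 in \<open>auto simp: flat_exp_def\<close>)
    then show ?thesis using 1 by (simp add: flat_exp_def)
  next
    case 2
    have "((\<lambda>h. (flat_exp p (0 + h) - flat_exp p 0) / h) \<longlongrightarrow> 0) (at 0)"
    proof (rule filterlim_split_at)
      show "((\<lambda>h. (flat_exp p (0 + h) - flat_exp p 0) / h) \<longlongrightarrow> 0) (at_left 0)"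
        by (rule tendsto_eventually) (auto simp: eventually_at_left_field flat_exp_def intro!: exI[of _ "-1"])
      have "((\<lambda>h. poly (pCons 0 p) (inverse h) * exp (- inverse h)) \<longlongrightarrow> (0::real)) (at_right 0)"
        by (rule filterlim_compose[OF poly_div_exp_tendsto_0 filterlim_inverse_at_top_right])
      then show "((\<lambda>h. (flat_exp p (0 + h) - flat_exp p 0) / h) \<longlongrightarrow> 0) (at_right 0)"
        by (rule Lim_transform_eventually)
           (auto simp: eventually_at_right_field flat_exp_def divide_inverse intro!: exI[of _ 1])
    qed
    then show ?thesis using 2 by (simp add: DERIV_def flat_exp_def)
  next
    case 3
    have "((\<lambda>t. poly p (1 / t) * exp (- (1 / t))) has_real_derivative
        poly p (1 / t) * (exp (- (1 / t)) * (1 / t^2)) + (poly (pderiv p) (1 / t) * (- (1 / t^2))) * exp (- (1 / t))) (at t)"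
    proof (rule DERIV_mult')
      have i: "((\<lambda>t. 1 / t) has_real_derivative (- (1 / t^2))) (at t)"
        using 3 by (auto intro!: derivative_eq_intros simp: power2_eq_square)
      show "((\<lambda>t. poly p (1 / t)) has_real_derivative poly (pderiv p) (1 / t) * (- (1 / t^2))) (at t)"
        by (rule DERIV_chain2[OF poly_DERIV i])
      show "((\<lambda>t. exp (- (1 / t))) has_real_derivative exp (- (1 / t)) * (1 / t^2)) (at t)"
        using DERIV_fun_exp[OF DERIV_minus[OF i]] by simp
    qed
    then have "(flat_exp p has_real_derivative
        poly p (1 / t) * (exp (- (1 / t)) * (1 / t^2)) + (poly (pderiv p) (1 / t) * (- (1 / t^2))) * exp (- (1 / t))) (at t)"
      by (rule has_field_derivative_transform_within_open[of _ _ _ "{0<..}"]) (use 3 in \<open>auto simp: flat_exp_def\<close>)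
    moreover have "poly p (1 / t) * (exp (- (1 / t)) * (1 / t^2)) + (poly (pderiv p) (1 / t) * (- (1 / t^2))) * exp (- (1 / t))
       = flat_exp (flat_exp_pderiv p) t"
      using 3 by (simp add: flat_exp_def flat_exp_pderiv_def poly_monom power_divide algebra_simps)
    ultimately show ?thesis by simp
  qed
qed

lemma continuous_flat_exp: "continuous_on A (flat_exp p)"
  using flat_exp_has_derivative by (meson DERIV_isCont continuous_at_imp_continuous_on)

lemma Ck_Suc_imp_Ck: "Ck (Suc k) f \<Longrightarrow> Ck k f"
proof (induction k arbitrary: f)
  case 0
  then obtain D where "\<forall>x. GDERIV f x :> D x" by auto
  then show ?case by (auto simp: gderiv_def intro!: continuous_at_imp_continuous_on has_derivative_continuous)
next
  case (Suc k)
  then obtain D where "\<forall>x. GDERIV f x :> D x" "\<forall>i. Ck (Suc k) (\<lambda>x. D x $ i)" by auto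
  with Suc.IH show ?case by (auto intro!: exI[of _ D])
qed

lemma Ck_const: "Ck k (\<lambda>x :: real^'n. c)"
proof (induction k arbitrary: c)
  case (Suc k)
  show ?case by (auto intro!: exI[of _ "\<lambda>_. 0"] Suc GDERIV_const)
qed simp

lemma Ck_add: "Ck k f \<Longrightarrow> Ck k g \<Longrightarrow> Ck k (\<lambda>x. f x + g x)"
proof (induction k arbitrary: f g)
  case (Suc k)
  obtain Df Dg where "\<forall>x. GDERIV f x :> Df x" "\<forall>i. Ck k (\<lambda>x. Df x $ i)"
    "\<forall>x. GDERIV g x :> Dg x" "\<forall>i. Ck k (\<lambda>x. Dg x $ i)" using Suc.prems by auto
  with Suc.IH show ?case by (auto intro!: exI[of _ "\<lambda>x. Df x + Dg x"] GDERIV_add)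
qed (auto intro: continuous_on_add)

lemma Ck_mult: "Ck k f \<Longrightarrow> Ck k g \<Longrightarrow> Ck k (\<lambda>x. f x * g x)"
proof (induction k arbitrary: f g)
  case (Suc k)
  obtain Df Dg where D: "\<forall>x. GDERIV f x :> Df x" "\<forall>i. Ck k (\<lambda>x. Df x $ i)"
    "\<forall>x. GDERIV g x :> Dg x" "\<forall>i. Ck k (\<lambda>x. Dg x $ i)" using Suc.prems by auto
  have "Ck k f" "Ck k g" using Suc.prems Ck_Suc_imp_Ck by blast+
  with Suc.IH D have "\<forall>i. Ck k (\<lambda>x. (f x *\<^sub>R Dg x + g x *\<^sub>R Df x) $ i)"
    by (auto intro!: Ck_add)
  moreover have "\<forall>x. GDERIV (\<lambda>x. f x * g x) x :> f x *\<^sub>R Dg x + g x *\<^sub>R Df x"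
    using D by (auto intro: GDERIV_mult)
  ultimately show ?case
    unfolding Ck.simps by (intro exI[of _ "\<lambda>x. f x *\<^sub>R Dg x + g x *\<^sub>R Df x"] conjI)
qed (auto intro: continuous_on_mult)

lemma Ck_component: "Ck k (\<lambda>x :: real^'n. x $ i - c)"
proof (cases k)
  case (Suc m)
  have "GDERIV (\<lambda>x :: real^'n. x $ i - c) x :> axis i 1" for x
    unfolding gderiv_def by (auto intro!: derivative_eq_intros bounded_linear.has_derivative[OF bounded_linear_vec_nth] simp: inner_axis)
  then show ?thesis unfolding Suc Ck.simps using Ck_const by (intro exI[of _ "\<lambda>_. axis i 1"]) auto
qed (auto intro!: continuous_intros)

text \<open>Up to coordinate factors, these functions again form a family closed under differentiation.\<close>
definition bump_poly :: "real poly \<Rightarrow> real \<Rightarrow> real^'n \<Rightarrow> real" where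
  "bump_poly p r z = flat_exp p (r\<^sup>2 - z \<bullet> z)"

abbreviation bump :: "real \<Rightarrow> real^'n \<Rightarrow> real" where "bump \<equiv> bump_poly 1"

definition bump_poly_grad :: "real poly \<Rightarrow> real \<Rightarrow> real^'n \<Rightarrow> real^'n" where
  "bump_poly_grad p r z = (- 2 * bump_poly (flat_exp_pderiv p) r z) *\<^sub>R z"

lemma bump_poly_gderiv: "GDERIV (bump_poly p r) z :> bump_poly_grad p r z"
proof -
  have "((\<lambda>z. r\<^sup>2 - z \<bullet> z) has_derivative (\<lambda>v. - (2 * (v \<bullet> z)))) (at z)"
    by (auto intro!: derivative_eq_intros simp: inner_commute)
  from DERIV_compose_FDERIV[OF flat_exp_has_derivative this]
  show ?thesis
    unfolding gderiv_def bump_poly_grad_def bump_poly_def by (simp add: mult_ac)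
qed

lemma GDERIV_translate: "(\<And>z. GDERIV f z :> D z) \<Longrightarrow> GDERIV (\<lambda>y. f (y - x)) y :> D (y - x)"
proof -
  assume D: "\<And>z. GDERIV f z :> D z"
  have "((\<lambda>y. y - x) has_derivative (\<lambda>v. v)) (at y)" by (auto intro!: derivative_eq_intros)
  from has_derivative_compose[OF this D[of "y - x", unfolded gderiv_def]]
  show ?thesis by (simp add: gderiv_def)
qed

lemma Ck_bump_poly: "Ck k (\<lambda>y. bump_poly p r (y - x))"
proof (induction k arbitrary: p)
  case 0
  show ?case
    unfolding bump_poly_def Ck.simps
    by (intro continuous_on_compose2[OF continuous_flat_exp] continuous_intros) auto
next
  case (Suc k)
  have "bump_poly_grad p r (y - x) $ i = bump_poly (flat_exp_pderiv p) r (y - x) * ((- 2) * (y $ i - x $ i))" for y i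
    by (simp add: bump_poly_grad_def algebra_simps)
  moreover have "Ck k (\<lambda>y. bump_poly (flat_exp_pderiv p) r (y - x) * ((- 2) * (y $ i - x $ i)))" for i
    by (intro Ck_mult Suc Ck_const Ck_component)
  ultimately have "\<forall>i. Ck k (\<lambda>y. bump_poly_grad p r (y - x) $ i)" by presburger
  then show ?case unfolding Ck.simps
    by (intro exI[of _ "\<lambda>y. bump_poly_grad p r (y - x)"] conjI allI GDERIV_translate bump_poly_gderiv) blast
qed

lemma bump_poly_support: "0 < r \<Longrightarrow> z \<notin> cball 0 r \<Longrightarrow> bump_poly p r z = 0"
proof -
  assume "0 < r" "z \<notin> cball 0 r"
  then have "r\<^sup>2 < (norm z)\<^sup>2" by (intro power_strict_mono) auto
  then show ?thesis by (simp add: bump_poly_def flat_exp_def power2_norm_eq_inner)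
qed

lemma test_function_bump:
  assumes "0 < r" "cball x r \<subseteq> \<Omega>"
  shows "test_function \<Omega> (\<lambda>y. bump_poly p r (y - x))"
  unfolding test_function_def
proof (intro conjI allI exI[of _ "cball x r"] impI)
  fix y assume "y \<notin> cball x r"
  then have "y - x \<notin> cball 0 r" by (simp add: dist_norm norm_minus_commute)
  then show "bump_poly p r (y - x) = 0" by (rule bump_poly_support[OF assms(1)])
qed (use assms Ck_bump_poly in auto)

lemma bump_nonneg: "0 \<le> bump r z" by (simp add: bump_poly_def flat_exp_def)

lemma bump_pos: "norm z < r \<Longrightarrow> 0 < bump r z"
proof -
  assume "norm z < r"
  then have "(norm z)\<^sup>2 < r\<^sup>2" by (intro power_strict_mono) auto
  then show ?thesis by (simp add: bump_poly_def flat_exp_def power2_norm_eq_inner)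
qed

lemma continuous_bump_poly: "continuous_on A (bump_poly p r)"
  unfolding bump_poly_def by (intro continuous_on_compose2[OF continuous_flat_exp] continuous_intros) auto

lemma borel_measurable_bump_poly[measurable]: "bump_poly p r \<in> borel_measurable borel"
  by (rule borel_measurable_continuous_onI[OF continuous_bump_poly])

lemma bump_poly_bounded:
  assumes "0 < r"
  obtains B where "0 \<le> B" "\<And>z :: real^'n. \<bar>bump_poly p r z\<bar> \<le> B" "\<And>z :: real^'n. norm (bump_poly_grad p r z) \<le> B"
proof -
  have *: "\<exists>B. \<forall>z :: real^'n. \<bar>bump_poly p r z\<bar> \<le> B" for p
  proof -
    have "compact (bump_poly p r ` (cball 0 r :: (real^'n) set))"
      by (intro compact_continuous_image continuous_bump_poly compact_cball)
    then obtain B where "\<forall>y \<in> bump_poly p r ` (cball 0 r :: (real^'n) set). norm y \<le> B"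
      by (auto simp: bounded_iff dest!: compact_imp_bounded)
    then have "\<bar>bump_poly p r z\<bar> \<le> max 0 B" for z :: "real^'n"
      using bump_poly_support[OF assms, of z p] by (cases "z \<in> cball 0 r") (auto simp: le_max_iff_disj)
    then show ?thesis by blast
  qed
  obtain B1 where B1: "\<And>z :: real^'n. \<bar>bump_poly p r z\<bar> \<le> B1" using * by blast
  obtain B2 where B2: "\<And>z :: real^'n. \<bar>bump_poly (flat_exp_pderiv p) r z\<bar> \<le> B2" using * by blast
  have B20: "0 \<le> B2" using B2[of 0] by linarith
  have "norm (bump_poly_grad p r z) \<le> 2 * B2 * r" for z :: "real^'n"
  proof (cases "z \<in> cball 0 r")
    case True
    have "norm (bump_poly_grad p r z) = 2 * \<bar>bump_poly (flat_exp_pderiv p) r z\<bar> * norm z"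
      by (simp add: bump_poly_grad_def abs_mult)
    also have "\<dots> \<le> 2 * B2 * r" using True B2[of z] B20 by (intro mult_mono) auto
    finally show ?thesis .
  next
    case False
    then show ?thesis using bump_poly_support[OF assms False] B20 assms by (simp add: bump_poly_grad_def)
  qed
  moreover have "0 \<le> 2 * B2 * r" using B20 assms by simp
  ultimately show thesis
    using B1 by (intro that[of "max B1 (2 * B2 * r)"]) (auto simp: le_max_iff_disj)
qed

text \<open>The type argument fixes the dimension, which \<open>r\<close> does not determine.\<close>
definition bump_mass :: "real \<Rightarrow> (real^'n) itself \<Rightarrow> real" where
  "bump_mass r _ = (\<integral>z. bump r (z :: real^'n) \<partial>lborel)"

lemma integrable_bump: "0 < r \<Longrightarrow> integrable lborel (bump r :: real^'n \<Rightarrow> real)"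
  by (rule integrable_continuous_compact_support[OF continuous_bump_poly, of "cball 0 r"])
     (auto intro: bump_poly_support)

lemma bump_mass_pos: assumes "0 < r" shows "0 < bump_mass r TYPE(real^'n)"
proof -
  have "0 \<le> bump_mass r TYPE(real^'n)" unfolding bump_mass_def by (intro Bochner_Integration.integral_nonneg bump_nonneg)
  moreover have "bump_mass r TYPE(real^'n) \<noteq> 0"
  proof
    assume "bump_mass r TYPE(real^'n) = 0"
    then have "AE z in lborel. bump r (z :: real^'n) = 0"
      unfolding bump_mass_def using integral_nonneg_eq_0_iff_AE[OF integrable_bump[OF assms]] bump_nonneg by auto
    then have "AE z in lborel. z \<notin> ball (0 :: real^'n) r"
      by eventually_elim (use bump_pos in force)
    then have "emeasure lborel (ball (0 :: real^'n) r) = 0"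
      by (subst (asm) AE_iff_measurable[of "ball 0 r"]) auto
    moreover have "0 < measure lborel (ball (0 :: real^'n) r)" by (rule content_ball_pos[OF assms])
    ultimately show False by (simp add: measure_def)
  qed
  ultimately show ?thesis by simp
qed

section \<open>Mollification\<close>

lemma borel_measurable_vecI:
  fixes f :: "'b \<Rightarrow> real^'n"
  shows "(\<And>i. (\<lambda>x. f x $ i) \<in> borel_measurable M) \<Longrightarrow> f \<in> borel_measurable M"
  by (subst borel_measurable_euclidean_space) (auto simp: Basis_vec_def inner_axis)

lemma borel_measurable_bump_poly_grad[measurable]: "bump_poly_grad p r \<in> borel_measurable borel"
  unfolding bump_poly_grad_def by measurable

text \<open>Convolution with the bump function, normalised to have integral 1.\<close>
definition mollify :: "real \<Rightarrow> (real^'n \<Rightarrow> real) \<Rightarrow> real^'n \<Rightarrow> real" where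
  "mollify r u x = (\<integral>y. u y * bump r (y - x) \<partial>lborel) / bump_mass r TYPE(real^'n)"

text \<open>The derivative falls on the bump function; the sign is that of \<open>x\<close> in \<open>y - x\<close>.\<close>
definition mollify_grad :: "real \<Rightarrow> (real^'n \<Rightarrow> real) \<Rightarrow> real^'n \<Rightarrow> real^'n" where
  "mollify_grad r u x = (\<chi> i. - (\<integral>y. u y * bump_poly_grad 1 r (y - x) $ i \<partial>lborel) / bump_mass r TYPE(real^'n))"

lemma integral_bump_translate: "(\<integral>y. bump r (y - x) \<partial>lborel) = bump_mass r TYPE(real^'n)" for x :: "real^'n"
  using integral_lborel_translate[of "bump r" "- x"] by (simp add: bump_mass_def)

lemma integrable_bump_translate: "0 < r \<Longrightarrow> integrable lborel (\<lambda>y :: real^'n. bump r (y - x))"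
proof (rule integrable_continuous_compact_support[of _ "cball x r"])
  show "continuous_on UNIV (\<lambda>y. bump r (y - x))"
    by (intro continuous_on_compose2[OF continuous_bump_poly[of UNIV]] continuous_intros) auto
  fix y :: "real^'n" assume "0 < r" "y \<notin> cball x r"
  then show "bump r (y - x) = 0" by (intro bump_poly_support) (auto simp: dist_norm norm_minus_commute)
qed auto

lemma integrable_mult_bump:
  fixes u :: "real^'n \<Rightarrow> real"
  assumes r: "0 < r" and u: "integrable lborel u"
  shows "integrable lborel (\<lambda>y. u y * bump r (y - x))"
    and "integrable lborel (\<lambda>y. u y * bump_poly_grad 1 r (y - x) $ i)"
proof -
  obtain B where B: "0 \<le> B" "\<And>z :: real^'n. \<bar>bump r z\<bar> \<le> B" "\<And>z :: real^'n. norm (bump_poly_grad 1 r z) \<le> B"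
    by (rule bump_poly_bounded[OF r, of 1]) blast
  have [measurable]: "u \<in> borel_measurable borel" using u by (simp add: borel_measurable_integrable[of lborel, simplified])
  have iB: "integrable lborel (\<lambda>y. \<bar>u y\<bar> * B)" using u by simp
  show "integrable lborel (\<lambda>y. u y * bump r (y - x))"
    by (rule Bochner_Integration.integrable_bound[OF iB])
       (auto intro!: AE_I2 mult_left_mono B simp: abs_mult B(1))
  have "\<bar>bump_poly_grad 1 r z $ i\<bar> \<le> B" for z :: "real^'n"
    using B(3)[of z] component_le_norm_cart[of "bump_poly_grad 1 r z" i] by linarith
  then show "integrable lborel (\<lambda>y. u y * bump_poly_grad 1 r (y - x) $ i)"
    by (intro Bochner_Integration.integrable_bound[OF iB])
       (auto intro!: AE_I2 mult_left_mono simp: abs_mult B(1))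
qed

lemma mollify_measurable[measurable]:
  assumes [measurable]: "u \<in> borel_measurable borel"
  shows "mollify r u \<in> borel_measurable borel"
  unfolding mollify_def
  by (intro borel_measurable_divide borel_measurable_const lborel.borel_measurable_lebesgue_integral) measurable

lemma mollify_grad_measurable:
  assumes [measurable]: "u \<in> borel_measurable borel"
  shows "mollify_grad r u \<in> borel_measurable borel"
  unfolding mollify_grad_def
  by (rule borel_measurable_vecI, simp only: vec_lambda_beta,
      intro borel_measurable_divide borel_measurable_uminus borel_measurable_const lborel.borel_measurable_lebesgue_integral) measurable

lemma mollify_gderiv:
  fixes u :: "real^'n \<Rightarrow> real"
  assumes r: "0 < r" and u: "integrable lborel u"
  shows "GDERIV (mollify r u) x :> mollify_grad r u x"
proof -
  let ?Z = "bump_mass r TYPE(real^'n)"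
  have [measurable]: "u \<in> borel_measurable borel" using u by (simp add: borel_measurable_integrable[of lborel, simplified])
  obtain B where B: "0 \<le> B" "\<And>z :: real^'n. \<bar>bump r z\<bar> \<le> B" "\<And>z :: real^'n. norm (bump_poly_grad 1 r z) \<le> B"
    by (rule bump_poly_bounded[OF r, of 1]) blast
  have "((\<lambda>x. \<integral>y. u y * bump r (y - x) \<partial>lborel) has_derivative
     (\<lambda>v. \<integral>y. u y * (- (v \<bullet> bump_poly_grad 1 r (y - x))) \<partial>lborel)) (at x)"
  proof (rule has_derivative_integral_dominated[where U = UNIV and g = "\<lambda>y. \<bar>u y\<bar> * B"])
    fix x y v :: "real^'n"
    show "integrable lborel (\<lambda>y. u y * bump r (y - x))" by (rule integrable_mult_bump[OF r u])
    have "((\<lambda>x. y - x) has_derivative (\<lambda>v. - v)) (at x)" by (auto intro!: derivative_eq_intros)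
    from has_derivative_compose[OF this bump_poly_gderiv[unfolded gderiv_def, of 1 r "y - x"]]
    show "((\<lambda>x. u y * bump r (y - x)) has_derivative (\<lambda>v. u y * (- (v \<bullet> bump_poly_grad 1 r (y - x))))) (at x)"
      by (intro has_derivative_mult_right) simp
    have "\<bar>v \<bullet> bump_poly_grad 1 r (y - x)\<bar> \<le> norm v * B"
      by (intro order_trans[OF Cauchy_Schwarz_ineq2] mult_left_mono B) auto
    then have "\<bar>u y\<bar> * \<bar>v \<bullet> bump_poly_grad 1 r (y - x)\<bar> \<le> \<bar>u y\<bar> * (norm v * B)"
      by (rule mult_left_mono) simp
    then show "\<bar>u y * (- (v \<bullet> bump_poly_grad 1 r (y - x)))\<bar> \<le> \<bar>u y\<bar> * B * norm v"
      by (simp add: abs_mult mult_ac)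
  qed (use u in auto)
  moreover have "(\<integral>y. u y * (- (v \<bullet> bump_poly_grad 1 r (y - x))) \<partial>lborel) = ?Z * (v \<bullet> mollify_grad r u x)" for v
  proof -
    have "(\<integral>y. u y * (- (v \<bullet> bump_poly_grad 1 r (y - x))) \<partial>lborel)
      = (\<integral>y. (\<Sum>i\<in>UNIV. - v $ i * (u y * bump_poly_grad 1 r (y - x) $ i)) \<partial>lborel)"
      by (intro Bochner_Integration.integral_cong refl)
         (simp add: inner_vec_def sum_distrib_left sum_negf[symmetric] mult_ac)
    also have "\<dots> = (\<Sum>i\<in>UNIV. - v $ i * (\<integral>y. u y * bump_poly_grad 1 r (y - x) $ i \<partial>lborel))"
      using integrable_mult_bump(2)[OF r u] by (subst Bochner_Integration.integral_sum) auto
    also have "\<dots> = ?Z * (v \<bullet> mollify_grad r u x)"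
      using bump_mass_pos[OF r, where 'n = 'n] by (simp add: inner_vec_def mollify_grad_def sum_distrib_left)
    finally show ?thesis .
  qed
  ultimately have d: "((\<lambda>x. \<integral>y. u y * bump r (y - x) \<partial>lborel) has_derivative (\<lambda>v. ?Z * (v \<bullet> mollify_grad r u x))) (at x)"
    by simp
  have "((\<lambda>x. (1 / ?Z) * (\<integral>y. u y * bump r (y - x) \<partial>lborel)) has_derivative (\<lambda>v. (1 / ?Z) * (?Z * (v \<bullet> mollify_grad r u x)))) (at x)"
    by (rule has_derivative_mult_right[OF d])
  then show ?thesis
    unfolding gderiv_def mollify_def[abs_def] using bump_mass_pos[OF r, where 'n = 'n] by simp
qed

lemma mollify_grad_bounded:
  fixes u :: "real^'n \<Rightarrow> real"
  assumes r: "0 < r" and u: "integrable lborel u"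
  obtains B where "\<And>x. norm (mollify_grad r u x) \<le> B"
proof -
  obtain B where B: "0 \<le> B" "\<And>z :: real^'n. \<bar>bump r z\<bar> \<le> B" "\<And>z :: real^'n. norm (bump_poly_grad 1 r z) \<le> B"
    by (rule bump_poly_bounded[OF r, of 1]) blast
  let ?Z = "bump_mass r TYPE(real^'n)"
  have "\<bar>mollify_grad r u x $ i\<bar> \<le> (\<integral>y. \<bar>u y\<bar> * B \<partial>lborel) / ?Z" for x i
  proof -
    have "\<bar>\<integral>y. u y * bump_poly_grad 1 r (y - x) $ i \<partial>lborel\<bar> \<le> (\<integral>y. \<bar>u y * bump_poly_grad 1 r (y - x) $ i\<bar> \<partial>lborel)"
      by (rule integral_abs_bound)
    also have "\<dots> \<le> (\<integral>y. \<bar>u y\<bar> * B \<partial>lborel)"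
    proof (rule integral_mono)
      fix y
      show "\<bar>u y * bump_poly_grad 1 r (y - x) $ i\<bar> \<le> \<bar>u y\<bar> * B"
        using B(3)[of "y - x"] component_le_norm_cart[of "bump_poly_grad 1 r (y - x)" i]
        by (simp add: abs_mult mult_left_mono)
    qed (use integrable_mult_bump(2)[OF r u] u in auto)
    finally show ?thesis
      using bump_mass_pos[OF r, where 'n = 'n] by (simp add: mollify_grad_def divide_right_mono)
  qed
  then have "norm (mollify_grad r u x) \<le> (\<Sum>i::'n\<in>UNIV. (\<integral>y. \<bar>u y\<bar> * B \<partial>lborel) / ?Z)" for x
    by (intro order_trans[OF norm_le_l1_cart] sum_mono)
  with that show thesis by blast
qed

lemma mollify_diff:
  assumes "0 < r" "integrable lborel u" "integrable lborel v"
  shows "mollify r (\<lambda>y. u y - v y) x = mollify r u x - mollify r v x"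
  unfolding mollify_def left_diff_distrib diff_divide_distrib[symmetric]
  by (subst Bochner_Integration.integral_diff) (auto intro: integrable_mult_bump assms)

text \<open>Jensen's inequality for the averaging measure, in the form that a variance is nonnegative.\<close>
lemma mollify_square_le:
  fixes w :: "real^'n \<Rightarrow> real"
  assumes r: "0 < r" and w: "integrable lborel w" "integrable lborel (\<lambda>y. (w y)\<^sup>2)"
  shows "(mollify r w x)\<^sup>2 \<le> mollify r (\<lambda>y. (w y)\<^sup>2) x"
proof -
  let ?Z = "bump_mass r TYPE(real^'n)" and ?m = "mollify r w x"
  have Z: "0 < ?Z" by (rule bump_mass_pos[OF r])
  note i = integrable_mult_bump(1)[OF r w(1)] integrable_mult_bump(1)[OF r w(2)] integrable_bump_translate[OF r]
  have "0 \<le> (\<integral>y. (w y - ?m)\<^sup>2 * bump r (y - x) \<partial>lborel)"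
    by (intro Bochner_Integration.integral_nonneg mult_nonneg_nonneg bump_nonneg) simp
  also have "\<dots> = (\<integral>y. (w y)\<^sup>2 * bump r (y - x) - 2 * ?m * (w y * bump r (y - x)) + ?m\<^sup>2 * bump r (y - x) \<partial>lborel)"
    by (intro Bochner_Integration.integral_cong refl) (simp add: power2_diff algebra_simps)
  also have "\<dots> = (\<integral>y. (w y)\<^sup>2 * bump r (y - x) \<partial>lborel) - 2 * ?m * (\<integral>y. w y * bump r (y - x) \<partial>lborel) + ?m\<^sup>2 * ?Z"
  proof -
    have A: "integrable lborel (\<lambda>y. 2 * ?m * (w y * bump r (y - x)))" and B: "integrable lborel (\<lambda>y. ?m\<^sup>2 * bump r (y - x))"
      by (intro integrable_mult_right i)+
    show ?thesis
      unfolding Bochner_Integration.integral_add[OF Bochner_Integration.integrable_diff[OF i(2) A] B]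
        Bochner_Integration.integral_diff[OF i(2) A] integral_mult_right_zero integral_bump_translate ..
  qed
  also have "(\<integral>y. w y * bump r (y - x) \<partial>lborel) = ?m * ?Z" using Z by (simp add: mollify_def)
  finally have "?m\<^sup>2 * ?Z \<le> (\<integral>y. (w y)\<^sup>2 * bump r (y - x) \<partial>lborel)"
    by (simp add: power2_eq_square mult_ac)
  then show ?thesis using Z by (simp add: mollify_def[of r "\<lambda>y. (w y)\<^sup>2"] pos_le_divide_eq)
qed

text \<open>Integrating the pointwise Jensen bound and exchanging the integrals shows that mollification is
  a contraction on \<open>L\<^sup>2\<close>.\<close>
lemma nn_integral_mollify_square_le:
  fixes w :: "real^'n \<Rightarrow> real"
  assumes r: "0 < r" and w: "integrable lborel w" "integrable lborel (\<lambda>y. (w y)\<^sup>2)"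
  shows "(\<integral>\<^sup>+x. ennreal ((mollify r w x)\<^sup>2) \<partial>lborel) \<le> (\<integral>\<^sup>+x. ennreal ((w x)\<^sup>2) \<partial>lborel)"
proof -
  let ?Z = "bump_mass r TYPE(real^'n)"
  have Z: "0 < ?Z" by (rule bump_mass_pos[OF r])
  have [measurable]: "w \<in> borel_measurable borel" using w by (simp add: borel_measurable_integrable[of lborel, simplified])
  have sym: "bump r (y - x) = bump r (x - y)" for x y :: "real^'n"
    by (simp add: bump_poly_def inner_diff_left inner_diff_right inner_commute algebra_simps)
  have "(\<integral>\<^sup>+x. ennreal ((mollify r w x)\<^sup>2) \<partial>lborel) \<le> (\<integral>\<^sup>+x. ennreal (mollify r (\<lambda>y. (w y)\<^sup>2) x) \<partial>lborel)"
    by (intro nn_integral_mono ennreal_leI mollify_square_le assms)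
  also have "\<dots> = (\<integral>\<^sup>+x. (\<integral>\<^sup>+y. ennreal ((w y)\<^sup>2 * bump r (y - x) / ?Z) \<partial>lborel) \<partial>lborel)"
  proof (rule nn_integral_cong)
    fix x
    have "(\<integral>\<^sup>+y. ennreal ((w y)\<^sup>2 * bump r (y - x) / ?Z) \<partial>lborel) = ennreal (\<integral>y. (w y)\<^sup>2 * bump r (y - x) / ?Z \<partial>lborel)"
      using integrable_mult_bump(1)[OF r w(2)] Z
      by (intro nn_integral_eq_integral) (auto intro!: AE_I2 divide_nonneg_pos mult_nonneg_nonneg bump_nonneg)
    then show "ennreal (mollify r (\<lambda>y. (w y)\<^sup>2) x) = (\<integral>\<^sup>+y. ennreal ((w y)\<^sup>2 * bump r (y - x) / ?Z) \<partial>lborel)"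
      by (simp add: mollify_def)
  qed
  also have "\<dots> = (\<integral>\<^sup>+y. (\<integral>\<^sup>+x. ennreal ((w y)\<^sup>2 * bump r (y - x) / ?Z) \<partial>lborel) \<partial>lborel)"
    by (rule lborel_pair.Fubini') measurable
  also have "\<dots> = (\<integral>\<^sup>+y. ennreal ((w y)\<^sup>2) \<partial>lborel)"
  proof (rule nn_integral_cong)
    fix y
    have "(\<integral>\<^sup>+x. ennreal ((w y)\<^sup>2 * bump r (y - x) / ?Z) \<partial>lborel) = ennreal (\<integral>x. (w y)\<^sup>2 * bump r (x - y) / ?Z \<partial>lborel)"
      unfolding sym[of y]
    proof (rule nn_integral_eq_integral)
      show "integrable lborel (\<lambda>x. (w y)\<^sup>2 * bump r (x - y) / ?Z)"
        by (intro Bochner_Integration.integrable_divide integrable_mult_right integrable_bump_translate r)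
    qed (use Z in \<open>auto intro!: AE_I2 divide_nonneg_pos mult_nonneg_nonneg bump_nonneg\<close>)
    also have "(\<integral>x. (w y)\<^sup>2 * bump r (x - y) / ?Z \<partial>lborel) = (w y)\<^sup>2"
      using Z by (simp add: integral_bump_translate)
    finally show "(\<integral>\<^sup>+x. ennreal ((w y)\<^sup>2 * bump r (y - x) / ?Z) \<partial>lborel) = ennreal ((w y)\<^sup>2)" .
  qed
  finally show ?thesis .
qed

text \<open>The sum of \<open>K\<close> and a ball; in this form compactness is inherited from \<open>K\<close>.\<close>
definition thicken :: "real \<Rightarrow> 'a::real_normed_vector set \<Rightarrow> 'a set" where
  "thicken e K = (\<lambda>(x, y). x + y) ` (K \<times> cball 0 e)"

lemma compact_thicken: "compact K \<Longrightarrow> compact (thicken e (K :: 'a::euclidean_space set))"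
  unfolding thicken_def
  by (intro compact_continuous_image compact_Times) (auto intro!: continuous_intros simp: case_prod_unfold)

lemma thicken_iff: "z \<in> thicken e K \<longleftrightarrow> (\<exists>x\<in>K. dist x z \<le> e)"
proof
  assume "z \<in> thicken e K"
  then obtain a b where "z = a + b" "a \<in> K" "norm b \<le> e" by (auto simp: thicken_def)
  then show "\<exists>x\<in>K. dist x z \<le> e" by (intro bexI[of _ a]) (auto simp: dist_norm)
next
  assume "\<exists>x\<in>K. dist x z \<le> e"
  then obtain x where "x \<in> K" "norm (z - x) \<le> e" by (auto simp: dist_norm norm_minus_commute)
  then show "z \<in> thicken e K" unfolding thicken_def by (intro image_eqI[of _ _ "(x, z - x)"]) auto
qed

lemma mollify_uniform_convergence:
  fixes v :: "real^'n \<Rightarrow> real"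
  assumes v: "continuous_on UNIV v" and K: "compact K" "\<And>x. x \<notin> K \<Longrightarrow> v x = 0" and e: "0 < e"
  obtains d where "0 < d" "\<And>r x. 0 < r \<Longrightarrow> r < d \<Longrightarrow> \<bar>mollify r v x - v x\<bar> \<le> e * indicator (thicken 1 K) x"
proof -
  have iv: "integrable lborel v" by (rule integrable_continuous_compact_support[OF v K])
  have "uniformly_continuous_on (thicken 2 K) v"
    by (intro compact_uniformly_continuous compact_thicken K continuous_on_subset[OF v]) auto
  then obtain d where d: "0 < d" "\<And>x y. x \<in> thicken 2 K \<Longrightarrow> y \<in> thicken 2 K \<Longrightarrow> dist y x < d \<Longrightarrow> dist (v y) (v x) < e"
    using e unfolding uniformly_continuous_on_def by metis
  show thesis
  proof (rule that[of "min 1 d"])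
    fix r and x :: "real^'n" assume r: "0 < r" "r < min 1 d"
    let ?Z = "bump_mass r TYPE(real^'n)"
    have Z: "0 < ?Z" by (rule bump_mass_pos[OF r(1)])
    have small: "\<bar>v y - v x\<bar> * bump r (y - x) \<le> e * indicator (thicken 1 K) x * bump r (y - x)" for y
    proof (cases "y - x \<in> cball 0 r")
      case False
      then show ?thesis using bump_poly_support[OF r(1) False] by simp
    next
      case True
      then have "norm (y - x) \<le> r" by (simp only: mem_cball_0)
      then have yx: "dist y x < 1" "dist y x < d" using r by (auto simp: dist_norm)
      show ?thesis
      proof (cases "x \<in> thicken 1 K")
        case True
        then obtain k where k: "k \<in> K" "dist k x \<le> 1" by (auto simp: thicken_iff)
        then have "dist k y \<le> 2" using yx(1) dist_triangle[of k y x] by (simp add: dist_commute)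
        with k have "x \<in> thicken 2 K" "y \<in> thicken 2 K" by (auto simp: thicken_iff intro!: bexI[of _ k])
        then have "\<bar>v y - v x\<bar> \<le> e" using d(2) yx(2) by (fastforce simp: dist_real_def intro: less_imp_le)
        then show ?thesis using True by (simp add: mult_right_mono bump_nonneg)
      next
        case False
        have "x \<notin> K" using False by (auto simp: thicken_iff intro!: bexI[of _ x])
        moreover have "y \<notin> K" using False yx(1) by (auto simp: thicken_iff intro!: bexI[of _ y])
        ultimately show ?thesis
          using K(2) less_imp_le[OF e] by (auto intro!: mult_nonneg_nonneg bump_nonneg)
      qed
    qed
    note i = integrable_mult_bump(1)[OF r(1) iv, of x] integrable_bump_translate[OF r(1), of x]
    have i2: "integrable lborel (\<lambda>y. (v y - v x) * bump r (y - x))"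
      using i by (simp add: left_diff_distrib)
    have "(mollify r v x - v x) * ?Z = (\<integral>y. (v y - v x) * bump r (y - x) \<partial>lborel)"
      using i Z by (simp add: left_diff_distrib mollify_def integral_bump_translate)
    then have "\<bar>mollify r v x - v x\<bar> * ?Z = \<bar>\<integral>y. (v y - v x) * bump r (y - x) \<partial>lborel\<bar>"
      using Z by (metis abs_mult abs_of_pos)
    also have "\<dots> \<le> (\<integral>y. \<bar>(v y - v x) * bump r (y - x)\<bar> \<partial>lborel)" by (rule integral_abs_bound)
    also have "\<dots> \<le> (\<integral>y. e * indicator (thicken 1 K) x * bump r (y - x) \<partial>lborel)"
      by (intro integral_mono integrable_abs i2 integrable_mult_right i(2))
         (use small in \<open>simp add: abs_mult abs_of_nonneg[OF bump_nonneg]\<close>)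
    also have "\<dots> = e * indicator (thicken 1 K) x * ?Z" by (simp add: integral_bump_translate)
    finally show "\<bar>mollify r v x - v x\<bar> \<le> e * indicator (thicken 1 K) x" using Z by simp
  qed (use d in auto)
qed

text \<open>Truncation makes \<open>u\<close> bounded. A bounded measurable function is an almost everywhere limit of
  continuous ones, which may be truncated too and multiplied by a continuous cutoff of \<open>K\<close>;
  dominated convergence then applies.\<close>
lemma continuous_compact_support_dense_L2:
  fixes u :: "'a::euclidean_space \<Rightarrow> real"
  assumes u[measurable]: "u \<in> borel_measurable borel" and u2: "integrable lborel (\<lambda>x. (u x)\<^sup>2)"
    and K: "compact K" "\<And>x. x \<notin> K \<Longrightarrow> u x = 0" and e: "0 < e"
  obtains v where "continuous_on UNIV v" "\<And>x. x \<notin> thicken 1 K \<Longrightarrow> v x = 0"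
    "integrable lborel (\<lambda>x. (u x - v x)\<^sup>2)" "(\<integral>x. (u x - v x)\<^sup>2 \<partial>lborel) < e"
proof -
  \<comment> \<open>truncation at height \<open>m\<close>\<close>
  define cl where "cl m y = max (- real m) (min (real m) y)" for m y
  have cl_le: "\<bar>y - cl m y\<bar> \<le> \<bar>y\<bar>" "\<bar>cl m y\<bar> \<le> real m" for m y
    unfolding cl_def by (auto simp: max_def min_def)
  have [measurable]: "cl m \<in> borel_measurable borel" for m unfolding cl_def by measurable
  have "(\<lambda>m. \<integral>x. (u x - cl m (u x))\<^sup>2 \<partial>lborel) \<longlonglongrightarrow> (\<integral>x. 0 \<partial>(lborel :: 'a measure))"
  proof (rule integral_dominated_convergence[OF _ _ u2])
    show "AE x in lborel. (\<lambda>m. (u x - cl m (u x))\<^sup>2) \<longlonglongrightarrow> 0"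
    proof (rule AE_I2)
      fix x
      obtain m0 where m0: "\<bar>u x\<bar> \<le> real m0" using real_arch_simple by blast
      have "(u x - cl m (u x))\<^sup>2 = 0" if "m0 \<le> m" for m
        using m0 that unfolding cl_def by (auto simp: max_def min_def)
      then show "(\<lambda>m. (u x - cl m (u x))\<^sup>2) \<longlonglongrightarrow> 0"
        by (intro tendsto_eventually) (auto simp: eventually_sequentially)
    qed
    show "AE x in lborel. norm ((u x - cl m (u x))\<^sup>2) \<le> (u x)\<^sup>2" for m
      using cl_le(1) by (intro AE_I2) (simp add: abs_le_square_iff[symmetric])
  qed measurable
  then have "eventually (\<lambda>m. (\<integral>x. (u x - cl m (u x))\<^sup>2 \<partial>lborel) < e / 4) sequentially"
    using e by (intro order_tendstoD) auto
  then obtain m where m: "(\<integral>x. (u x - cl m (u x))\<^sup>2 \<partial>lborel) < e / 4"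
    by (auto simp: eventually_sequentially)
  define w where "w x = cl m (u x)" for x
  have [measurable]: "w \<in> borel_measurable borel" unfolding w_def by measurable
  have w0: "w x = 0" if "x \<notin> K" for x using K(2)[OF that] by (simp add: w_def cl_def)
  have wm: "\<bar>w x\<bar> \<le> real m" for x unfolding w_def by (rule cl_le)
  have iuw: "integrable lborel (\<lambda>x. (u x - w x)\<^sup>2)"
    by (rule Bochner_Integration.integrable_bound[OF u2])
       (use cl_le(1) in \<open>auto intro!: AE_I2 simp: w_def abs_le_square_iff[symmetric]\<close>)
  have "w measurable_on UNIV"
    by (rule lebesgue_measurable_imp_measurable_on_real) (auto intro: borel_measurable_if measurable_completion)
  then obtain N g where N: "negligible N" and g: "\<And>n. continuous_on UNIV (g n)"
    and lim: "\<And>x. x \<notin> N \<Longrightarrow> (\<lambda>n. g n x) \<longlonglongrightarrow> w x"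
    unfolding measurable_on_def by auto
  \<comment> \<open>the cutoff: 1 on \<open>K\<close>, 0 outside its unit neighbourhood\<close>
  define c where "c x = max 0 (1 - infdist x K)" for x
  define v where "v n x = (if K = {} then 0 else c x * cl m (g n x))" for n x
  have cc: "continuous_on UNIV c" unfolding c_def by (intro continuous_intros)
  have clc: "continuous_on UNIV (cl m)" unfolding cl_def by (intro continuous_intros)
  have vc: "continuous_on UNIV (v n)" for n
    unfolding v_def by (cases "K = {}") (auto intro!: continuous_intros cc continuous_on_compose2[OF clc g])
  have c0: "c x = 0" if x: "x \<notin> thicken 1 K" "K \<noteq> {}" for x
  proof -
    obtain k where k: "k \<in> K" "infdist x K = dist x k"
      using infdist_attains_inf[OF compact_imp_closed[OF K(1)] x(2), of x] by blast
    then have "1 < dist x k" using x(1) by (force simp: thicken_iff dist_commute)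
    with k show ?thesis by (simp add: c_def)
  qed
  have c1: "0 \<le> c x" "c x \<le> 1" for x unfolding c_def using infdist_nonneg[of x K] by auto
  have v0: "v n x = 0" if "x \<notin> thicken 1 K" for n x using c0[OF that] by (simp add: v_def)
  have vm: "\<bar>v n x\<bar> \<le> real m" for n x
  proof -
    have "c x * \<bar>cl m (g n x)\<bar> \<le> 1 * real m" by (intro mult_mono c1 cl_le) auto
    then show ?thesis using c1 by (simp add: v_def abs_mult)
  qed
  have tK: "compact (thicken 1 K)" by (rule compact_thicken[OF K(1)])
  have Kt: "K \<subseteq> thicken 1 K" unfolding subset_iff thicken_iff by (metis dist_self zero_le_one)
  have idom: "integrable lborel (\<lambda>x. (2 * real m)\<^sup>2 * indicator (thicken 1 K) x)"
    using tK emeasure_compact_finite[OF tK]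
    by (intro integrable_mult_right integrable_real_indicator) (auto simp: borel_compact)
  have bnd: "norm ((w x - v n x)\<^sup>2) \<le> (2 * real m)\<^sup>2 * indicator (thicken 1 K) x" for n x
  proof (cases "x \<in> thicken 1 K")
    case True
    have "\<bar>w x - v n x\<bar> \<le> \<bar>2 * real m\<bar>" using wm[of x] vm[of n x] by linarith
    then have "(w x - v n x)\<^sup>2 \<le> (2 * real m)\<^sup>2" by (simp only: abs_le_square_iff)
    then show ?thesis using True by simp
  next
    case False
    then show ?thesis using v0 w0 Kt by auto
  qed
  have vmeas[measurable]: "v n \<in> borel_measurable borel" for n by (rule borel_measurable_continuous_onI[OF vc])
  have "(\<lambda>n. \<integral>x. (w x - v n x)\<^sup>2 \<partial>lborel) \<longlonglongrightarrow> (\<integral>x. 0 \<partial>(lborel :: 'a measure))"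
  proof (rule integral_dominated_convergence[OF _ _ idom])
    have "AE x in lebesgue. x \<notin> N" using N by (simp add: negligible_iff_null_sets AE_not_in)
    then have "AE x in lborel. x \<notin> N" by (simp add: AE_completion_iff)
    then show "AE x in lborel. (\<lambda>n. (w x - v n x)\<^sup>2) \<longlonglongrightarrow> 0"
    proof eventually_elim
      fix x assume x: "x \<notin> N"
      have ww: "cl m (w x) = w x" using wm[of x] by (auto simp: cl_def max_def min_def)
      have "(\<lambda>n. cl m (g n x)) \<longlonglongrightarrow> cl m (w x)"
        using lim[OF x] clc by (auto intro: continuous_on_tendsto_compose[where s = UNIV])
      then have l: "(\<lambda>n. c x * cl m (g n x)) \<longlonglongrightarrow> c x * w x" by (simp add: ww tendsto_mult)
      have cw: "c x * w x = w x"
      proof (cases "x \<in> K")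
        case False then show ?thesis by (simp add: w0)
      qed (simp add: c_def)
      have "(\<lambda>n. v n x) \<longlonglongrightarrow> w x"
        using l cw w0[of x] by (cases "K = {}") (auto simp: v_def)
      then have "(\<lambda>n. (w x - v n x)\<^sup>2) \<longlonglongrightarrow> (w x - w x)\<^sup>2" by (intro tendsto_intros)
      then show "(\<lambda>n. (w x - v n x)\<^sup>2) \<longlonglongrightarrow> 0" by simp
    qed
    show "AE x in lborel. norm ((w x - v n x)\<^sup>2) \<le> (2 * real m)\<^sup>2 * indicator (thicken 1 K) x" for n
      by (intro AE_I2 bnd)
  qed measurable
  then have "eventually (\<lambda>n. (\<integral>x. (w x - v n x)\<^sup>2 \<partial>lborel) < e / 4) sequentially"
    using e by (intro order_tendstoD) auto
  then obtain n where n: "(\<integral>x. (w x - v n x)\<^sup>2 \<partial>lborel) < e / 4"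
    by (auto simp: eventually_sequentially)
  have iwv: "integrable lborel (\<lambda>x. (w x - v n x)\<^sup>2)"
  proof (rule Bochner_Integration.integrable_bound[OF idom])
    show "AE x in lborel. norm ((w x - v n x)\<^sup>2) \<le> norm ((2 * real m)\<^sup>2 * indicator (thicken 1 K) x)"
      by (rule AE_I2, rule order_trans[OF bnd]) simp
  qed measurable
  have sq: "(u x - v n x)\<^sup>2 \<le> 2 * (u x - w x)\<^sup>2 + 2 * (w x - v n x)\<^sup>2" for x
    using zero_le_power2[of "(u x - w x) - (w x - v n x)"] by (simp add: power2_eq_square algebra_simps)
  have isum: "integrable lborel (\<lambda>x. 2 * (u x - w x)\<^sup>2 + 2 * (w x - v n x)\<^sup>2)" using iuw iwv by simp
  have iuv: "integrable lborel (\<lambda>x. (u x - v n x)\<^sup>2)"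
    by (rule Bochner_Integration.integrable_bound[OF isum]) (use sq in \<open>auto intro!: AE_I2 order_trans[OF sq]\<close>)
  have "(\<integral>x. (u x - v n x)\<^sup>2 \<partial>lborel) \<le> (\<integral>x. 2 * (u x - w x)\<^sup>2 + 2 * (w x - v n x)\<^sup>2 \<partial>lborel)"
    by (intro integral_mono iuv isum sq)
  also have "\<dots> < e" using m n iuw iwv by (simp add: w_def)
  finally show thesis using that[of "v n"] vc v0 iuv by blast
qed

text \<open>Compare with a continuous approximation \<open>v\<close> of \<open>u\<close>: the mollification of \<open>v\<close> converges uniformly, and
  that of \<open>u - v\<close> is no larger than \<open>u - v\<close> itself.\<close>
lemma mollify_L2_convergence:
  fixes u :: "real^'n \<Rightarrow> real"
  assumes u[measurable]: "u \<in> borel_measurable borel" and u1: "integrable lborel u" and u2: "integrable lborel (\<lambda>x. (u x)\<^sup>2)"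
    and K: "compact K" "\<And>x. x \<notin> K \<Longrightarrow> u x = 0"
    and r: "\<And>n. 0 < r n" "r \<longlonglongrightarrow> 0"
  shows "(\<lambda>n. \<integral>\<^sup>+x. ennreal ((mollify (r n) u x - u x)\<^sup>2) \<partial>lborel) \<longlonglongrightarrow> 0"
proof (rule order_tendstoI)
  fix a :: ennreal assume "0 < a"
  then obtain e where e: "0 < ennreal e" "ennreal e < a" "0 \<le> e"
    by (metis dense ennreal_cases not_less_zero infinity_ennreal_def top_greatest not_le order_less_trans)
  then have e0: "0 < e" by (simp add: ennreal_less_zero_iff)
  obtain v where v: "continuous_on UNIV v" "\<And>x. x \<notin> thicken 1 K \<Longrightarrow> v x = 0"
    "integrable lborel (\<lambda>x. (u x - v x)\<^sup>2)" "(\<integral>x. (u x - v x)\<^sup>2 \<partial>lborel) < e / 12"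
    by (rule continuous_compact_support_dense_L2[OF u u2 K, of "e / 12"]) (use e0 in auto)
  have tK: "compact (thicken 1 K)" by (rule compact_thicken[OF K(1)])
  have v1: "integrable lborel v" by (rule integrable_continuous_compact_support[OF v(1) tK v(2)])
  have [measurable]: "v \<in> borel_measurable borel" by (rule borel_measurable_continuous_onI[OF v(1)])
  let ?L = "measure lborel (thicken 1 (thicken 1 K))"
  have tK2: "compact (thicken 1 (thicken 1 K))" by (rule compact_thicken[OF tK])
  \<comment> \<open>makes the contribution of the uniform error to the integral at most \<open>e / 6\<close>\<close>
  define \<eta> where "\<eta> = sqrt (e / (6 * (?L + 1)))"
  have L0: "0 < ?L + 1" by (simp add: add_nonneg_pos)
  have \<eta>: "0 < \<eta>" "\<eta>\<^sup>2 * ?L \<le> e / 6"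
  proof -
    show "0 < \<eta>" using e0 L0 by (simp add: \<eta>_def)
    have \<eta>2: "\<eta>\<^sup>2 = e / (6 * (?L + 1))" using e0 L0 by (simp add: \<eta>_def)
    have "\<eta>\<^sup>2 * ?L \<le> \<eta>\<^sup>2 * (?L + 1)" by (rule mult_left_mono) auto
    also have "\<dots> = e / 6"
    proof -
      have "e / (6 * D) * D = e / 6" if "0 < D" for D :: real using that by simp
      from this[OF L0] show ?thesis unfolding \<eta>2 .
    qed
    finally show "\<eta>\<^sup>2 * ?L \<le> e / 6" .
  qed
  obtain d where d: "0 < d" "\<And>r x. 0 < r \<Longrightarrow> r < d \<Longrightarrow> \<bar>mollify r v x - v x\<bar> \<le> \<eta> * indicator (thicken 1 (thicken 1 K)) x"
    by (rule mollify_uniform_convergence[OF v(1) tK v(2) \<eta>(1)]) (assumption, rule that)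
  have "eventually (\<lambda>n. r n < d) sequentially" using r(2) d(1) by (rule order_tendstoD)
  then show "eventually (\<lambda>n. (\<integral>\<^sup>+x. ennreal ((mollify (r n) u x - u x)\<^sup>2) \<partial>lborel) < a) sequentially"
  proof (rule eventually_mono)
    fix n assume n: "r n < d"
    let ?w = "\<lambda>y. u y - v y"
    have w1: "integrable lborel ?w" using u1 v1 by simp
    have N: "(\<integral>\<^sup>+x. ennreal ((?w x)\<^sup>2) \<partial>lborel) \<le> ennreal (e / 12)"
      using v(3,4) by (subst nn_integral_eq_integral) (auto intro!: ennreal_leI)
    have "(\<integral>\<^sup>+x. ennreal ((mollify (r n) u x - u x)\<^sup>2) \<partial>lborel)
      \<le> (\<integral>\<^sup>+x. ennreal 3 * ennreal ((mollify (r n) ?w x)\<^sup>2) + (ennreal 3 * ennreal ((mollify (r n) v x - v x)\<^sup>2) + ennreal 3 * ennreal ((?w x)\<^sup>2)) \<partial>lborel)"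
    proof (rule nn_integral_mono)
      fix x
      have s3: "(a + b - c)\<^sup>2 \<le> 3 * a\<^sup>2 + (3 * b\<^sup>2 + 3 * c\<^sup>2)" for a b c :: real
        using zero_le_power2[of "a - b"] zero_le_power2[of "a + c"] zero_le_power2[of "b + c"]
        by (simp add: power2_eq_square algebra_simps)
      have "mollify (r n) u x - u x = mollify (r n) ?w x + (mollify (r n) v x - v x) - ?w x"
        by (simp add: mollify_diff[OF r(1) u1 v1])
      then have "(mollify (r n) u x - u x)\<^sup>2 \<le> 3 * (mollify (r n) ?w x)\<^sup>2 + (3 * (mollify (r n) v x - v x)\<^sup>2 + 3 * (?w x)\<^sup>2)"
        by (simp only: s3)
      then show "ennreal ((mollify (r n) u x - u x)\<^sup>2) \<le> ennreal 3 * ennreal ((mollify (r n) ?w x)\<^sup>2) + (ennreal 3 * ennreal ((mollify (r n) v x - v x)\<^sup>2) + ennreal 3 * ennreal ((?w x)\<^sup>2))"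
        by (simp only: ennreal_mult[symmetric] ennreal_plus[symmetric] zero_le_power2 zero_le_numeral mult_nonneg_nonneg add_nonneg_nonneg) (rule ennreal_leI)
    qed
    also have "\<dots> = ennreal 3 * (\<integral>\<^sup>+x. ennreal ((mollify (r n) ?w x)\<^sup>2) \<partial>lborel) + (ennreal 3 * (\<integral>\<^sup>+x. ennreal ((mollify (r n) v x - v x)\<^sup>2) \<partial>lborel)
        + ennreal 3 * (\<integral>\<^sup>+x. ennreal ((?w x)\<^sup>2) \<partial>lborel))"
      by (simp add: nn_integral_add nn_integral_cmult del: ennreal_numeral)
    also have "\<dots> \<le> ennreal 3 * ennreal (e / 12) + (ennreal 3 * ennreal (e / 6) + ennreal 3 * ennreal (e / 12))"
    proof (intro add_mono mult_left_mono N)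
      show "(\<integral>\<^sup>+x. ennreal ((mollify (r n) ?w x)\<^sup>2) \<partial>lborel) \<le> ennreal (e / 12)"
        using nn_integral_mollify_square_le[OF r(1) w1 v(3)] N by (rule order_trans)
      have "(\<integral>\<^sup>+x. ennreal ((mollify (r n) v x - v x)\<^sup>2) \<partial>lborel) \<le> (\<integral>\<^sup>+x. ennreal (\<eta>\<^sup>2) * indicator (thicken 1 (thicken 1 K)) x \<partial>lborel)"
      proof (rule nn_integral_mono)
        fix x
        have "\<bar>mollify (r n) v x - v x\<bar> \<le> \<bar>\<eta> * indicator (thicken 1 (thicken 1 K)) x\<bar>"
          using d(2)[OF r(1) n] by (rule order_trans) simp
        then have "(mollify (r n) v x - v x)\<^sup>2 \<le> (\<eta> * indicator (thicken 1 (thicken 1 K)) x)\<^sup>2"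
          by (simp only: abs_le_square_iff)
        then have "ennreal ((mollify (r n) v x - v x)\<^sup>2) \<le> ennreal ((\<eta> * indicator (thicken 1 (thicken 1 K)) x)\<^sup>2)"
          by (rule ennreal_leI)
        also have "\<dots> = ennreal (\<eta>\<^sup>2) * indicator (thicken 1 (thicken 1 K)) x"
          by (auto simp: indicator_def)
        finally show "ennreal ((mollify (r n) v x - v x)\<^sup>2) \<le> ennreal (\<eta>\<^sup>2) * indicator (thicken 1 (thicken 1 K)) x" .
      qed
      also have "\<dots> = ennreal (\<eta>\<^sup>2) * emeasure lborel (thicken 1 (thicken 1 K))"
        using tK2 by (intro nn_integral_cmult_indicator) (simp add: borel_compact)
      also have "\<dots> = ennreal (\<eta>\<^sup>2 * ?L)"
        using emeasure_compact_finite[OF tK2] by (simp add: emeasure_eq_ennreal_measure ennreal_mult less_top)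
      also have "\<dots> \<le> ennreal (e / 6)" by (rule ennreal_leI[OF \<eta>(2)])
      finally show "(\<integral>\<^sup>+x. ennreal ((mollify (r n) v x - v x)\<^sup>2) \<partial>lborel) \<le> ennreal (e / 6)" .
    qed auto
    also have "\<dots> = ennreal e"
    proof -
      have "ennreal 3 * ennreal (e / 12) + (ennreal 3 * ennreal (e / 6) + ennreal 3 * ennreal (e / 12))
         = ennreal (3 * (e / 12) + (3 * (e / 6) + 3 * (e / 12)))"
        using e0 by (simp only: ennreal_mult[symmetric] ennreal_plus[symmetric])
      then show ?thesis by simp
    qed
    finally show "(\<integral>\<^sup>+x. ennreal ((mollify (r n) u x - u x)\<^sup>2) \<partial>lborel) < a" using e(2) by simp
  qed
qed simp

section \<open>Square-integrable limits, cutoffs and weak gradients\<close>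

text \<open>The bound \<open>\<bar>a\<^sup>2 - b\<^sup>2\<bar> \<le> \<tau> * b\<^sup>2 + (1 + 1 / \<tau>) * (a - b)\<^sup>2\<close> with small \<open>\<tau>\<close> reduces the convergence of
  the second moments to that of the squared distances.\<close>
lemma L2_limit_square:
  fixes g :: "'b \<Rightarrow> real"
  assumes [measurable]: "\<And>n. gn n \<in> borel_measurable M" "g \<in> borel_measurable M"
    and g: "integrable M (\<lambda>x. (g x)\<^sup>2)" and d: "\<And>n. integrable M (\<lambda>x. (gn n x - g x)\<^sup>2)"
    and lim: "(\<lambda>n. \<integral>x. (gn n x - g x)\<^sup>2 \<partial>M) \<longlonglongrightarrow> 0"
  shows "\<And>n. integrable M (\<lambda>x. (gn n x)\<^sup>2)" and "(\<lambda>n. \<integral>x. (gn n x)\<^sup>2 \<partial>M) \<longlonglongrightarrow> (\<integral>x. (g x)\<^sup>2 \<partial>M)"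
proof -
  have sq: "a\<^sup>2 \<le> 2 * b\<^sup>2 + 2 * (a - b)\<^sup>2" for a b :: real
    using zero_le_power2[of "a - 2 * b"] by (simp add: power2_eq_square algebra_simps)
  show ig: "integrable M (\<lambda>x. (gn n x)\<^sup>2)" for n
  proof (rule Bochner_Integration.integrable_bound)
    show "integrable M (\<lambda>x. 2 * (g x)\<^sup>2 + 2 * (gn n x - g x)\<^sup>2)" using g d[of n] by simp
    show "AE x in M. norm ((gn n x)\<^sup>2) \<le> norm (2 * (g x)\<^sup>2 + 2 * (gn n x - g x)\<^sup>2)"
      by (rule AE_I2) (simp add: sq abs_of_nonneg)
  qed measurable
  show "(\<lambda>n. \<integral>x. (gn n x)\<^sup>2 \<partial>M) \<longlonglongrightarrow> (\<integral>x. (g x)\<^sup>2 \<partial>M)"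
  proof (rule LIMSEQ_I)
    fix e :: real assume e: "0 < e"
    define I where "I = (\<integral>x. (g x)\<^sup>2 \<partial>M)"
    have I0: "0 \<le> I" unfolding I_def by (intro Bochner_Integration.integral_nonneg) simp
    define \<tau> where "\<tau> = e / (2 * (I + 1))"
    have \<tau>: "0 < \<tau>" using e I0 by (simp add: \<tau>_def)
    have \<tau>I: "\<tau> * I < e / 2"
    proof -
      have "\<tau> * I < \<tau> * (I + 1)" using \<tau> by simp
      also have "\<dots> = e / 2"
      proof -
        have "e / (2 * D) * D = e / 2" if "0 < D" for D :: real using that by simp
        from this[of "I + 1"] show ?thesis unfolding \<tau>_def using I0 by simp
      qed
      finally show ?thesis .
    qed
    have c: "0 < 1 + 1 / \<tau>" using \<tau> by (simp add: add_pos_pos)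
    have "eventually (\<lambda>n. (\<integral>x. (gn n x - g x)\<^sup>2 \<partial>M) < e / 2 / (1 + 1 / \<tau>)) sequentially"
      by (rule order_tendstoD(2)[OF lim]) (use e c in simp)
    then obtain N where N: "\<And>n. N \<le> n \<Longrightarrow> (\<integral>x. (gn n x - g x)\<^sup>2 \<partial>M) < e / 2 / (1 + 1 / \<tau>)"
      unfolding eventually_sequentially by blast
    \<comment> \<open>expand the squares of \<open>\<tau> * b \<plusminus> (a - b)\<close>\<close>
    have pt: "\<bar>a\<^sup>2 - b\<^sup>2\<bar> \<le> \<tau> * b\<^sup>2 + (1 + 1 / \<tau>) * (a - b)\<^sup>2" for a b :: real
    proof -
      define d where "d = a - b"
      have "0 \<le> (\<tau> * b - d)\<^sup>2 / \<tau>" "0 \<le> (\<tau> * b + d)\<^sup>2 / \<tau>" using \<tau> by auto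
      then have "0 \<le> \<tau> * b\<^sup>2 - 2 * b * d + d\<^sup>2 / \<tau>" "0 \<le> \<tau> * b\<^sup>2 + 2 * b * d + d\<^sup>2 / \<tau>"
        using \<tau> by (simp_all add: power2_eq_square field_simps)
      moreover have "a\<^sup>2 - b\<^sup>2 = d\<^sup>2 + 2 * b * d" by (simp add: d_def power2_eq_square algebra_simps)
      moreover have "(1 + 1 / \<tau>) * d\<^sup>2 = d\<^sup>2 + d\<^sup>2 / \<tau>" by (simp add: algebra_simps)
      ultimately show ?thesis unfolding d_def[symmetric] using zero_le_power2[of d] by linarith
    qed
    show "\<exists>N. \<forall>n\<ge>N. norm ((\<integral>x. (gn n x)\<^sup>2 \<partial>M) - (\<integral>x. (g x)\<^sup>2 \<partial>M)) < e"
    proof (intro exI[of _ N] allI impI)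
      fix n assume n: "N \<le> n"
      have "norm ((\<integral>x. (gn n x)\<^sup>2 \<partial>M) - (\<integral>x. (g x)\<^sup>2 \<partial>M)) = \<bar>\<integral>x. (gn n x)\<^sup>2 - (g x)\<^sup>2 \<partial>M\<bar>"
        using ig[of n] g by simp
      also have "\<dots> \<le> (\<integral>x. \<bar>(gn n x)\<^sup>2 - (g x)\<^sup>2\<bar> \<partial>M)" by (rule integral_abs_bound)
      also have "\<dots> \<le> (\<integral>x. \<tau> * (g x)\<^sup>2 + (1 + 1 / \<tau>) * (gn n x - g x)\<^sup>2 \<partial>M)"
        by (intro integral_mono pt integrable_abs Bochner_Integration.integrable_diff Bochner_Integration.integrable_add
            integrable_mult_right ig g d)
      also have "\<dots> = \<tau> * I + (1 + 1 / \<tau>) * (\<integral>x. (gn n x - g x)\<^sup>2 \<partial>M)"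
        using g d[of n] by (simp add: I_def)
      also have "\<dots> < e / 2 + e / 2"
      proof (rule add_strict_mono[OF \<tau>I])
        have "(1 + 1 / \<tau>) * (\<integral>x. (gn n x - g x)\<^sup>2 \<partial>M) < (1 + 1 / \<tau>) * (e / 2 / (1 + 1 / \<tau>))"
          by (rule mult_strict_left_mono[OF N[OF n] c])
        also have "\<dots> = e / 2"
        proof -
          have "D * (y / D) = y" if "0 < D" for D y :: real using that by simp
          from this[OF c] show ?thesis .
        qed
        finally show "(1 + 1 / \<tau>) * (\<integral>x. (gn n x - g x)\<^sup>2 \<partial>M) < e / 2" .
      qed
      finally show "norm ((\<integral>x. (gn n x)\<^sup>2 \<partial>M) - (\<integral>x. (g x)\<^sup>2 \<partial>M)) < e" by simp
    qed
  qed
qed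

lemma (in prob_space) integrable_of_square:
  fixes X :: "'a \<Rightarrow> real"
  assumes [measurable]: "X \<in> borel_measurable M" and "integrable M (\<lambda>x. (X x)\<^sup>2)"
  shows "integrable M X"
proof (rule Bochner_Integration.integrable_bound)
  show "integrable M (\<lambda>x. 1 + (X x)\<^sup>2)" using assms by simp
  have "\<bar>a\<bar> \<le> 1 + a\<^sup>2" for a :: real
    using zero_le_power2[of "\<bar>a\<bar> - 1"] by (simp add: power2_diff)
  then show "AE x in M. norm (X x) \<le> norm (1 + (X x)\<^sup>2)" by (intro AE_I2) (simp add: abs_of_nonneg add_nonneg_nonneg)
qed simp

lemma (in prob_space) expectation_square_le:
  fixes X :: "'a \<Rightarrow> real"
  assumes X: "X \<in> borel_measurable M" "integrable M (\<lambda>x. (X x)\<^sup>2)"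
  shows "(\<integral>x. X x \<partial>M)\<^sup>2 \<le> (\<integral>x. (X x)\<^sup>2 \<partial>M)"
proof -
  have "0 \<le> variance X" by (rule variance_positive)
  then show ?thesis unfolding variance_eq[OF integrable_of_square[OF X] X(2)] by (simp only: diff_ge_0_iff_ge)
qed

lemma (in prob_space) L2_limit_expectation:
  fixes g :: "'a \<Rightarrow> real"
  assumes [measurable]: "\<And>n. gn n \<in> borel_measurable M" "g \<in> borel_measurable M"
    and g: "integrable M (\<lambda>x. (g x)\<^sup>2)" and d: "\<And>n. integrable M (\<lambda>x. (gn n x - g x)\<^sup>2)"
    and lim: "(\<lambda>n. \<integral>x. (gn n x - g x)\<^sup>2 \<partial>M) \<longlonglongrightarrow> 0"
  shows "(\<lambda>n. \<integral>x. gn n x \<partial>M) \<longlonglongrightarrow> (\<integral>x. g x \<partial>M)"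
proof -
  have i: "integrable M (gn n)" for n
    by (rule integrable_of_square[OF assms(1)], rule L2_limit_square(1)[OF assms(1,2) g d lim])
  have "(\<lambda>n. \<integral>x. gn n x - g x \<partial>M) \<longlonglongrightarrow> 0"
  proof (rule Lim_null_comparison)
    show "\<forall>\<^sub>F n in sequentially. norm (\<integral>x. gn n x - g x \<partial>M) \<le> sqrt (\<integral>x. (gn n x - g x)\<^sup>2 \<partial>M)"
    proof (intro always_eventually allI)
      fix n
      have "(\<integral>x. gn n x - g x \<partial>M)\<^sup>2 \<le> (\<integral>x. (gn n x - g x)\<^sup>2 \<partial>M)"
        by (rule expectation_square_le[OF _ d]) simp
      then show "norm (\<integral>x. gn n x - g x \<partial>M) \<le> sqrt (\<integral>x. (gn n x - g x)\<^sup>2 \<partial>M)"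
        by (simp add: real_le_rsqrt)
    qed
    show "(\<lambda>n. sqrt (\<integral>x. (gn n x - g x)\<^sup>2 \<partial>M)) \<longlonglongrightarrow> 0"
      using tendsto_real_sqrt[OF lim] by simp
  qed
  then have "(\<lambda>n. (\<integral>x. gn n x \<partial>M) - (\<integral>x. g x \<partial>M)) \<longlonglongrightarrow> 0"
    using i integrable_of_square[OF assms(2) g] by simp
  then show ?thesis by (rule LIM_zero_cancel)
qed

text \<open>Squaring the positive part makes this cutoff \<open>C\<^sup>1\<close>; its gradient is of size \<open>O(1/R)\<close>.\<close>
definition cutoff :: "real \<Rightarrow> real^'n \<Rightarrow> real" where
  "cutoff R x = (max 0 (1 - (x \<bullet> x) / R\<^sup>2))\<^sup>2"

definition cutoff_grad :: "real \<Rightarrow> real^'n \<Rightarrow> real^'n" where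
  "cutoff_grad R x = (- 4 * max 0 (1 - (x \<bullet> x) / R\<^sup>2) / R\<^sup>2) *\<^sub>R x"

lemma DERIV_max_0_square: "((\<lambda>t. (max 0 t)\<^sup>2) has_real_derivative 2 * max 0 t) (at (t::real))"
proof -
  consider "t < 0" | "t = 0" | "0 < t" by linarith
  then show ?thesis
  proof cases
    case 1
    have "((\<lambda>_. 0) has_real_derivative 0) (at t)" by simp
    then have "((\<lambda>t. (max 0 t)\<^sup>2) has_real_derivative 0) (at t)"
      by (rule has_field_derivative_transform_within_open[of _ _ _ "{..<0}"]) (use 1 in auto)
    then show ?thesis using 1 by simp
  next
    case 2
    have "((\<lambda>h::real. (max 0 h)\<^sup>2 / h) \<longlongrightarrow> 0) (at 0)"
    proof (rule Lim_null_comparison)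
      have "norm ((max 0 h)\<^sup>2 / h) \<le> \<bar>h\<bar>" for h :: real
        by (cases "h \<le> 0") (auto simp: max_def power2_eq_square)
      then show "\<forall>\<^sub>F h in at (0::real). norm ((max 0 h)\<^sup>2 / h) \<le> \<bar>h\<bar>" by (intro always_eventually allI)
      show "((\<lambda>h::real. \<bar>h\<bar>) \<longlongrightarrow> 0) (at 0)" by (rule tendsto_rabs_zero) (rule tendsto_ident_at)
    qed
    then show ?thesis using 2 by (simp add: DERIV_def)
  next
    case 3
    have "((\<lambda>t. t\<^sup>2) has_real_derivative 2 * t) (at t)" by (auto intro!: derivative_eq_intros)
    then have "((\<lambda>t. (max 0 t)\<^sup>2) has_real_derivative 2 * t) (at t)"
      by (rule has_field_derivative_transform_within_open[of _ _ _ "{0<..}"]) (use 3 in auto)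
    then show ?thesis using 3 by simp
  qed
qed

lemma cutoff_gderiv: "R \<noteq> 0 \<Longrightarrow> GDERIV (cutoff R) x :> cutoff_grad R x" for x :: "real^'n"
proof -
  assume R: "R \<noteq> 0"
  have q: "((\<lambda>x::real^'n. x \<bullet> x) has_derivative (\<lambda>v. 2 * (v \<bullet> x))) (at x)"
    by (auto intro!: derivative_eq_intros simp: inner_commute)
  have "((\<lambda>t. 1 - t / R\<^sup>2) has_real_derivative - (1 / R\<^sup>2)) (at t)" for t
    using DERIV_diff[OF DERIV_const[of 1] DERIV_cdivide[OF DERIV_ident, of "R\<^sup>2"]] by simp
  from DERIV_compose_FDERIV[OF DERIV_chain2[OF DERIV_max_0_square this] q]
  show ?thesis
    unfolding gderiv_def cutoff_def[abs_def] cutoff_grad_def by (simp add: mult_ac)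
qed

lemma cutoff_bounds: "0 \<le> cutoff R x" "cutoff R x \<le> 1"
proof -
  have "max 0 (1 - (x \<bullet> x) / R\<^sup>2) \<le> 1" by simp
  then show "cutoff R x \<le> 1" unfolding cutoff_def by (rule power_le_one[rotated]) simp
qed (simp add: cutoff_def)

lemma cutoff_support:
  assumes "0 < R" "x \<notin> cball 0 R" shows "cutoff R x = 0" "cutoff_grad R x = 0"
proof -
  have "R\<^sup>2 < (norm x)\<^sup>2" using assms by (intro power_strict_mono) auto
  then have "1 < (x \<bullet> x) / R\<^sup>2" using assms(1) by (simp add: power2_norm_eq_inner)
  then have "max 0 (1 - (x \<bullet> x) / R\<^sup>2) = 0" by (simp add: max_def)
  then show "cutoff R x = 0" "cutoff_grad R x = 0" unfolding cutoff_def cutoff_grad_def by auto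
qed

lemma cutoff_grad_bound:
  assumes "0 < R" shows "norm (cutoff_grad R x) \<le> 4 / R"
proof (cases "x \<in> cball 0 R")
  case True
  have "\<bar>max 0 (1 - (x \<bullet> x) / R\<^sup>2)\<bar> \<le> 1" by simp
  then have "4 * \<bar>max 0 (1 - (x \<bullet> x) / R\<^sup>2)\<bar> / R\<^sup>2 * norm x \<le> 4 * 1 / R\<^sup>2 * R"
    using True assms by (intro mult_mono divide_right_mono mult_left_mono) auto
  then show ?thesis using assms by (simp add: cutoff_grad_def abs_mult power2_eq_square)
next
  case False
  then show ?thesis using cutoff_support[OF assms False] assms by simp
qed

lemma cutoff_measurable[measurable]: "cutoff R \<in> borel_measurable borel" "cutoff_grad R \<in> borel_measurable borel"
  unfolding cutoff_def[abs_def] cutoff_grad_def[abs_def] divide_inverse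
  by (intro borel_measurable_continuous_onI continuous_intros)+

lemma cutoff_tendsto: "(\<lambda>k. cutoff (real (Suc k)) x) \<longlonglongrightarrow> 1"
proof -
  have "(\<lambda>k. (max 0 (1 - (x \<bullet> x) * (inverse (real (Suc k)))\<^sup>2))\<^sup>2) \<longlonglongrightarrow> (max 0 (1 - (x \<bullet> x) * 0\<^sup>2))\<^sup>2"
    by (intro tendsto_intros LIMSEQ_inverse_real_of_nat)
  then show ?thesis by (simp add: cutoff_def divide_inverse power_inverse)
qed

lemma mollify_bounded:
  fixes u :: "real^'n \<Rightarrow> real"
  assumes r: "0 < r" and u: "integrable lborel u"
  obtains B where "\<And>x. \<bar>mollify r u x\<bar> \<le> B"
proof -
  obtain B where B: "0 \<le> B" "\<And>z :: real^'n. \<bar>bump r z\<bar> \<le> B" "\<And>z :: real^'n. norm (bump_poly_grad 1 r z) \<le> B"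
    by (rule bump_poly_bounded[OF r, of 1]) blast
  let ?Z = "bump_mass r TYPE(real^'n)"
  have "\<bar>mollify r u x\<bar> \<le> (\<integral>y. \<bar>u y\<bar> * B \<partial>lborel) / ?Z" for x
  proof -
    have "\<bar>\<integral>y. u y * bump r (y - x) \<partial>lborel\<bar> \<le> (\<integral>y. \<bar>u y * bump r (y - x)\<bar> \<partial>lborel)" by (rule integral_abs_bound)
    also have "\<dots> \<le> (\<integral>y. \<bar>u y\<bar> * B \<partial>lborel)"
    proof (rule integral_mono)
      fix y show "\<bar>u y * bump r (y - x)\<bar> \<le> \<bar>u y\<bar> * B" unfolding abs_mult by (intro mult_left_mono B) auto
    qed (use integrable_mult_bump(1)[OF r u] u in auto)
    finally show ?thesis using bump_mass_pos[OF r, where 'n = 'n] by (simp add: mollify_def divide_right_mono)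
  qed
  with that show thesis by blast
qed

text \<open>Testing the weak gradient against a translated bump function shows that the mollification
  of a function has the mollification of its weak gradient as classical gradient, at points
  whose surrounding ball lies in the domain.\<close>
lemma mollify_grad_eq_mollify_weak_gradient:
  fixes f :: "real^'n \<Rightarrow> real"
  assumes wg: "weak_gradient \<Omega> f G" and r: "0 < r" and sub: "cball x r \<subseteq> K" "K \<subseteq> \<Omega>"
  shows "mollify_grad r (\<lambda>y. indicator K y * f y) x $ i = mollify r (\<lambda>y. indicator K y * G y $ i) x"
proof -
  let ?\<phi> = "\<lambda>y. bump r (y - x)" and ?D = "\<lambda>y. bump_poly_grad 1 r (y - x)"
  have out: "?\<phi> y = 0" "?D y = 0" if "y \<notin> cball x r" for y
  proof -
    have "y - x \<notin> cball 0 r" using that by (simp add: dist_norm norm_minus_commute)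
    from bump_poly_support[OF r this] show "?\<phi> y = 0" "?D y = 0" by (simp_all add: bump_poly_grad_def)
  qed
  have "test_function \<Omega> ?\<phi>" by (rule test_function_bump[OF r]) (use sub in blast)
  moreover have "\<forall>y. GDERIV ?\<phi> y :> ?D y" using GDERIV_translate[OF bump_poly_gderiv] by blast
  moreover have W: "test_function \<Omega> \<phi> \<Longrightarrow> \<forall>x. GDERIV \<phi> x :> D x \<Longrightarrow>
      (LINT y:\<Omega>|lborel. f y * D y $ i) = - (LINT y:\<Omega>|lborel. G y $ i * \<phi> y)" for \<phi> D
    using wg unfolding weak_gradient_def by (elim conjE) (erule allE, erule allE, erule allE, erule impE, assumption, erule impE, assumption)
  ultimately have "(LINT y:\<Omega>|lborel. f y * ?D y $ i) = - (LINT y:\<Omega>|lborel. G y $ i * ?\<phi> y)"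
    by (intro W[of ?\<phi> ?D])
  moreover have "(LINT y:\<Omega>|lborel. f y * ?D y $ i) = (\<integral>y. (indicator K y * f y) * ?D y $ i \<partial>lborel)"
    unfolding set_lebesgue_integral_def
  proof (intro Bochner_Integration.integral_cong refl)
    fix y show "indicator \<Omega> y *\<^sub>R (f y * ?D y $ i) = (indicator K y * f y) * ?D y $ i"
      using out(2)[of y] sub by (cases "y \<in> cball x r") (auto simp: indicator_def)
  qed
  moreover have "(LINT y:\<Omega>|lborel. G y $ i * ?\<phi> y) = (\<integral>y. (indicator K y * G y $ i) * ?\<phi> y \<partial>lborel)"
    unfolding set_lebesgue_integral_def
  proof (intro Bochner_Integration.integral_cong refl)
    fix y show "indicator \<Omega> y *\<^sub>R (G y $ i * ?\<phi> y) = (indicator K y * G y $ i) * ?\<phi> y"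
      using out(1)[of y] sub by (cases "y \<in> cball x r") (auto simp: indicator_def)
  qed
  ultimately show ?thesis by (simp add: mollify_grad_def mollify_def)
qed

text \<open>A small \<open>s\<close> keeps the constant of \<open>b\<close> close to 1 at the expense of \<open>a\<close>, which will be the small
  contribution of the gradient of a cutoff.\<close>
lemma norm_add_square_le:
  fixes a b :: "'a::real_inner"
  assumes s: "0 < s"
  shows "(norm (a + b))\<^sup>2 \<le> (1 + 1 / s) * (norm a)\<^sup>2 + (1 + s) * (norm b)\<^sup>2"
proof -
  have "(norm (a + b))\<^sup>2 \<le> (norm a + norm b)\<^sup>2" by (intro power_mono norm_triangle_ineq) auto
  also have "\<dots> = (norm a)\<^sup>2 + (norm b)\<^sup>2 + 2 * norm a * norm b" by (simp add: power2_sum)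
  also have "2 * norm a * norm b \<le> (norm a)\<^sup>2 / s + s * (norm b)\<^sup>2"
  proof -
    have "0 \<le> (norm a - s * norm b)\<^sup>2 / s" using s by simp
    then show ?thesis using s by (simp add: power2_eq_square field_simps)
  qed
  finally show ?thesis by (simp add: algebra_simps)
qed

context nataf_model
begin

lemma T_has_derivative:
  assumes a: "\<And>i s. (t i has_real_derivative a i s) (at s)"
  shows "(T has_derivative (\<lambda>v. \<chi> i. a i (x $ i) * v $ i)) (at x)"
  unfolding has_derivative_componentwise_within[of T]
proof
  fix b :: "real^'n" assume "b \<in> Basis"
  then obtain i where b: "b = axis i 1" by (auto simp: Basis_vec_def)
  have "((\<lambda>x. t i (x $ i)) has_derivative (\<lambda>v. v $ i * a i (x $ i))) (at x)"
    by (rule DERIV_compose_FDERIV[OF a]) (rule bounded_linear_imp_has_derivative[OF bounded_linear_vec_nth])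
  then show "((\<lambda>x. T x \<bullet> b) has_derivative (\<lambda>v. (\<chi> i. a i (x $ i) * v $ i) \<bullet> b)) (at x)"
    by (simp add: b inner_axis T_component mult.commute)
qed

lemma lambda_max_ge_1: "1 \<le> lambda_max \<Sigma>"
proof -
  have s: "transpose \<Sigma> = \<Sigma>" using spd by (simp add: symmetric_positive_definite_def)
  fix i :: 'n
  have "axis i 1 \<bullet> (\<Sigma> *v axis i 1) = 1" by (simp add: inner_axis' matrix_vector_mul_component[symmetric] matrix_vector_mult_basis column_def diag)
  then show "1 \<le> lambda_max \<Sigma>"
    using quadratic_form_le_lambda_max[OF s, of "axis i 1"] by (simp add: inner_axis')
qed

lemma integral_T:
  fixes F :: "real^'n \<Rightarrow> real"
  assumes [measurable]: "F \<in> borel_measurable borel"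
  shows "(\<integral>x. F (T x) \<partial>\<nu>) = (\<integral>y. F y \<partial>\<mu>)" "integrable \<nu> (\<lambda>x. F (T x)) \<longleftrightarrow> integrable \<mu> F"
proof -
  have "(\<integral>y. F y \<partial>\<mu>) = (\<integral>y. F y \<partial>distr \<nu> borel T)" by (rule arg_cong[OF mu_eq_distr])
  then show "(\<integral>x. F (T x) \<partial>\<nu>) = (\<integral>y. F y \<partial>\<mu>)" by (subst (asm) integral_distr) auto
  have "integrable \<mu> F \<longleftrightarrow> integrable (distr \<nu> borel T) F" by (rule arg_cong[OF mu_eq_distr])
  then show "integrable \<nu> (\<lambda>x. F (T x)) \<longleftrightarrow> integrable \<mu> F" by (subst (asm) integrable_distr_eq) auto
qed

lemma L2_mu_of_lborel:
  fixes w :: "nat \<Rightarrow> real^'n \<Rightarrow> real"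
  assumes K: "compact K" "K \<subseteq> \<Omega>"
    and w[measurable]: "\<And>n. w n \<in> borel_measurable borel"
    and lim: "(\<lambda>n. \<integral>\<^sup>+x. ennreal ((w n x)\<^sup>2) \<partial>lborel) \<longlonglongrightarrow> 0"
    and int: "\<And>n. integrable \<mu> (\<lambda>x. (indicator K x * w n x)\<^sup>2)"
  shows "(\<lambda>n. \<integral>x. (indicator K x * w n x)\<^sup>2 \<partial>\<mu>) \<longlonglongrightarrow> 0"
proof -
  have [measurable]: "K \<in> sets borel" using K by (simp add: borel_compact)
  obtain c where c: "0 < c"
    "\<And>u. u \<in> borel_measurable borel \<Longrightarrow> (\<And>x. x \<notin> K \<Longrightarrow> u x = 0) \<Longrightarrow> (\<integral>\<^sup>+x. u x \<partial>\<mu>) \<le> ennreal c * (\<integral>\<^sup>+x. u x \<partial>lborel)"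
    by (rule compare_lborel_mu[OF K]) blast
  have le: "(\<integral>\<^sup>+x. ennreal ((indicator K x * w n x)\<^sup>2) \<partial>\<mu>) \<le> ennreal c * (\<integral>\<^sup>+x. ennreal ((w n x)\<^sup>2) \<partial>lborel)" for n
  proof -
    have "(\<integral>\<^sup>+x. ennreal ((indicator K x * w n x)\<^sup>2) \<partial>\<mu>) \<le> ennreal c * (\<integral>\<^sup>+x. ennreal ((indicator K x * w n x)\<^sup>2) \<partial>lborel)"
      by (rule c(2)) auto
    also have "\<dots> \<le> ennreal c * (\<integral>\<^sup>+x. ennreal ((w n x)\<^sup>2) \<partial>lborel)"
      by (intro mult_left_mono nn_integral_mono ennreal_leI) (auto simp: indicator_def)
    finally show ?thesis .
  qed
  have "(\<lambda>n. ennreal c * (\<integral>\<^sup>+x. ennreal ((w n x)\<^sup>2) \<partial>lborel)) \<longlonglongrightarrow> ennreal c * 0"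
    by (intro ennreal_tendsto_cmult lim) simp
  then have l: "(\<lambda>n. ennreal c * (\<integral>\<^sup>+x. ennreal ((w n x)\<^sup>2) \<partial>lborel)) \<longlonglongrightarrow> 0" by (simp only: mult_zero_right)
  have "(\<lambda>n. \<integral>\<^sup>+x. ennreal ((indicator K x * w n x)\<^sup>2) \<partial>\<mu>) \<longlonglongrightarrow> 0"
    by (rule tendsto_sandwich[OF _ _ tendsto_const l]) (intro always_eventually allI zero_le le)+
  moreover have "(\<integral>\<^sup>+x. ennreal ((indicator K x * w n x)\<^sup>2) \<partial>\<mu>) = ennreal (\<integral>x. (indicator K x * w n x)\<^sup>2 \<partial>\<mu>)" for n
    by (rule nn_integral_eq_integral[OF int]) simp
  ultimately have l2: "(\<lambda>n. ennreal (\<integral>x. (indicator K x * w n x)\<^sup>2 \<partial>\<mu>)) \<longlonglongrightarrow> ennreal 0" by (simp only: ennreal_0)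
  show ?thesis by (rule tendsto_ennrealD[OF l2]) (simp_all add: always_eventually Bochner_Integration.integral_nonneg)
qed

lemma L2_lborel_of_mu:
  fixes w g :: "real^'n \<Rightarrow> real"
  assumes K: "compact K" "K \<subseteq> \<Omega>"
    and w[measurable]: "w \<in> borel_measurable borel" and z: "\<And>x. x \<notin> K \<Longrightarrow> w x = 0"
    and g: "integrable \<mu> g" "\<And>x. (w x)\<^sup>2 \<le> g x"
  shows "integrable lborel (\<lambda>x. (w x)\<^sup>2)" "integrable lborel w" "integrable \<mu> (\<lambda>x. (w x)\<^sup>2)"
proof -
  have [measurable]: "K \<in> sets borel" using K by (simp add: borel_compact)
  show m: "integrable \<mu> (\<lambda>x. (w x)\<^sup>2)"
  proof (rule Bochner_Integration.integrable_bound[OF g(1)])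
    show "AE x in \<mu>. norm ((w x)\<^sup>2) \<le> norm (g x)"
    proof (rule AE_I2)
      fix x show "norm ((w x)\<^sup>2) \<le> norm (g x)" using g(2)[of x] by simp
    qed
  qed measurable
  obtain c where c: "0 < c"
    "\<And>u. u \<in> borel_measurable borel \<Longrightarrow> (\<And>x. x \<notin> K \<Longrightarrow> u x = 0) \<Longrightarrow> (\<integral>\<^sup>+x. u x \<partial>lborel) \<le> ennreal c * (\<integral>\<^sup>+x. u x \<partial>\<mu>)"
    by (rule compare_lborel_mu[OF K]) blast
  have "(\<integral>\<^sup>+x. ennreal ((w x)\<^sup>2) \<partial>lborel) \<le> ennreal c * (\<integral>\<^sup>+x. ennreal ((w x)\<^sup>2) \<partial>\<mu>)"
    by (rule c(2)) (auto simp: z)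
  also have "\<dots> = ennreal c * ennreal (\<integral>x. (w x)\<^sup>2 \<partial>\<mu>)" by (subst nn_integral_eq_integral[OF m]) auto
  also have "\<dots> < \<infinity>" by (simp add: ennreal_mult_less_top)
  finally show i: "integrable lborel (\<lambda>x. (w x)\<^sup>2)" by (intro integrableI_nonneg) auto
  show "integrable lborel w"
  proof (rule Bochner_Integration.integrable_bound)
    show "integrable lborel (\<lambda>x. indicator K x + (w x)\<^sup>2)"
      using emeasure_compact_finite[OF K(1)] by (intro Bochner_Integration.integrable_add i integrable_real_indicator) auto
    have "\<bar>a\<bar> \<le> 1 + a\<^sup>2" for a :: real
      using zero_le_power2[of "\<bar>a\<bar> - 1"] by (simp add: power2_diff)
    then show "AE x in lborel. norm (w x) \<le> norm (indicator K x + (w x)\<^sup>2)"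
      using z by (intro AE_I2) (auto simp: indicator_def abs_of_nonneg add_nonneg_nonneg)
  qed simp
qed

lemma prob_nu: "prob_space \<nu>" by (rule prob_space_centered_normal[OF spd])

end

section \<open>From the normal distribution to the transported measure\<close>

lemma norm_square_eq_sum: "(norm v)\<^sup>2 = (\<Sum>i\<in>UNIV. (v $ i)\<^sup>2)" for v :: "real^'n"
  unfolding power2_norm_eq_inner inner_vec_def by (simp add: power2_eq_square)

context nataf_model
begin

text \<open>The cutoff times \<open>F \<circ> T\<close> has compact support, so the inequality for \<open>\<nu>\<close> applies to it. Its gradient
  is the sum of a term \<open>O(1/R)\<close> from the cutoff and of the gradient of \<open>F \<circ> T\<close>. As the derivative of \<open>T\<close>
  is diagonal with squared entries at most \<open>1 / \<kappa> i\<close>, the latter has squared norm at most \<open>m\<close> times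
  that of the gradient of \<open>F\<close>.\<close>
lemma poincare_cutoff_smooth:
  fixes F :: "real^'n \<Rightarrow> real" and DF :: "real^'n \<Rightarrow> real^'n"
  assumes R: "0 < R" and s: "0 < s" and m: "\<And>i. 1 / \<kappa> i \<le> m"
    and dF: "\<And>y. GDERIV F y :> DF y" and BF: "\<And>y. \<bar>F y\<bar> \<le> B1" and BDF: "\<And>y. norm (DF y) \<le> B2"
    and [measurable]: "DF \<in> borel_measurable borel"
  defines "K \<equiv> T ` cball 0 R"
  shows "(\<integral>x. (cutoff R x * F (T x))\<^sup>2 \<partial>\<nu>) - (\<integral>x. cutoff R x * F (T x) \<partial>\<nu>)\<^sup>2
    \<le> lambda_max \<Sigma> * ((1 + s) * m * (\<integral>y. indicator K y * (norm (DF y))\<^sup>2 \<partial>\<mu>)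
        + (1 + 1 / s) * (4 / R)\<^sup>2 * (\<integral>y. indicator K y * (F y)\<^sup>2 \<partial>\<mu>))"
proof -
  interpret N: prob_space \<nu> by (rule prob_nu)
  obtain a where a: "\<And>i s. (t i has_real_derivative a i s) (at s)" "\<And>i s. 0 < a i s" "\<And>i s. a i s \<le> 1 / sqrt (\<kappa> i)"
    and am[measurable]: "\<And>i. a i \<in> borel_measurable borel"
    by (rule T_coordinate_derivatives) blast
  have m0: "0 \<le> m" using m[of undefined] kappa_pos[of undefined] by (meson order_trans less_imp_le zero_less_divide_1_iff)
  have a2: "(a i r)\<^sup>2 \<le> m" for i r
  proof -
    have "(a i r)\<^sup>2 \<le> (1 / sqrt (\<kappa> i))\<^sup>2" by (intro power_mono a less_imp_le)
    also have "\<dots> = 1 / \<kappa> i" using kappa_pos[of i] by (simp add: power_divide)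
    finally show ?thesis using m[of i] by linarith
  qed
  \<comment> \<open>the gradient of \<open>F \<circ> T\<close>\<close>
  define H where "H x = (\<chi> i. a i (x $ i) * DF (T x) $ i)" for x
  define D where "D x = F (T x) *\<^sub>R cutoff_grad R x + cutoff R x *\<^sub>R H x" for x
  have dF': "(F has_derivative (\<lambda>v. v \<bullet> DF y)) (at y)" for y using dF[of y] by (simp add: gderiv_def)
  have cF: "continuous_on UNIV F" using dF' by (meson continuous_at_imp_continuous_on has_derivative_continuous)
  then have Fm[measurable]: "F \<in> borel_measurable borel" by (rule borel_measurable_continuous_onI)
  have Hm[measurable]: "H \<in> borel_measurable borel"
    unfolding H_def by (rule borel_measurable_vecI) (simp only: vec_lambda_beta, measurable)
  have Dm[measurable]: "D \<in> borel_measurable borel" unfolding D_def[abs_def] by measurable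
  have normH: "(norm (H x))\<^sup>2 \<le> m * (norm (DF (T x)))\<^sup>2" for x
  proof -
    have "(norm (H x))\<^sup>2 = (\<Sum>i\<in>UNIV. (a i (x $ i))\<^sup>2 * (DF (T x) $ i)\<^sup>2)"
      by (simp add: norm_square_eq_sum H_def power_mult_distrib)
    also have "\<dots> \<le> (\<Sum>i\<in>UNIV. m * (DF (T x) $ i)\<^sup>2)" by (intro sum_mono mult_right_mono a2) simp
    also have "\<dots> = m * (norm (DF (T x)))\<^sup>2"
      by (simp add: norm_square_eq_sum sum_distrib_left)
    finally show ?thesis .
  qed
  have gd: "GDERIV (\<lambda>x. cutoff R x * F (T x)) x :> D x" for x
  proof -
    have "((\<lambda>x. F (T x)) has_derivative (\<lambda>v. (\<chi> i. a i (x $ i) * v $ i) \<bullet> DF (T x))) (at x)"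
      by (rule has_derivative_compose[OF T_has_derivative[OF a(1)] dF'])
    moreover have "(\<chi> i. a i (x $ i) * v $ i) \<bullet> DF (T x) = v \<bullet> H x" for v
      by (simp add: inner_vec_def H_def mult_ac)
    ultimately have "GDERIV (\<lambda>x. F (T x)) x :> H x" by (simp add: gderiv_def)
    from GDERIV_mult[OF cutoff_gderiv[of R x] this] R show ?thesis by (simp add: D_def add.commute)
  qed
  have D0: "D x = 0" if "x \<notin> cball 0 R" for x using cutoff_support[OF R that] by (simp add: D_def)
  have bounds: "0 \<le> B1" "0 \<le> B2" using order_trans[OF abs_ge_zero BF] order_trans[OF norm_ge_zero BDF] by auto
  have n1: "norm (F (T x) *\<^sub>R cutoff_grad R x) \<le> \<bar>F (T x)\<bar> * (4 / R)" for x
    using mult_left_mono[OF cutoff_grad_bound[OF R, of x], of "\<bar>F (T x)\<bar>"] by simp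
  have n2: "norm (cutoff R x *\<^sub>R H x) \<le> norm (H x)" for x
    using cutoff_bounds[of R x] by (simp add: mult_left_le_one_le)
  have HB: "norm (H x) \<le> sqrt m * B2" for x
  proof -
    have "(norm (H x))\<^sup>2 \<le> m * B2\<^sup>2"
      by (rule order_trans[OF normH]) (intro mult_left_mono power_mono BDF m0 norm_ge_zero)
    also have "\<dots> = (sqrt m * B2)\<^sup>2" using m0 by (simp add: power_mult_distrib)
    finally have sq: "(norm (H x))\<^sup>2 \<le> (sqrt m * B2)\<^sup>2" .
    show ?thesis by (rule power2_le_imp_le[OF sq]) (intro mult_nonneg_nonneg real_sqrt_ge_zero m0 bounds)
  qed
  have DB: "norm (D x) \<le> B1 * (4 / R) + sqrt m * B2" for x
  proof -
    have "norm (D x) \<le> norm (F (T x) *\<^sub>R cutoff_grad R x) + norm (cutoff R x *\<^sub>R H x)"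
      unfolding D_def by (rule norm_triangle_ineq)
    also have "\<dots> \<le> B1 * (4 / R) + sqrt m * B2"
    proof (rule add_mono)
      show "norm (F (T x) *\<^sub>R cutoff_grad R x) \<le> B1 * (4 / R)"
        using n1[of x] mult_right_mono[OF BF[of "T x"], of "4 / R"] R by simp
      show "norm (cutoff R x *\<^sub>R H x) \<le> sqrt m * B2" using n2[of x] HB[of x] by linarith
    qed
    finally show ?thesis .
  qed
  have sym: "transpose \<Sigma> = \<Sigma>" using spd by (simp add: symmetric_positive_definite_def)
  let ?E = "\<lambda>y. (1 + s) * m * (indicator K y * (norm (DF y))\<^sup>2) + (1 + 1 / s) * (4 / R)\<^sup>2 * (indicator K y * (F y)\<^sup>2)"
  have s0: "0 \<le> 1 + 1 / s" "0 \<le> 1 + s" using s by (auto intro: add_nonneg_nonneg)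
  have Dsq: "(norm (D x))\<^sup>2 \<le> ?E (T x)" for x
  proof (cases "x \<in> cball 0 R")
    case True
    then have TK: "T x \<in> K" by (auto simp: K_def)
    have "(norm (D x))\<^sup>2 \<le> (1 + 1 / s) * (norm (F (T x) *\<^sub>R cutoff_grad R x))\<^sup>2 + (1 + s) * (norm (cutoff R x *\<^sub>R H x))\<^sup>2"
      unfolding D_def by (rule norm_add_square_le[OF s])
    also have "\<dots> \<le> (1 + 1 / s) * ((4 / R)\<^sup>2 * (F (T x))\<^sup>2) + (1 + s) * (m * (norm (DF (T x)))\<^sup>2)"
    proof (intro add_mono mult_left_mono s0)
      have "(norm (F (T x) *\<^sub>R cutoff_grad R x))\<^sup>2 \<le> (\<bar>F (T x)\<bar> * (4 / R))\<^sup>2"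
        by (intro power_mono n1 norm_ge_zero)
      then show "(norm (F (T x) *\<^sub>R cutoff_grad R x))\<^sup>2 \<le> (4 / R)\<^sup>2 * (F (T x))\<^sup>2"
        by (simp add: power_mult_distrib power_divide mult_ac)
      have "(norm (cutoff R x *\<^sub>R H x))\<^sup>2 \<le> (norm (H x))\<^sup>2" by (intro power_mono n2 norm_ge_zero)
      then show "(norm (cutoff R x *\<^sub>R H x))\<^sup>2 \<le> m * (norm (DF (T x)))\<^sup>2" using normH[of x] by linarith
    qed
    also have "\<dots> = ?E (T x)" using TK by simp
    finally show ?thesis .
  next
    case False
    then show ?thesis using D0[OF False] s0 m0 by (auto intro!: add_nonneg_nonneg mult_nonneg_nonneg)
  qed
  have cK: "compact K" unfolding K_def
  proof (rule compact_continuous_image)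
    obtain S where "homeomorphism UNIV \<Omega> T S" by (rule T_homeomorphism)
    then show "continuous_on (cball 0 R) T" by (auto simp: homeomorphism_def intro: continuous_on_subset)
  qed simp
  have [measurable]: "K \<in> sets borel" using cK by (simp add: borel_compact)
  interpret U: prob_space \<mu> by (rule prob)
  have iE1: "integrable \<mu> (\<lambda>y. indicator K y * (norm (DF y))\<^sup>2)"
    by (rule U.integrable_const_bound[of _ "B2\<^sup>2"])
       (auto intro!: AE_I2 power_mono BDF mult_left_le_one_le order_trans[OF mult_left_le_one_le] simp: indicator_def)
  have iE2: "integrable \<mu> (\<lambda>y. indicator K y * (F y)\<^sup>2)"
  proof (rule U.integrable_const_bound[of _ "B1\<^sup>2"])
    have "(F y)\<^sup>2 \<le> B1\<^sup>2" for y using power_mono[OF BF[of y], of 2] by simp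
    then show "AE y in \<mu>. norm (indicator K y * (F y)\<^sup>2) \<le> B1\<^sup>2" by (intro AE_I2) (auto simp: indicator_def)
  qed measurable
  have iE: "integrable \<mu> ?E" by (intro Bochner_Integration.integrable_add integrable_mult_right iE1 iE2)
  have Em: "?E \<in> borel_measurable borel" by measurable
  have "(\<integral>x. (cutoff R x * F (T x))\<^sup>2 \<partial>\<nu>) - (\<integral>x. cutoff R x * F (T x) \<partial>\<nu>)\<^sup>2 \<le> (\<integral>x. D x \<bullet> (\<Sigma> *v D x) \<partial>\<nu>)"
    by (rule gaussian_poincare[OF spd compact_cball[of 0 R] _ gd DB Dm]) (simp add: cutoff_support(1)[OF R])
  also have "\<dots> \<le> (\<integral>x. lambda_max \<Sigma> * ?E (T x) \<partial>\<nu>)"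
  proof (rule integral_mono')
    show "integrable \<nu> (\<lambda>x. lambda_max \<Sigma> * ?E (T x))"
      by (intro integrable_mult_right) (simp only: integral_T(2)[OF Em] iE)
    fix x
    have "D x \<bullet> (\<Sigma> *v D x) \<le> lambda_max \<Sigma> * (D x \<bullet> D x)" by (rule quadratic_form_le_lambda_max[OF sym])
    also have "\<dots> \<le> lambda_max \<Sigma> * ?E (T x)"
      using lambda_max_ge_1 Dsq[of x] by (intro mult_left_mono) (auto simp: power2_norm_eq_inner)
    finally show "D x \<bullet> (\<Sigma> *v D x) \<le> lambda_max \<Sigma> * ?E (T x)" .
    show "0 \<le> lambda_max \<Sigma> * ?E (T x)"
      using lambda_max_ge_1 order_trans[OF zero_le_power2 Dsq[of x]] by (intro mult_nonneg_nonneg) auto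
  qed
  also have "\<dots> = lambda_max \<Sigma> * (\<integral>x. ?E (T x) \<partial>\<nu>)" by (rule integral_mult_right_zero)
  also have "(\<integral>x. ?E (T x) \<partial>\<nu>) = (\<integral>y. ?E y \<partial>\<mu>)" by (rule integral_T(1)[OF Em])
  also have "(\<integral>y. ?E y \<partial>\<mu>) = (1 + s) * m * (\<integral>y. indicator K y * (norm (DF y))\<^sup>2 \<partial>\<mu>)
      + (1 + 1 / s) * (4 / R)\<^sup>2 * (\<integral>y. indicator K y * (F y)\<^sup>2 \<partial>\<mu>)"
    unfolding Bochner_Integration.integral_add[OF integrable_mult_right[OF iE1] integrable_mult_right[OF iE2]]
      integral_mult_right_zero ..
  finally show ?thesis .
qed

text \<open>The cutoff confines everything to the compact set \<open>K\<close>, the image of a ball. Mollifications of \<open>f\<close>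
  are smooth, have the mollified weak gradient as gradient on \<open>K\<close>, and converge in \<open>L\<^sup>2\<close> with respect
  to Lebesgue measure, hence on \<open>K\<close> also with respect to \<open>\<mu>\<close>.\<close>
lemma poincare_cutoff:
  fixes f :: "real^'n \<Rightarrow> real" and G :: "real^'n \<Rightarrow> real^'n"
  assumes R: "0 < R" and s: "0 < s" and m: "\<And>i. 1 / \<kappa> i \<le> m"
    and f[measurable]: "f \<in> borel_measurable borel" and f2: "integrable \<mu> (\<lambda>x. (f x)\<^sup>2)"
    and wg: "weak_gradient \<Omega> f G" and G2: "integrable \<mu> (\<lambda>x. (norm (G x))\<^sup>2)"
  shows "(\<integral>x. (cutoff R x * f (T x))\<^sup>2 \<partial>\<nu>) - (\<integral>x. cutoff R x * f (T x) \<partial>\<nu>)\<^sup>2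
    \<le> lambda_max \<Sigma> * ((1 + s) * m * (\<integral>y. (norm (G y))\<^sup>2 \<partial>\<mu>) + (1 + 1 / s) * (4 / R)\<^sup>2 * (\<integral>y. (f y)\<^sup>2 \<partial>\<mu>))"
proof -
  interpret N: prob_space \<nu> by (rule prob_nu)
  interpret U: prob_space \<mu> by (rule prob)
  have m0: "0 \<le> m" using m[of undefined] kappa_pos[of undefined] by (meson order_trans less_imp_le zero_less_divide_1_iff)
  have s0: "0 \<le> 1 + 1 / s" "0 \<le> 1 + s" using s by (auto intro: add_nonneg_nonneg)
  define K where "K = T ` cball 0 R"
  obtain S where S: "homeomorphism UNIV \<Omega> T S" by (rule T_homeomorphism)
  have cK: "compact K" unfolding K_def
    using S by (intro compact_continuous_image) (auto simp: homeomorphism_def intro: continuous_on_subset)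
  have KO: "K \<subseteq> \<Omega>" unfolding K_def using T_in by blast
  have KT: "T x \<in> K \<longleftrightarrow> x \<in> cball 0 R" for x
  proof -
    have "S (T y) = y" for y using S by (simp add: homeomorphism_def)
    then have "T x = T y \<Longrightarrow> x = y" for y by metis
    then show ?thesis by (auto simp: K_def)
  qed
  obtain e where e: "0 < e" "(\<Union>x\<in>K. cball x e) \<subseteq> \<Omega>"
    by (rule compact_subset_open_imp_cball_epsilon_subset[OF cK open_domain KO])
  \<comment> \<open>room around \<open>K\<close> for the mollification\<close>
  define K' where "K' = thicken e K"
  have cK': "compact K'" unfolding K'_def by (rule compact_thicken[OF cK])
  have K'O: "K' \<subseteq> \<Omega>" using e(2) by (auto simp: K'_def thicken_iff)
  have KK': "K \<subseteq> K'" unfolding K'_def subset_iff thicken_iff using e(1) by (metis dist_self less_imp_le)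
  have [measurable]: "K \<in> sets borel" "K' \<in> sets borel" using cK cK' by (auto simp: borel_compact)
  define u where "u y = indicator K' y * f y" for y
  define U where "U i y = indicator K' y * G y $ i" for i y
  have um[measurable]: "u \<in> borel_measurable borel" unfolding u_def[abs_def] by measurable
  have Um[measurable]: "U i \<in> borel_measurable borel" for i
  proof -
    have "set_integrable lborel K' G"
      using wg cK' K'O unfolding weak_gradient_def locally_integrable_on_def by blast
    then have "(\<lambda>y. indicator K' y *\<^sub>R G y) \<in> borel_measurable borel"
      unfolding set_integrable_def by (simp add: borel_measurable_integrable[of lborel, simplified])
    from borel_measurable_vec_nth[OF this, of i] show ?thesis by (simp add: U_def[abs_def])
  qed
  have u2: "(u x)\<^sup>2 \<le> (f x)\<^sup>2" for x by (simp add: u_def indicator_def)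
  have U2: "(U i x)\<^sup>2 \<le> (norm (G x))\<^sup>2" for i x
  proof -
    have "\<bar>G x $ i\<bar> \<le> \<bar>norm (G x)\<bar>" using component_le_norm_cart[of "G x" i] by simp
    then have "(G x $ i)\<^sup>2 \<le> (norm (G x))\<^sup>2" by (simp only: abs_le_square_iff)
    then show ?thesis by (simp add: U_def indicator_def)
  qed
  have u0: "u x = 0" if "x \<notin> K'" for x using that by (simp add: u_def)
  have U0: "U i x = 0" if "x \<notin> K'" for i x using that by (simp add: U_def)
  have Lu: "integrable lborel (\<lambda>x. (u x)\<^sup>2)" "integrable lborel u" "integrable \<mu> (\<lambda>x. (u x)\<^sup>2)"
    by (rule L2_lborel_of_mu[OF cK' K'O um _ f2 u2]; erule u0)+
  have LU: "integrable lborel (\<lambda>x. (U i x)\<^sup>2)" "integrable lborel (U i)" "integrable \<mu> (\<lambda>x. (U i x)\<^sup>2)" for i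
    by (rule L2_lborel_of_mu[OF cK' K'O Um _ G2 U2]; erule U0)+
  \<comment> \<open>radii tending to 0 that keep the mollification on \<open>K\<close> inside \<open>K'\<close>\<close>
  define r where "r n = e * inverse (real (Suc n))" for n
  have r: "0 < r n" "r n \<le> e" for n
  proof -
    show "0 < r n" using e(1) by (simp add: r_def)
    have "inverse (real (Suc n)) \<le> 1" by (simp add: inverse_le_1_iff)
    then show "r n \<le> e" unfolding r_def using e(1) mult_left_mono[of "inverse (real (Suc n))" 1 e] by simp
  qed
  have r0: "r \<longlonglongrightarrow> 0"
    using tendsto_mult[OF tendsto_const[of e] LIMSEQ_inverse_real_of_nat] by (simp add: r_def[abs_def])
  define F where "F n = mollify (r n) u" for n
  have Fm[measurable]: "F n \<in> borel_measurable borel" for n unfolding F_def by measurable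
  have grad: "mollify_grad (r n) u x $ i = mollify (r n) (U i) x" if "x \<in> K" for n x i
    unfolding u_def[abs_def] U_def[abs_def]
  proof (rule mollify_grad_eq_mollify_weak_gradient[OF wg r(1) _ K'O])
    show "cball x (r n) \<subseteq> K'" unfolding K'_def subset_iff thicken_iff
      using that r(2)[of n] by (auto intro!: bexI[of _ x])
  qed
  have conv_u: "(\<lambda>n. \<integral>\<^sup>+x. ennreal ((mollify (r n) u x - u x)\<^sup>2) \<partial>lborel) \<longlonglongrightarrow> 0"
    by (rule mollify_L2_convergence[OF um Lu(2,1) cK' _ r(1) r0]) (erule u0)
  have conv_U: "(\<lambda>n. \<integral>\<^sup>+x. ennreal ((mollify (r n) (U i) x - U i x)\<^sup>2) \<partial>lborel) \<longlonglongrightarrow> 0" for i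
    by (rule mollify_L2_convergence[OF Um LU(2,1) cK' _ r(1) r0]) (erule U0)
  have sq_bounded: "integrable \<mu> (\<lambda>x. (indicator K x * mollify (r n) w x)\<^sup>2)" if w[measurable]: "w \<in> borel_measurable borel" and w1: "integrable lborel w" for n w
  proof -
    obtain B where B: "\<And>x. \<bar>mollify (r n) w x\<bar> \<le> B" by (rule mollify_bounded[OF r(1) w1]) blast
    have "(mollify (r n) w x)\<^sup>2 \<le> B\<^sup>2" for x using power_mono[OF B[of x], of 2] by simp
    then show ?thesis by (intro U.integrable_const_bound[of _ "B\<^sup>2"]) (auto intro!: AE_I2 simp: indicator_def)
  qed
  have sqdiff: "integrable \<mu> (\<lambda>x. (indicator K x * (mollify (r n) w x - w x))\<^sup>2)"
    if w[measurable]: "w \<in> borel_measurable borel" and "integrable lborel w" "integrable \<mu> (\<lambda>x. (w x)\<^sup>2)" for n w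
  proof (rule Bochner_Integration.integrable_bound)
    show "integrable \<mu> (\<lambda>x. 2 * (indicator K x * mollify (r n) w x)\<^sup>2 + 2 * (w x)\<^sup>2)"
      using sq_bounded[OF that(1,2), of n] that(3) by simp
    have sq: "(p - q)\<^sup>2 \<le> 2 * p\<^sup>2 + 2 * q\<^sup>2" for p q :: real
      using zero_le_power2[of "p + q"] by (simp add: power2_eq_square algebra_simps)
    show "AE x in \<mu>. norm ((indicator K x * (mollify (r n) w x - w x))\<^sup>2) \<le> norm (2 * (indicator K x * mollify (r n) w x)\<^sup>2 + 2 * (w x)\<^sup>2)"
      by (rule AE_I2) (auto simp: indicator_def sq abs_of_nonneg)
  qed measurable
  have lim: "(\<lambda>n. \<integral>x. (indicator K x * mollify (r n) w x - indicator K x * w x)\<^sup>2 \<partial>\<mu>) \<longlonglongrightarrow> 0"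
    and limsq: "(\<lambda>n. \<integral>x. (indicator K x * mollify (r n) w x)\<^sup>2 \<partial>\<mu>) \<longlonglongrightarrow> (\<integral>x. (indicator K x * w x)\<^sup>2 \<partial>\<mu>)"
    if w[measurable]: "w \<in> borel_measurable borel" and w1: "integrable lborel w" and w2: "integrable \<mu> (\<lambda>x. (w x)\<^sup>2)"
      and conv: "(\<lambda>n. \<integral>\<^sup>+x. ennreal ((mollify (r n) w x - w x)\<^sup>2) \<partial>lborel) \<longlonglongrightarrow> 0" for w
  proof -
    have "(\<lambda>n. \<integral>x. (indicator K x * (mollify (r n) w x - w x))\<^sup>2 \<partial>\<mu>) \<longlonglongrightarrow> 0"
      by (rule L2_mu_of_lborel[OF cK KO _ conv sqdiff[OF w w1 w2]]) measurable
    then show l: "(\<lambda>n. \<integral>x. (indicator K x * mollify (r n) w x - indicator K x * w x)\<^sup>2 \<partial>\<mu>) \<longlonglongrightarrow> 0"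
      by (simp only: right_diff_distrib)
    show "(\<lambda>n. \<integral>x. (indicator K x * mollify (r n) w x)\<^sup>2 \<partial>\<mu>) \<longlonglongrightarrow> (\<integral>x. (indicator K x * w x)\<^sup>2 \<partial>\<mu>)"
    proof (rule L2_limit_square(2)[OF _ _ _ _ l])
      show "integrable \<mu> (\<lambda>x. (indicator K x * w x)\<^sup>2)"
        by (rule Bochner_Integration.integrable_bound[OF w2]) (auto intro!: AE_I2 simp: indicator_def)
      show "integrable \<mu> (\<lambda>x. (indicator K x * mollify (r n) w x - indicator K x * w x)\<^sup>2)" for n
        using sqdiff[OF w w1 w2, of n] by (simp only: right_diff_distrib)
    qed measurable
  qed
  define h where "h n x = cutoff R x * F n (T x)" for n x
  define h0 where "h0 x = cutoff R x * f (T x)" for x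
  have hm[measurable]: "h n \<in> borel_measurable \<nu>" "h0 \<in> borel_measurable \<nu>" for n
    unfolding h_def[abs_def] h0_def[abs_def] by measurable
  have fT2: "integrable \<nu> (\<lambda>x. (f (T x))\<^sup>2)" using f2 integral_T(2)[of "\<lambda>y. (f y)\<^sup>2"] by simp
  have h02: "integrable \<nu> (\<lambda>x. (h0 x)\<^sup>2)"
  proof (rule Bochner_Integration.integrable_bound[OF fT2])
    have "(cutoff R x)\<^sup>2 \<le> 1" for x :: "real^'n" using cutoff_bounds[of R x] by (simp add: power_le_one)
    then show "AE x in \<nu>. norm ((h0 x)\<^sup>2) \<le> norm ((f (T x))\<^sup>2)"
      by (intro AE_I2) (simp add: h0_def power_mult_distrib mult_left_le_one_le)
  qed measurable
  have hd_le: "(h n x - h0 x)\<^sup>2 \<le> (indicator K (T x) * F n (T x) - indicator K (T x) * u (T x))\<^sup>2" for n x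
  proof (cases "x \<in> cball 0 R")
    case True
    then have TK: "T x \<in> K" by (simp add: KT)
    have "h n x - h0 x = cutoff R x * (F n (T x) - u (T x))"
      using TK KK' by (auto simp: h_def h0_def u_def algebra_simps)
    moreover have "(cutoff R x)\<^sup>2 \<le> 1" using cutoff_bounds[of R x] by (simp add: power_le_one)
    ultimately show ?thesis using TK by (simp add: power_mult_distrib mult_left_le_one_le)
  next
    case False
    then show ?thesis using cutoff_support(1)[OF R False] by (simp add: h_def h0_def)
  qed
  have iF: "integrable \<mu> (\<lambda>x. (indicator K x * F n x - indicator K x * u x)\<^sup>2)" for n
    using sqdiff[OF um Lu(2,3), of n] by (simp only: F_def right_diff_distrib)
  have iFT: "integrable \<nu> (\<lambda>x. (indicator K (T x) * F n (T x) - indicator K (T x) * u (T x))\<^sup>2)" for n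
    using iF[of n] integral_T(2)[of "\<lambda>x. (indicator K x * F n x - indicator K x * u x)\<^sup>2"] by simp
  have hd: "integrable \<nu> (\<lambda>x. (h n x - h0 x)\<^sup>2)" for n
    by (rule Bochner_Integration.integrable_bound[OF iFT[of n]]) (auto intro!: AE_I2 hd_le)
  have hlim: "(\<lambda>n. \<integral>x. (h n x - h0 x)\<^sup>2 \<partial>\<nu>) \<longlonglongrightarrow> 0"
  proof (rule tendsto_sandwich[OF _ _ tendsto_const lim[OF um Lu(2,3) conv_u]])
    show "\<forall>\<^sub>F n in sequentially. 0 \<le> (\<integral>x. (h n x - h0 x)\<^sup>2 \<partial>\<nu>)"
      by (intro always_eventually allI Bochner_Integration.integral_nonneg) simp
    show "\<forall>\<^sub>F n in sequentially. (\<integral>x. (h n x - h0 x)\<^sup>2 \<partial>\<nu>) \<le> (\<integral>x. (indicator K x * mollify (r n) u x - indicator K x * u x)\<^sup>2 \<partial>\<mu>)"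
    proof (intro always_eventually allI)
      fix n
      have "(\<integral>x. (h n x - h0 x)\<^sup>2 \<partial>\<nu>) \<le> (\<integral>x. (indicator K (T x) * F n (T x) - indicator K (T x) * u (T x))\<^sup>2 \<partial>\<nu>)"
        by (rule integral_mono[OF hd iFT hd_le])
      also have "\<dots> = (\<integral>x. (indicator K x * F n x - indicator K x * u x)\<^sup>2 \<partial>\<mu>)"
        using integral_T(1)[of "\<lambda>x. (indicator K x * F n x - indicator K x * u x)\<^sup>2"] by simp
      finally show "(\<integral>x. (h n x - h0 x)\<^sup>2 \<partial>\<nu>) \<le> (\<integral>x. (indicator K x * mollify (r n) u x - indicator K x * u x)\<^sup>2 \<partial>\<mu>)"
        by (simp only: F_def)
    qed
  qed
  have var_lim: "(\<lambda>n. (\<integral>x. (h n x)\<^sup>2 \<partial>\<nu>) - (\<integral>x. h n x \<partial>\<nu>)\<^sup>2) \<longlonglongrightarrow> (\<integral>x. (h0 x)\<^sup>2 \<partial>\<nu>) - (\<integral>x. h0 x \<partial>\<nu>)\<^sup>2"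
    by (intro tendsto_diff tendsto_power L2_limit_square(2)[OF hm h02 hd hlim] N.L2_limit_expectation[OF hm h02 hd hlim])
  have var_le: "(\<integral>x. (h n x)\<^sup>2 \<partial>\<nu>) - (\<integral>x. h n x \<partial>\<nu>)\<^sup>2
    \<le> lambda_max \<Sigma> * ((1 + s) * m * (\<Sum>i\<in>UNIV. \<integral>y. (indicator K y * mollify (r n) (U i) y)\<^sup>2 \<partial>\<mu>)
        + (1 + 1 / s) * (4 / R)\<^sup>2 * (\<integral>y. (indicator K y * mollify (r n) u y)\<^sup>2 \<partial>\<mu>))" for n
  proof -
    obtain B1 where B1: "\<And>x. \<bar>F n x\<bar> \<le> B1" unfolding F_def by (rule mollify_bounded[OF r(1) Lu(2)]) blast
    obtain B2 where B2: "\<And>x. norm (mollify_grad (r n) u x) \<le> B2" by (rule mollify_grad_bounded[OF r(1) Lu(2)]) blast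
    have 1: "(\<integral>y. indicator K y * (norm (mollify_grad (r n) u y))\<^sup>2 \<partial>\<mu>) = (\<Sum>i\<in>UNIV. \<integral>y. (indicator K y * mollify (r n) (U i) y)\<^sup>2 \<partial>\<mu>)"
    proof -
      have "(\<integral>y. indicator K y * (norm (mollify_grad (r n) u y))\<^sup>2 \<partial>\<mu>) = (\<integral>y. (\<Sum>i\<in>UNIV. (indicator K y * mollify (r n) (U i) y)\<^sup>2) \<partial>\<mu>)"
      proof (rule Bochner_Integration.integral_cong[OF refl])
        fix y show "indicator K y * (norm (mollify_grad (r n) u y))\<^sup>2 = (\<Sum>i\<in>UNIV. (indicator K y * mollify (r n) (U i) y)\<^sup>2)"
          by (cases "y \<in> K") (simp_all add: norm_square_eq_sum grad)
      qed
      also have "\<dots> = (\<Sum>i\<in>UNIV. \<integral>y. (indicator K y * mollify (r n) (U i) y)\<^sup>2 \<partial>\<mu>)"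
        by (rule Bochner_Integration.integral_sum) (rule sq_bounded[OF Um LU(2)])
      finally show ?thesis .
    qed
    have 2: "(\<integral>y. indicator K y * (F n y)\<^sup>2 \<partial>\<mu>) = (\<integral>y. (indicator K y * mollify (r n) u y)\<^sup>2 \<partial>\<mu>)"
      by (rule Bochner_Integration.integral_cong[OF refl]) (simp add: indicator_def F_def)
    have gF: "GDERIV (F n) y :> mollify_grad (r n) u y" for y
      unfolding F_def by (rule mollify_gderiv[OF r(1) Lu(2)])
    show ?thesis
      using poincare_cutoff_smooth[OF R s m gF B1 B2 mollify_grad_measurable[OF um]]
      unfolding h_def K_def[symmetric] 1 2 .
  qed
  have "(\<integral>x. (h0 x)\<^sup>2 \<partial>\<nu>) - (\<integral>x. h0 x \<partial>\<nu>)\<^sup>2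
    \<le> lambda_max \<Sigma> * ((1 + s) * m * (\<Sum>i\<in>UNIV. \<integral>y. (indicator K y * U i y)\<^sup>2 \<partial>\<mu>)
        + (1 + 1 / s) * (4 / R)\<^sup>2 * (\<integral>y. (indicator K y * u y)\<^sup>2 \<partial>\<mu>))"
  proof (rule LIMSEQ_le[OF var_lim])
    show "(\<lambda>n. lambda_max \<Sigma> * ((1 + s) * m * (\<Sum>i\<in>UNIV. \<integral>y. (indicator K y * mollify (r n) (U i) y)\<^sup>2 \<partial>\<mu>)
        + (1 + 1 / s) * (4 / R)\<^sup>2 * (\<integral>y. (indicator K y * mollify (r n) u y)\<^sup>2 \<partial>\<mu>)))
      \<longlonglongrightarrow> lambda_max \<Sigma> * ((1 + s) * m * (\<Sum>i\<in>UNIV. \<integral>y. (indicator K y * U i y)\<^sup>2 \<partial>\<mu>)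
        + (1 + 1 / s) * (4 / R)\<^sup>2 * (\<integral>y. (indicator K y * u y)\<^sup>2 \<partial>\<mu>))"
      by (intro tendsto_mult tendsto_add tendsto_const tendsto_sum limsq[OF um Lu(2,3) conv_u] limsq[OF Um LU(2,3) conv_U])
  qed (use var_le in blast)
  also have "\<dots> \<le> lambda_max \<Sigma> * ((1 + s) * m * (\<integral>y. (norm (G y))\<^sup>2 \<partial>\<mu>) + (1 + 1 / s) * (4 / R)\<^sup>2 * (\<integral>y. (f y)\<^sup>2 \<partial>\<mu>))"
  proof (intro mult_left_mono add_mono)
    have iKU: "integrable \<mu> (\<lambda>y. (indicator K y * U i y)\<^sup>2)" for i
      by (rule Bochner_Integration.integrable_bound[OF LU(3)]) (auto intro!: AE_I2 simp: indicator_def)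
    have "(\<Sum>i\<in>UNIV. \<integral>y. (indicator K y * U i y)\<^sup>2 \<partial>\<mu>) = (\<integral>y. (\<Sum>i\<in>UNIV. (indicator K y * U i y)\<^sup>2) \<partial>\<mu>)"
      by (rule Bochner_Integration.integral_sum[symmetric]) (rule iKU)
    also have "\<dots> \<le> (\<integral>y. (norm (G y))\<^sup>2 \<partial>\<mu>)"
    proof (rule integral_mono)
      fix y
      have "(\<Sum>i\<in>UNIV. (indicator K y * U i y)\<^sup>2) \<le> (\<Sum>i\<in>UNIV. (G y $ i)\<^sup>2)"
        by (intro sum_mono) (simp add: U_def indicator_def)
      also have "\<dots> = (norm (G y))\<^sup>2" by (simp add: norm_square_eq_sum)
      finally show "(\<Sum>i\<in>UNIV. (indicator K y * U i y)\<^sup>2) \<le> (norm (G y))\<^sup>2" .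
    qed (use iKU G2 in auto)
    finally show "(\<Sum>i\<in>UNIV. \<integral>y. (indicator K y * U i y)\<^sup>2 \<partial>\<mu>) \<le> (\<integral>y. (norm (G y))\<^sup>2 \<partial>\<mu>)" .
    show "(\<integral>y. (indicator K y * u y)\<^sup>2 \<partial>\<mu>) \<le> (\<integral>y. (f y)\<^sup>2 \<partial>\<mu>)"
    proof (rule integral_mono[OF _ f2])
      show "integrable \<mu> (\<lambda>y. (indicator K y * u y)\<^sup>2)"
        by (rule Bochner_Integration.integrable_bound[OF Lu(3)]) (auto intro!: AE_I2 simp: indicator_def)
      fix y show "(indicator K y * u y)\<^sup>2 \<le> (f y)\<^sup>2" by (simp add: u_def indicator_def)
    qed
  qed (use m0 s0 lambda_max_ge_1 in \<open>auto intro!: mult_nonneg_nonneg\<close>)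
  finally show ?thesis unfolding h0_def .
qed

text \<open>Let the radius \<open>R\<close> of the cutoff tend to infinity with \<open>s = 1 / R\<close>: then \<open>s\<close> and the factor
  \<open>(1 + 1 / s) * (4 / R)\<^sup>2\<close> both tend to 0.\<close>
theorem poincare_inequality_nataf:
  assumes m: "\<And>i. 1 / \<kappa> i \<le> m"
  shows "poincare_inequality \<Omega> \<mu> (lambda_max \<Sigma> * m)"
  unfolding poincare_inequality_def
proof (intro allI impI)
  fix f :: "real^'n \<Rightarrow> real" and G
  assume f: "f \<in> borel_measurable \<mu>" and f2: "integrable \<mu> (\<lambda>x. (f x)\<^sup>2)" and wg: "weak_gradient \<Omega> f G"
    and G2: "integrable \<mu> (\<lambda>x. (norm (G x))\<^sup>2)"
  have fm[measurable]: "f \<in> borel_measurable borel" using f by (simp add: measurable_cong_sets[OF sets_mu refl])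
  interpret N: prob_space \<nu> by (rule prob_nu)
  let ?A = "\<integral>y. (norm (G y))\<^sup>2 \<partial>\<mu>" and ?B = "\<integral>y. (f y)\<^sup>2 \<partial>\<mu>"
  let ?q = "\<lambda>k. inverse (real (Suc k))"
  let ?h = "\<lambda>k x. cutoff (real (Suc k)) x * f (T x)"
  have fT2: "integrable \<nu> (\<lambda>x. (f (T x))\<^sup>2)" using f2 integral_T(2)[of "\<lambda>y. (f y)\<^sup>2"] by simp
  have fT1: "integrable \<nu> (\<lambda>x. f (T x))" by (rule N.integrable_of_square[OF _ fT2]) measurable
  have le: "(\<integral>x. (?h k x)\<^sup>2 \<partial>\<nu>) - (\<integral>x. ?h k x \<partial>\<nu>)\<^sup>2
      \<le> lambda_max \<Sigma> * ((1 + ?q k) * m * ?A + 16 * ((?q k)\<^sup>2 + ?q k) * ?B)" for k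
  proof -
    have R: "0 < real (Suc k)" and q: "0 < ?q k" by simp_all
    have "(1 + 1 / ?q k) * (4 / real (Suc k))\<^sup>2 = 16 * ((?q k)\<^sup>2 + ?q k)"
    proof -
      have "(1 + D) * (4 / D)\<^sup>2 = 16 * ((inverse D)\<^sup>2 + inverse D)" if "0 < D" for D :: real
        using that by (simp add: power2_eq_square field_simps)
      from this[OF R] show ?thesis by (simp only: inverse_eq_divide div_by_1 divide_divide_eq_right mult_1)
    qed
    with poincare_cutoff[OF R q m fm f2 wg G2] show ?thesis by (simp only:)
  qed
  have l1: "(\<lambda>k. \<integral>x. (?h k x)\<^sup>2 \<partial>\<nu>) \<longlonglongrightarrow> (\<integral>x. (f (T x))\<^sup>2 \<partial>\<nu>)"
  proof (rule integral_dominated_convergence[OF _ _ fT2])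
    show "AE x in \<nu>. (\<lambda>k. (?h k x)\<^sup>2) \<longlonglongrightarrow> (f (T x))\<^sup>2"
    proof (rule AE_I2)
      fix x
      have "(\<lambda>k. (?h k x)\<^sup>2) \<longlonglongrightarrow> (1 * f (T x))\<^sup>2" by (intro tendsto_power tendsto_mult tendsto_const cutoff_tendsto)
      then show "(\<lambda>k. (?h k x)\<^sup>2) \<longlonglongrightarrow> (f (T x))\<^sup>2" by simp
    qed
    show "AE x in \<nu>. norm ((?h k x)\<^sup>2) \<le> (f (T x))\<^sup>2" for k
    proof (rule AE_I2)
      fix x :: "real^'n"
      have "(cutoff (real (Suc k)) x)\<^sup>2 \<le> 1" using cutoff_bounds[of "real (Suc k)" x] by (simp add: power_le_one)
      then show "norm ((?h k x)\<^sup>2) \<le> (f (T x))\<^sup>2" by (simp add: power_mult_distrib mult_left_le_one_le)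
    qed
  qed measurable
  have l2: "(\<lambda>k. \<integral>x. ?h k x \<partial>\<nu>) \<longlonglongrightarrow> (\<integral>x. f (T x) \<partial>\<nu>)"
  proof (rule integral_dominated_convergence[where w = "\<lambda>x. \<bar>f (T x)\<bar>"])
    show "integrable \<nu> (\<lambda>x. \<bar>f (T x)\<bar>)" using fT1 by simp
    show "AE x in \<nu>. (\<lambda>k. ?h k x) \<longlonglongrightarrow> f (T x)"
    proof (rule AE_I2)
      fix x
      have "(\<lambda>k. ?h k x) \<longlonglongrightarrow> 1 * f (T x)" by (intro tendsto_mult tendsto_const cutoff_tendsto)
      then show "(\<lambda>k. ?h k x) \<longlonglongrightarrow> f (T x)" by simp
    qed
    show "AE x in \<nu>. norm (?h k x) \<le> \<bar>f (T x)\<bar>" for k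
      by (rule AE_I2) (simp add: abs_mult mult_left_le_one_le cutoff_bounds)
  qed measurable
  have "(\<integral>x. (f (T x))\<^sup>2 \<partial>\<nu>) - (\<integral>x. f (T x) \<partial>\<nu>)\<^sup>2 \<le> lambda_max \<Sigma> * ((1 + 0) * m * ?A + 16 * (0\<^sup>2 + 0) * ?B)"
  proof (rule LIMSEQ_le)
    show "(\<lambda>k. (\<integral>x. (?h k x)\<^sup>2 \<partial>\<nu>) - (\<integral>x. ?h k x \<partial>\<nu>)\<^sup>2) \<longlonglongrightarrow> (\<integral>x. (f (T x))\<^sup>2 \<partial>\<nu>) - (\<integral>x. f (T x) \<partial>\<nu>)\<^sup>2"
      by (intro tendsto_diff tendsto_power l1 l2)
    show "(\<lambda>k. lambda_max \<Sigma> * ((1 + ?q k) * m * ?A + 16 * ((?q k)\<^sup>2 + ?q k) * ?B))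
        \<longlonglongrightarrow> lambda_max \<Sigma> * ((1 + 0) * m * ?A + 16 * (0\<^sup>2 + 0) * ?B)"
      by (intro tendsto_mult tendsto_add tendsto_const tendsto_power LIMSEQ_inverse_real_of_nat)
  qed (use le in blast)
  moreover have "(\<integral>x. (f (T x))\<^sup>2 \<partial>\<nu>) = ?B" using integral_T(1)[of "\<lambda>y. (f y)\<^sup>2"] by simp
  moreover have "(\<integral>x. f (T x) \<partial>\<nu>) = (\<integral>y. f y \<partial>\<mu>)" by (rule integral_T(1)[OF fm])
  ultimately show "(\<integral>x. (f x)\<^sup>2 \<partial>\<mu>) - (\<integral>x. f x \<partial>\<mu>)\<^sup>2 \<le> lambda_max \<Sigma> * m * (\<integral>x. (norm (G x))\<^sup>2 \<partial>\<mu>)"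
    by (simp add: mult.assoc)
qed

end

section \<open>The optimal constant\<close>

text \<open>Gradients are unique, so \<open>D\<close> is the continuous one that \<open>Ck\<close> provides.\<close>
lemma Ck_1_imp_continuous_gradient:
  assumes "Ck (Suc 0) \<phi>" and D: "\<And>x. GDERIV \<phi> x :> D x"
  shows "continuous_on UNIV D"
proof -
  obtain D' where D': "\<And>x. GDERIV \<phi> x :> D' x" "\<And>i. continuous_on UNIV (\<lambda>x. D' x $ i)"
    using assms(1) by auto
  have "D' = D"
  proof
    fix x
    have "(\<lambda>h. h \<bullet> D' x) = (\<lambda>h. h \<bullet> D x)"
      using D'(1)[of x] D[of x] unfolding gderiv_def by (rule has_derivative_unique)
    then have "(D' x - D x) \<bullet> (D' x - D x) = 0" by (metis cancel_comm_monoid_add_class.diff_cancel inner_diff_right)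
    then show "D' x = D x" by simp
  qed
  with D'(2) show ?thesis
    by (subst continuous_on_componentwise) (auto simp: Basis_vec_def inner_axis)
qed

text \<open>The derivatives of the compactly supported function \<open>f * \<phi>\<close> have integral 0.\<close>
lemma classical_gradient_is_weak_gradient:
  fixes f :: "real^'n \<Rightarrow> real"
  assumes df: "\<And>x. GDERIV f x :> G x" and cG: "continuous_on UNIV G"
  shows "weak_gradient \<Omega> f G"
  unfolding weak_gradient_def
proof (intro conjI allI impI)
  have df': "(f has_derivative (\<lambda>v. v \<bullet> G x)) (at x)" for x using df[of x] by (simp add: gderiv_def)
  have cf: "continuous_on UNIV f" using df' by (meson continuous_at_imp_continuous_on has_derivative_continuous)
  show "locally_integrable_on f \<Omega>" "locally_integrable_on G \<Omega>"
    unfolding locally_integrable_on_def set_integrable_def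
    by (intro allI impI borel_integrable_compact continuous_on_subset[OF cf] continuous_on_subset[OF cG]
        subset_UNIV; erule conjunct1)+
  fix \<phi> D i assume \<phi>: "test_function \<Omega> \<phi>" and D: "\<forall>x. GDERIV \<phi> x :> D x"
  obtain K where K: "compact K" "K \<subseteq> \<Omega>" "\<And>x. x \<notin> K \<Longrightarrow> \<phi> x = 0" using \<phi> unfolding test_function_def by blast
  have "Ck (Suc 0) \<phi>" using \<phi> unfolding test_function_def by blast
  then have cD: "continuous_on UNIV D" by (rule Ck_1_imp_continuous_gradient) (use D in blast)
  have d\<phi>: "(\<phi> has_derivative (\<lambda>v. v \<bullet> D x)) (at x)" for x using D by (simp add: gderiv_def)
  have c\<phi>: "continuous_on UNIV \<phi>" using d\<phi> by (meson continuous_at_imp_continuous_on has_derivative_continuous)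
  have D0: "D x = 0" if "x \<notin> K" for x
  proof -
    have "(\<lambda>v. v \<bullet> D x) = (\<lambda>_. 0)"
      by (rule has_derivative_eq_0_outside_support[OF compact_imp_closed[OF K(1)] K(3) d\<phi> that])
    then have "D x \<bullet> D x = 0" by meson
    then show ?thesis by simp
  qed
  then have D0': "D x = 0" if "x \<notin> \<Omega>" for x using K(2) that by blast
  have i1: "integrable lborel (\<lambda>x. f x * D x $ i)"
    by (rule integrable_continuous_compact_support[OF _ K(1)])
       (auto intro!: continuous_intros cf cD simp: D0)
  have i2: "integrable lborel (\<lambda>x. G x $ i * \<phi> x)"
    by (rule integrable_continuous_compact_support[OF _ K(1)])
       (auto intro!: continuous_intros c\<phi> cG simp: K(3))
  let ?F' = "\<lambda>x v. f x * (v \<bullet> D x) + (v \<bullet> G x) * \<phi> x"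
  have e: "?F' x (axis i 1) = f x * D x $ i + G x $ i * \<phi> x" for x by (simp add: inner_axis')
  have ce: "continuous_on UNIV (\<lambda>x. f x * D x $ i + G x $ i * \<phi> x)"
    by (intro continuous_intros cf cD cG c\<phi>)
  have "compact ((\<lambda>x. f x * D x $ i + G x $ i * \<phi> x) ` K)"
    by (intro compact_continuous_image K continuous_on_subset[OF ce]) simp
  then obtain B where B: "\<forall>y \<in> (\<lambda>x. f x * D x $ i + G x $ i * \<phi> x) ` K. norm y \<le> B"
    by (auto simp: bounded_iff dest!: compact_imp_bounded)
  have "(\<integral>x. ?F' x (axis i 1) \<partial>lborel) = 0"
  proof (rule integral_directional_derivative_eq_0[OF K(1), where F = "\<lambda>x. f x * \<phi> x"])
    fix x
    show "((\<lambda>x. f x * \<phi> x) has_derivative ?F' x) (at x)" by (rule has_derivative_mult[OF df' d\<phi>])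
    show "x \<notin> K \<Longrightarrow> f x * \<phi> x = 0" by (simp add: K(3))
    show "\<bar>?F' x (axis i 1)\<bar> \<le> max 0 B"
      unfolding e using B D0[of x] K(3)[of x] by (cases "x \<in> K") (auto simp: le_max_iff_disj)
    show "(\<lambda>x. ?F' x (axis i 1)) \<in> borel_measurable borel"
      unfolding e by (rule borel_measurable_continuous_onI[OF ce])
  qed
  then have "(\<integral>x. f x * D x $ i \<partial>lborel) = - (\<integral>x. G x $ i * \<phi> x \<partial>lborel)"
    unfolding e Bochner_Integration.integral_add[OF i1 i2] by simp
  moreover have "(LINT x:\<Omega>|lborel. f x * D x $ i) = (\<integral>x. f x * D x $ i \<partial>lborel)"
    unfolding set_lebesgue_integral_def
    by (rule Bochner_Integration.integral_cong[OF refl]) (auto simp: indicator_def D0')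
  moreover have "(LINT x:\<Omega>|lborel. G x $ i * \<phi> x) = (\<integral>x. G x $ i * \<phi> x \<partial>lborel)"
    unfolding set_lebesgue_integral_def
    by (rule Bochner_Integration.integral_cong[OF refl]) (use K(2,3) in \<open>auto simp: indicator_def\<close>)
  ultimately show "(LINT x:\<Omega>|lborel. f x * D x $ i) = - (LINT x:\<Omega>|lborel. G x $ i * \<phi> x)" by simp
qed

text \<open>For each \<open>f\<close> the admissible constants form a closed set, bounded below by the quotient of variance
  and energy when the energy is positive.\<close>
lemma poincare_inequality_Inf:
  fixes \<Omega> :: "(real^'n) set" and \<mu> :: "(real^'n) measure"
  assumes ne: "A \<noteq> {}" and A: "\<And>C. C \<in> A \<Longrightarrow> poincare_inequality \<Omega> \<mu> C"
  shows "poincare_inequality \<Omega> \<mu> (Inf A)"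
  unfolding poincare_inequality_def
proof (intro allI impI)
  fix f :: "real^'n \<Rightarrow> real" and G
  assume f: "f \<in> borel_measurable \<mu>" "integrable \<mu> (\<lambda>x. (f x)\<^sup>2)" "weak_gradient \<Omega> f G" "integrable \<mu> (\<lambda>x. (norm (G x))\<^sup>2)"
  let ?V = "(\<integral>x. (f x)\<^sup>2 \<partial>\<mu>) - (\<integral>x. f x \<partial>\<mu>)\<^sup>2" and ?E = "\<integral>x. (norm (G x))\<^sup>2 \<partial>\<mu>"
  have le: "?V \<le> C * ?E" if "C \<in> A" for C using A[OF that] f unfolding poincare_inequality_def by blast
  have E0: "0 \<le> ?E" by (intro Bochner_Integration.integral_nonneg) simp
  show "?V \<le> Inf A * ?E"
  proof (cases "?E = 0")
    case True
    obtain C where "C \<in> A" using ne by blast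
    from le[OF this] show ?thesis unfolding True by simp
  next
    case False
    then have E: "0 < ?E" using E0 by (simp only: order_less_le) simp
    have "?V / ?E \<le> Inf A"
      by (rule cInf_greatest[OF ne]) (use le E in \<open>simp add: divide_le_eq\<close>)
    then show ?thesis using E by (simp add: divide_le_eq)
  qed
qed

context nataf_model
begin

lemma mu_not_null_open:
  assumes U: "open U" "U \<noteq> {}" "U \<subseteq> \<Omega>"
  shows "\<not> (AE x in \<mu>. x \<notin> U)"
proof
  assume "AE x in \<mu>. x \<notin> U"
  then have "AE x in lborel. 0 < ennreal (\<rho> x) \<longrightarrow> x \<notin> U"
    unfolding density using density_measurable by (subst (asm) AE_density) auto
  then have AE: "AE x in lborel. x \<notin> U"
    by eventually_elim (use density_pos U(3) in \<open>auto simp: ennreal_less_zero_iff\<close>)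
  obtain x e where x: "0 < e" "ball x e \<subseteq> U" using U(1,2) open_contains_ball by blast
  from AE have "AE y in lborel. y \<notin> ball x e" by eventually_elim (use x(2) in blast)
  then have "emeasure lborel (ball x e) = 0" by (subst (asm) AE_iff_measurable[of "ball x e"]) auto
  moreover have "0 < measure lborel (ball x e)" by (rule content_ball_pos[OF x(1)])
  ultimately show False by (simp add: measure_def)
qed

text \<open>A bump function with support inside \<open>\<Omega>\<close> is positive on one ball and zero on another. Neither ball is
  a null set, so the function is not almost everywhere constant and has positive variance.\<close>
lemma not_poincare_inequality_0: "\<not> poincare_inequality \<Omega> \<mu> 0"
proof
  assume P0: "poincare_inequality \<Omega> \<mu> 0"
  interpret U: prob_space \<mu> by (rule prob)
  define x where "x = T 0"
  obtain e where e: "0 < e" "cball x e \<subseteq> \<Omega>"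
    using open_domain T_in[of 0] open_contains_cball unfolding x_def by blast
  define r where "r = e / 2"
  have r: "0 < r" using e by (simp add: r_def)
  let ?f = "\<lambda>y. bump r (y - x)" and ?G = "\<lambda>y. bump_poly_grad 1 r (y - x)"
  have df: "GDERIV ?f y :> ?G y" for y by (rule GDERIV_translate[OF bump_poly_gderiv])
  have cG: "continuous_on UNIV ?G"
    unfolding bump_poly_grad_def
    by (intro continuous_intros continuous_on_compose2[OF continuous_bump_poly[of UNIV]]) auto
  have m[measurable]: "?f \<in> borel_measurable borel" "?G \<in> borel_measurable borel" by measurable
  obtain B where B: "0 \<le> B" "\<And>z :: real^'n. \<bar>bump r z\<bar> \<le> B" "\<And>z :: real^'n. norm (bump_poly_grad 1 r z) \<le> B"
    by (rule bump_poly_bounded[OF r, of 1]) blast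
  have f2: "integrable \<mu> (\<lambda>y. (?f y)\<^sup>2)"
  proof (rule U.integrable_const_bound[of _ "B\<^sup>2"])
    show "AE y in \<mu>. norm ((?f y)\<^sup>2) \<le> B\<^sup>2" using B(1) B(2) by (intro AE_I2) (simp add: abs_le_square_iff[symmetric])
  qed measurable
  have G2: "integrable \<mu> (\<lambda>y. (norm (?G y))\<^sup>2)"
  proof (rule U.integrable_const_bound[of _ "B\<^sup>2"])
    show "AE y in \<mu>. norm ((norm (?G y))\<^sup>2) \<le> B\<^sup>2" using B(1) B(3) by (intro AE_I2) (simp add: abs_le_square_iff[symmetric])
  qed measurable
  have f1: "integrable \<mu> ?f" by (rule U.integrable_of_square[OF _ f2]) measurable
  define M where "M = (\<integral>y. ?f y \<partial>\<mu>)"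
  have V: "(\<integral>y. (?f y)\<^sup>2 \<partial>\<mu>) - M\<^sup>2 \<le> 0"
  proof -
    have "?f \<in> borel_measurable \<mu>" by measurable
    then have "(\<integral>y. (?f y)\<^sup>2 \<partial>\<mu>) - (\<integral>y. ?f y \<partial>\<mu>)\<^sup>2 \<le> 0 * (\<integral>y. (norm (?G y))\<^sup>2 \<partial>\<mu>)"
      using P0[unfolded poincare_inequality_def, rule_format, of ?f ?G] f2 G2
        classical_gradient_is_weak_gradient[OF df cG] by blast
    then show ?thesis by (simp add: M_def)
  qed
  have i: "integrable \<mu> (\<lambda>y. (?f y - M)\<^sup>2)"
    using f1 f2 by (simp add: power2_diff)
  have "(\<integral>y. (?f y - M)\<^sup>2 \<partial>\<mu>) = (\<integral>y. (?f y)\<^sup>2 \<partial>\<mu>) - M\<^sup>2"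
    using U.variance_eq[OF f1 f2] by (simp add: M_def)
  then have "(\<integral>y. (?f y - M)\<^sup>2 \<partial>\<mu>) = 0"
    using V Bochner_Integration.integral_nonneg[of \<mu> "\<lambda>y. (?f y - M)\<^sup>2"] by simp
  then have "AE y in \<mu>. (?f y - M)\<^sup>2 = 0"
    using integral_nonneg_eq_0_iff_AE[OF i] by simp
  then have AE: "AE y in \<mu>. ?f y = M" by eventually_elim simp
  have "M = 0"
  proof (rule ccontr)
    assume M: "M \<noteq> 0"
    \<comment> \<open>the centre of a ball between the support of the bump function and the sphere of radius \<open>2 * r\<close>\<close>
    define y0 where "y0 = x + (3 * r / 2) *\<^sub>R axis undefined 1"
    have far: "?f y = 0" "y \<in> \<Omega>" if y: "y \<in> ball y0 (r / 2)" for y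
    proof -
      have d: "dist x y0 = 3 * r / 2" using r by (simp add: y0_def dist_norm)
      have "dist x y0 \<le> dist x y + dist y0 y" "dist x y \<le> dist x y0 + dist y0 y"
        by (metis dist_triangle dist_commute)+
      then have *: "r < dist x y" "dist x y \<le> 2 * r" using y d by auto
      then have "y - x \<notin> cball 0 r" by (simp only: mem_cball_0 dist_norm norm_minus_commute[of x y] not_le)
      then show "?f y = 0" by (rule bump_poly_support[OF r])
      show "y \<in> \<Omega>" using * e(2) by (auto simp: r_def)
    qed
    from AE have "AE y in \<mu>. y \<notin> ball y0 (r / 2)" by eventually_elim (use far(1) M in auto)
    moreover have "ball y0 (r / 2) \<noteq> {}" using r by simp
    ultimately show False using mu_not_null_open[of "ball y0 (r / 2)"] far(2) by blast
  qed
  have near: "0 < ?f y" "y \<in> \<Omega>" if y: "y \<in> ball x r" for y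
  proof -
    show "0 < ?f y" using y by (intro bump_pos) (simp add: dist_norm norm_minus_commute)
    show "y \<in> \<Omega>" using y e by (auto simp: r_def)
  qed
  from AE have "AE y in \<mu>. y \<notin> ball x r" by eventually_elim (use near(1) \<open>M = 0\<close> in force)
  moreover have "ball x r \<noteq> {}" using r by simp
  ultimately show False using mu_not_null_open[of "ball x r"] near(2) by blast
qed

theorem poincare_constant_bound:
  "0 < poincare_constant \<Omega> \<mu> \<and> poincare_inequality \<Omega> \<mu> (poincare_constant \<Omega> \<mu>) \<and>
    poincare_constant \<Omega> \<mu> \<le> lambda_max \<Sigma> * (MAX i. 1 / \<kappa> i)"
proof -
  let ?A = "{C. 0 < C \<and> poincare_inequality \<Omega> \<mu> C}" and ?m = "MAX i. 1 / \<kappa> i"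
  have m: "1 / \<kappa> i \<le> ?m" for i by (rule Max_ge) auto
  have "0 < 1 / \<kappa> undefined" using kappa_pos by simp
  also have "\<dots> \<le> ?m" by (rule m)
  finally have "0 < lambda_max \<Sigma> * ?m" using lambda_max_ge_1 by (intro mult_pos_pos) auto
  then have A: "lambda_max \<Sigma> * ?m \<in> ?A" using poincare_inequality_nataf[OF m] by simp
  have bdd: "bdd_below ?A" by (rule bdd_belowI[of _ 0]) auto
  have P: "poincare_inequality \<Omega> \<mu> (Inf ?A)" by (rule poincare_inequality_Inf) (use A in auto)
  have "0 \<le> Inf ?A" by (rule cInf_greatest) (use A in auto)
  moreover have "Inf ?A \<noteq> 0" using P not_poincare_inequality_0 by metis
  moreover have "Inf ?A \<le> lambda_max \<Sigma> * ?m" by (rule cInf_lower[OF A bdd])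
  ultimately show ?thesis using P unfolding poincare_constant_def by simp
qed

end

theorem proposition5p2:
  fixes \<Omega> :: "(real^'n) set"
    and \<mu> :: "(real^'n) measure"
    and \<rho> :: "real^'n \<Rightarrow> real"
    and \<Sigma> :: "real^'n^'n"
    and C :: "real^'n \<Rightarrow> real"
    and \<kappa> :: "'n \<Rightarrow> real"
  assumes "open \<Omega>" and "connected \<Omega>" and "piecewise_C1_boundary \<Omega>"
    and "prob_space \<mu>"
    and "\<rho> \<in> borel_measurable borel"
    and "\<mu> = density lborel (\<lambda>x. ennreal (\<rho> x))"
    and "\<And>x. x \<in> \<Omega> \<Longrightarrow> 0 < \<rho> x" and "\<And>x. x \<notin> \<Omega> \<Longrightarrow> \<rho> x = 0"
    and "symmetric_positive_definite \<Sigma>"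
    and "\<And>i. \<Sigma> $ i $ i = 1"
    and "\<And>i j. i \<noteq> j \<Longrightarrow> \<Sigma> $ i $ j \<in> {-1<..<1}"
    and "gaussian_copula \<Sigma> C" and "copula_of \<mu> C"
    and "diffeomorphism UNIV \<Omega> (nataf \<mu>)"
    and "\<And>i. uniformly_log_concave (marginal \<mu> i) (\<kappa> i)"
  shows "0 < poincare_constant \<Omega> \<mu> \<and>
    poincare_inequality \<Omega> \<mu> (poincare_constant \<Omega> \<mu>) \<and>
    poincare_constant \<Omega> \<mu> \<le> lambda_max \<Sigma> * (MAX i. 1 / \<kappa> i)"
proof -
  have "nataf_model \<Omega> \<mu> \<rho> \<Sigma> C \<kappa>"
    by (rule nataf_model.intro) (fact assms)+
  then show ?thesis by (rule nataf_model.poincare_constant_bound)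
qed

end
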